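(* Let $1<p<\infty$ and let $\Phi$ be a Young function with complementary Young function $\bar\Phi$. (i) Suppose that $\bar\Phi\in B_p^*$. Let $(u,v)$ be a couple of weights on $\mathbf R^n$ such that $u^p$ satisfies condition $(A)$ and such that, for some positive constant $K$, $$\left(\frac{1}{|R|}\int_R u^p\,dx\right)^{1/p}\|v^{-1}\|_{\Phi,R}\le K\qquad\text{for all rectangles } R\in\mathcal R .$$ Then there is a constant $C$ such that $$\int_{\mathbf R^n}(u\,M_{\mathcal R}f)^p\,dx\le C\int_{\mathbf R^n}(vf)^p\,dx$$ for all non-negative functions $f$. (ii) Conversely, suppose that $\Phi$ has the property that $M_{\mathcal R}$ is bounded from $L^p(v^p)$ to $L^p(u^p)$ whenever the couple of weights $(u,v)$ satisfies $$\left(\frac{1}{|R|}\int_R u^p\,dx\right)^{1/p}\|v^{-1}\|_{\Phi,R}\le K$$ for some positive constant $K$ and for all rectangles $R\in\mathcal R$. Then $\bar\Phi\in B_p^*$.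
   Context: $\mathcal R$ is the family of all (bounded, open) rectangles in $\mathbf R^n$ with sides parallel to the coordinate axes. A weight is a non-negative measurable function $w$ on $\mathbf R^n$ with $w(R)=\int_R w\,dx<\infty$ for every $R\in\mathcal R$; we write $w(E)=\int_E w\,dx$. The strong maximal function is $$M_{\mathcal R}f(x)=\sup_{R\ni x,\,R\in\mathcal R}\frac1{|R|}\int_R|f(y)|\,dy .$$ $L^p(w)$ denotes $L^p(\mathbf R^n, w\,dx)$. A Young function is a continuous, convex, strictly increasing function $\Phi:[0,\infty)\to[0,\infty)$ with $\Phi(0)=0$ and $\Phi(t)\to\infty$ as $t\to\infty$. Its complementary function is $\bar\Phi(s)=\sup_{t>0}\{st-\Phi(t)\}$, $s\ge0$. For a set $E$ of finite positive measure, the normalized Luxemburg norm is $$\|f\|_{\Phi,E}=\inf\Big\{\lambda>0:\frac1{|E|}\int_E\Phi\Big(\frac{|f(x)|}{\lambda}\Big)dx\le1\Big\}.$$ Class $B_p^*$: for $1<p<\infty$, a function $\Psi$ (a Young function, or the complementary function of one) satisfies $\Psi\in B_p^*$ if there is a constant $c>0$ such that $$\int_c^\infty\frac{\Phi_n(\Psi(t))}{t^p}\,\frac{dt}{t}<\infty,\qquad \Phi_n(t):=t[\log(e+t)]^{n-1}.$$ Condition $(A)$: a weight $w$ satisfies $(A)$ if there are constants $0<\lambda<1$ and $0<c(\lambda)<\infty$ such that $$w\big(\{x\in\mathbf R^n: M_{\mathcal R}(\chi_E)(x)>\lambda\}\big)\le c(\lambda)\,w(E)$$ for all measurable sets $E$.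 *)

theory Defs
  imports "HOL-Analysis.Analysis"
begin

(* The sources of infinite values (v^{-1} where v = 0, the strong maximal function, the
   complementary function of a Young function of linear growth) are kept: such quantities live in
   ennreal, where inverse 0 = \<infinity> and 0 * \<infinity> = 0.  A real function tending to \<infinity> at \<infinity> is evaluated
   on ennreal through the following extension. *)

definition ext_infty :: "(real \<Rightarrow> real) \<Rightarrow> ennreal \<Rightarrow> ennreal" where
  "ext_infty \<phi> x = (if x = \<infinity> then \<infinity> else ennreal (\<phi> (enn2real x)))"

(* intended for exponents p > 0 only *)
definition epowr :: "ennreal \<Rightarrow> real \<Rightarrow> ennreal" where
  "epowr x p = ext_infty (\<lambda>t. t powr p) x"

definition rectangles :: "(real ^ 'n) set set" where
  "rectangles = {box a b | a b. \<forall>i. a $ i < b $ i}"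

definition average :: "(real ^ 'n) set \<Rightarrow> (real ^ 'n \<Rightarrow> ennreal) \<Rightarrow> ennreal" where
  "average E g = (\<integral>\<^sup>+x\<in>E. g x \<partial>lebesgue) / emeasure lebesgue E"

definition weighted_measure :: "(real ^ 'n \<Rightarrow> real) \<Rightarrow> (real ^ 'n) set \<Rightarrow> ennreal" where
  "weighted_measure w E = (\<integral>\<^sup>+x\<in>E. ennreal (w x) \<partial>lebesgue)"

definition weight :: "(real ^ 'n \<Rightarrow> real) \<Rightarrow> bool" where
  "weight w \<longleftrightarrow> w \<in> borel_measurable lebesgue \<and> (\<forall>x. 0 \<le> w x) \<and>
     (\<forall>R\<in>rectangles. weighted_measure w R < \<infinity>)"

definition strong_maximal :: "(real ^ 'n \<Rightarrow> real) \<Rightarrow> real ^ 'n \<Rightarrow> ennreal" where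
  "strong_maximal f x = (SUP R\<in>{R \<in> rectangles. x \<in> R}. average R (\<lambda>y. ennreal \<bar>f y\<bar>))"

definition young_function :: "(real \<Rightarrow> real) \<Rightarrow> bool" where
  "young_function \<Phi> \<longleftrightarrow>
     continuous_on {0..} \<Phi> \<and> convex_on {0..} \<Phi> \<and> strict_mono_on {0..} \<Phi> \<and>
     (\<forall>t\<ge>0. 0 \<le> \<Phi> t) \<and> \<Phi> 0 = 0 \<and> filterlim \<Phi> at_top at_top"

(* Truncating s t - \<Phi>(t) at 0 does not change the supremum: s t - \<Phi>(t) tends to 0 as t \<rightarrow> 0+,
   so the supremum is non-negative.  It may be \<infinity>. *)
definition complementary :: "(real \<Rightarrow> real) \<Rightarrow> real \<Rightarrow> ennreal" where
  "complementary \<Phi> s = (SUP t\<in>{0<..}. ennreal (s * t - \<Phi> t))"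

(* The infimum over the empty set is \<infinity>. *)
definition luxemburg_norm ::
    "(real \<Rightarrow> real) \<Rightarrow> (real ^ 'n) set \<Rightarrow> (real ^ 'n \<Rightarrow> ennreal) \<Rightarrow> ennreal" where
  "luxemburg_norm \<Phi> E g =
     (INF l\<in>{l::real. 0 < l \<and> average E (\<lambda>x. ext_infty \<Phi> (g x / ennreal l)) \<le> 1}. ennreal l)"

definition Phi_n :: "nat \<Rightarrow> real \<Rightarrow> real" where
  "Phi_n n t = t * (ln (exp 1 + t)) ^ (n - 1)"

definition B_star :: "nat \<Rightarrow> real \<Rightarrow> (real \<Rightarrow> ennreal) \<Rightarrow> bool" where
  "B_star n p \<Psi> \<longleftrightarrow>
     (\<exists>c>0. (\<integral>\<^sup>+t\<in>{c..}. ext_infty (Phi_n n) (\<Psi> t) / ennreal (t powr p) / ennreal t \<partial>lebesgue) < \<infinity>)"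

definition condition_A :: "(real ^ 'n \<Rightarrow> real) \<Rightarrow> bool" where
  "condition_A w \<longleftrightarrow> weight w \<and>
     (\<exists>l c::real. 0 < l \<and> l < 1 \<and> 0 < c \<and>
        (\<forall>E\<in>sets lebesgue.
           weighted_measure w {x. strong_maximal (indicator E) x > ennreal l}
             \<le> ennreal c * weighted_measure w E))"

definition bump_condition ::
    "real \<Rightarrow> (real \<Rightarrow> real) \<Rightarrow> (real ^ 'n \<Rightarrow> real) \<Rightarrow> (real ^ 'n \<Rightarrow> real) \<Rightarrow> real \<Rightarrow> bool" where
  "bump_condition p \<Phi> u v K \<longleftrightarrow>
     (\<forall>R\<in>rectangles.
        epowr (average R (\<lambda>x. ennreal (u x powr p))) (1 / p) *
          luxemburg_norm \<Phi> R (\<lambda>x. inverse (ennreal (v x))) \<le> ennreal K)"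

definition weighted_Lp_norm ::
    "real \<Rightarrow> (real ^ 'n \<Rightarrow> real) \<Rightarrow> (real ^ 'n \<Rightarrow> ennreal) \<Rightarrow> ennreal" where
  "weighted_Lp_norm p w g =
     epowr (\<integral>\<^sup>+x. epowr (g x) p \<partial>density lebesgue (\<lambda>x. ennreal (w x))) (1 / p)"

definition strong_maximal_bounded ::
    "real \<Rightarrow> (real ^ 'n \<Rightarrow> real) \<Rightarrow> (real ^ 'n \<Rightarrow> real) \<Rightarrow> bool" where
  "strong_maximal_bounded p w\<^sub>1 w\<^sub>2 \<longleftrightarrow>
     (\<exists>C::real. 0 < C \<and>
        (\<forall>f\<in>borel_measurable lebesgue.
           weighted_Lp_norm p w\<^sub>1 (\<lambda>x. ennreal \<bar>f x\<bar>) < \<infinity> \<longrightarrow>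
           weighted_Lp_norm p w\<^sub>2 (strong_maximal f)
             \<le> ennreal C * weighted_Lp_norm p w\<^sub>1 (\<lambda>x. ennreal \<bar>f x\<bar>)))"

end

theory Submission
  imports Defs
begin

text \<open>
Write \<Psi> for the complementary function of \<Phi>, n for the dimension, P(x) for the product of
the numbers max 1 |x_i|, and |E| for Lebesgue measure. Both implications rest on one piece of
information about rectangles, seen from two sides: the strong maximal function of a function g has
a weak-type bound with gauge t (log t)^(n-1) (\<open>jessen_marcinkiewicz_zygmund\<close>), and this
gauge is attained by the indicator of a cube, because {P \<le> s} has measure at least a multiple of
s (log s)^(n-1) (\<open>hyperbolic_region_lower\<close>).

Sufficiency. The maximal function of f is the supremum of b 1_R over countably many pairs (R, b)
with b < avg_R f, so it is enough to bound the maximum over a finite family with a constant that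
does not depend on the family. Put the pairs in order of decreasing b and select greedily the
rectangles that overlap the previously selected ones by at most a fraction \<lambda>. A rejected
rectangle lies in the set where the maximal function of the indicator of the union of the
selected ones with larger b exceeds \<lambda>, so condition (A) turns the u^p-measure of every level set into the sum of the
u^p-measures of selected rectangles (\<open>condition_A_selection\<close>). For one rectangle, Young's
inequality f \<le> l (\<Psi>(v f) + \<Phi>(1 / (v l))), suitably scaled, converts the bump condition into the
statement that b^p u^p(R) is at most a constant times N^p |R|, where the average of \<Psi>(s v f) over
R exceeds 1 as soon as s N > 1 (\<open>bump_condition_testing\<close>). The selected rectangles have
disjoint parts of comparable measure, so the sum of N^p |R| is controlled by integrating
|{M(\<Psi>(s v f)) > 1}| against s^(-p-1) ds. The weak-type bound and the substitution s \<mapsto> s v f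
reduce this to (v f)^p times the integral that defines the class B_p^*
(\<open>scattered_sum_le\<close>). The gauge in the weak-type bound vanishes near 0; this is what makes
that last integral converge at s = 0.

Necessity. One explicit pair is enough: u = \<Phi>^{-1}(P) and v the product of the 1 + x_i^2. Since
1 / v has averages at most 8^n / sup_R P over every rectangle R, and \<Phi>(\<theta> t) \<le> \<theta> \<Phi>(t) for
\<theta> \<le> 1, the pair satisfies the bump condition (\<open>bump_condition_test_pair\<close>). Testing
boundedness on the cube |x_i| < 1, whose maximal function is at least 2^{-n} / P, gives a finite
integral of (\<Phi>^{-1}(P) / P)^p. Because \<Psi>(t) \<ge> P forces t \<ge> P / \<Phi>^{-1}(P), that integral bounds
the integral of t^(-p-1) |{P \<le> \<Psi>(t)}| dt by Tonelli's theorem, and the measure of the hyperbolic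
region is at least a multiple of the gauge of the class B_p^* (\<open>hyperbolic_integral_imp_B_star\<close>).
\<close>

section \<open>The one-dimensional maximal function\<close>

text \<open>
Only intervals with rational end points enter. The supremum is then countable, which gives
measurability at once, also with respect to parameters; no size is lost, by
\<open>interval_integral_le_max_1d\<close>.
\<close>
definition max_1d :: "(real \<Rightarrow> ennreal) \<Rightarrow> real \<Rightarrow> ennreal" where
  "max_1d g y = (SUP I\<in>{(a, b) \<in> \<rat> \<times> \<rat>. a < b}.
     case I of (a, b) \<Rightarrow> indicator {a<..<b} y *
       ((\<integral>\<^sup>+z. g z * indicator {a<..<b} z \<partial>lborel) / ennreal (b - a)))"

lemma countable_rat_intervals: "countable {(a, b) \<in> \<rat> \<times> \<rat>. a < (b::real)}"
  by (rule countable_subset[of _ "\<rat> \<times> \<rat>"]) (auto simp: countable_rat)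

text \<open>
Vitali's lemma selects disjoint intervals whose fivefold enlargements cover the union; the
integrals over the selected ones add up to at most the whole integral.
\<close>

lemma weak_type_finite:
  fixes g :: "real \<Rightarrow> ennreal"
  assumes [measurable]: "g \<in> borel_measurable borel" and t: "0 < t" and fin: "finite K"
    and K: "\<And>a b. (a, b) \<in> K \<Longrightarrow> a < b \<and>
        ennreal t * ennreal (b - a) \<le> (\<integral>\<^sup>+z. g z * indicator {a<..<b} z \<partial>lborel)"
  shows "emeasure lborel (\<Union>(a, b)\<in>K. {a<..<b}) \<le> ennreal (5 / t) * (\<integral>\<^sup>+z. g z \<partial>lborel)"
proof -
  have [measurable]: "ball x e \<in> sets borel" for x e :: real by simp
  define m where "m = (\<lambda>(a, b). (a + b) / 2 :: real)"
  define r where "r = (\<lambda>(a, b). (b - a) / 2 :: real)"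
  define B where "B = (\<Sum>i\<in>K. r i)"
  have ball: "ball (m i) (r i) = {fst i<..<snd i}" for i
    by (auto simp: m_def r_def ball_eq_greaterThanLessThan field_simps split: prod.splits)
  have rpos: "0 < r i" if "i \<in> K" for i
    using K that by (auto simp: r_def split: prod.splits)
  have rB: "0 < r i \<and> r i \<le> B" if "i \<in> K" for i
    using rpos that unfolding B_def
    by (auto intro!: member_le_sum fin simp: less_imp_le)
  obtain C where C: "C \<subseteq> K" "pairwise (\<lambda>i j. disjnt (ball (m i) (r i)) (ball (m j) (r j))) C"
      "(\<Union>i\<in>K. ball (m i) (r i)) \<subseteq> (\<Union>i\<in>C. ball (m i) (5 * r i))"
    by (rule Vitali_covering_lemma_balls[OF subset_refl, where K=K and a=m and r=r and B=B]) (use rB in auto)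
  have finC: "finite C" using C(1) fin finite_subset by blast
  have disj: "disjoint_family_on (\<lambda>i. ball (m i) (r i)) C"
    using C(2) by (auto simp: disjoint_family_on_def pairwise_def disjnt_def)
  have "emeasure lborel (\<Union>(a, b)\<in>K. {a<..<b}) = emeasure lborel (\<Union>i\<in>K. ball (m i) (r i))"
    by (intro arg_cong[where f="emeasure lborel"]) (auto simp: ball split: prod.splits)
  also have "\<dots> \<le> emeasure lborel (\<Union>i\<in>C. ball (m i) (5 * r i))"
    using C(3) by (intro emeasure_mono) (auto intro!: borel_open open_UN)
  also have "\<dots> \<le> (\<Sum>i\<in>C. emeasure lborel (ball (m i) (5 * r i)))"
    by (intro emeasure_subadditive_finite finC) auto
  also have "\<dots> \<le> (\<Sum>i\<in>C. ennreal (5 / t) *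
       (\<integral>\<^sup>+z. g z * indicator (ball (m i) (r i)) z \<partial>lborel))"
  proof (rule sum_mono)
    fix i assume i: "i \<in> C"
    obtain a b where ab: "i = (a, b)" by force
    have k: "a < b" "ennreal t * ennreal (b - a) \<le> (\<integral>\<^sup>+z. g z * indicator {a<..<b} z \<partial>lborel)"
      using K i C(1) ab by auto
    have "emeasure lborel (ball (m i) (5 * r i)) = ennreal (5 * (b - a))"
      using k(1) by (simp add: ball_eq_greaterThanLessThan r_def m_def ab field_simps)
    also have "\<dots> = ennreal (5 / t) * (ennreal t * ennreal (b - a))"
      using t k(1) by (simp flip: ennreal_mult add: field_simps)
    also have "\<dots> \<le> ennreal (5 / t) * (\<integral>\<^sup>+z. g z * indicator {a<..<b} z \<partial>lborel)"
      using k(2) by (intro mult_left_mono) auto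
    finally show "emeasure lborel (ball (m i) (5 * r i)) \<le> ennreal (5 / t) *
       (\<integral>\<^sup>+z. g z * indicator (ball (m i) (r i)) z \<partial>lborel)"
      by (simp add: ball ab)
  qed
  also have "\<dots> = ennreal (5 / t) * (\<integral>\<^sup>+z. (\<Sum>i\<in>C. g z * indicator (ball (m i) (r i)) z) \<partial>lborel)"
    by (subst nn_integral_sum) (auto simp: sum_distrib_left borel_open)
  also have "\<dots> \<le> ennreal (5 / t) * (\<integral>\<^sup>+z. g z \<partial>lborel)"
  proof (intro mult_left_mono nn_integral_mono)
    fix z
    have "(indicator (\<Union>i\<in>C. ball (m i) (r i)) z :: ennreal) =
        (\<Sum>i\<in>C. indicator (ball (m i) (r i)) z)"
      by (rule indicator_UN_disjoint[OF finC disj])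
    then have "(\<Sum>i\<in>C. g z * indicator (ball (m i) (r i)) z) =
        g z * (indicator (\<Union>i\<in>C. ball (m i) (r i)) z)"
      by (simp flip: sum_distrib_left)
    also have "\<dots> \<le> g z" by (auto simp: indicator_def)
    finally show "(\<Sum>i\<in>C. g z * indicator (ball (m i) (r i)) z) \<le> g z" .
  qed auto
  finally show ?thesis .
qed

lemma measurable_max_1d [measurable]:
  "max_1d g \<in> borel_measurable borel"
  unfolding max_1d_def[abs_def]
  by (intro borel_measurable_SUP countable_rat_intervals) (auto split: prod.splits)

lemma max_1d_weak_type:
  assumes [measurable]: "g \<in> borel_measurable borel" and t: "0 < t"
  shows "emeasure lborel {y. ennreal t < max_1d g y} \<le> ennreal (5 / t) * (\<integral>\<^sup>+z. g z \<partial>lborel)"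
proof -
  define K where "K = {(a, b) \<in> \<rat> \<times> \<rat>. a < b \<and>
      ennreal t < (\<integral>\<^sup>+z. g z * indicator {a<..<b} z \<partial>lborel) / ennreal (b - a)}"
  have KK: "a < b \<and> ennreal t * ennreal (b - a) \<le> (\<integral>\<^sup>+z. g z * indicator {a<..<b} z \<partial>lborel)"
    if "(a, b) \<in> K" for a b
  proof -
    from that have *: "a < b" "ennreal t < (\<integral>\<^sup>+z. g z * indicator {a<..<b} z \<partial>lborel) / ennreal (b - a)"
      by (auto simp: K_def)
    have "ennreal t * ennreal (b - a) \<le>
       (\<integral>\<^sup>+z. g z * indicator {a<..<b} z \<partial>lborel) / ennreal (b - a) * ennreal (b - a)"
      using *(2) by (intro mult_right_mono) auto
    also have "\<dots> = (\<integral>\<^sup>+z. g z * indicator {a<..<b} z \<partial>lborel)"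
      using *(1) by (simp add: ennreal_divide_times ennreal_mult_divide_eq)
    finally show ?thesis using * by simp
  qed
  have eq: "{y. ennreal t < max_1d g y} = (\<Union>(a, b)\<in>K. {a<..<b})"
  proof (intro set_eqI iffI)
    fix y assume "y \<in> {y. ennreal t < max_1d g y}"
    then obtain a b where "a \<in> \<rat>" "b \<in> \<rat>" "a < b" and *: "ennreal t < indicator {a<..<b} y *
       ((\<integral>\<^sup>+z. g z * indicator {a<..<b} z \<partial>lborel) / ennreal (b - a))"
      unfolding max_1d_def less_SUP_iff mem_Collect_eq by auto
    then have "y \<in> {a<..<b}" "(a, b) \<in> K"
      by (cases "y \<in> {a<..<b}"; auto simp: K_def)+
    then show "y \<in> (\<Union>(a, b)\<in>K. {a<..<b})" by blast
  next
    fix y assume "y \<in> (\<Union>(a, b)\<in>K. {a<..<b})"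
    then obtain a b where "(a, b) \<in> K" "y \<in> {a<..<b}" by auto
    then show "y \<in> {y. ennreal t < max_1d g y}"
      unfolding max_1d_def less_SUP_iff mem_Collect_eq K_def
      by (intro bexI[of _ "(a, b)"]) auto
  qed
  have cK: "countable K"
    by (rule countable_subset[OF _ countable_rat_intervals]) (auto simp: K_def)
  show ?thesis
  proof (cases "K = {}")
    case False
    define A where "A n = (\<Union>(a, b)\<in>from_nat_into K ` {..n}. {a<..<b})" for n :: nat
    have incA: "incseq A"
      unfolding A_def incseq_def by (intro allI impI UN_mono image_mono) auto
    have openA: "open (A n)" for n unfolding A_def by (auto intro!: open_UN split: prod.splits)
    have "(\<Union>(a, b)\<in>K. {a<..<b}) = (\<Union>(a, b)\<in>range (from_nat_into K). {a<..<b})"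
      using False cK by (simp add: range_from_nat_into)
    also have "\<dots> = (\<Union>n. A n)" 
    proof -
      have "range (from_nat_into K) = (\<Union>n. from_nat_into K ` {..n})" by auto
      then show ?thesis unfolding A_def by (simp only: UN_UN_flatten)
    qed
    finally have "emeasure lborel {y. ennreal t < max_1d g y} = emeasure lborel (\<Union>n. A n)"
      using eq by simp
    also have "\<dots> = (SUP n. emeasure lborel (A n))"
      using incA openA by (intro SUP_emeasure_incseq[symmetric]) auto
    also have "\<dots> \<le> ennreal (5 / t) * (\<integral>\<^sup>+z. g z \<partial>lborel)"
    proof (intro SUP_least)
      fix n
      have sub: "from_nat_into K ` {..n} \<subseteq> K" using from_nat_into[OF False] by auto
      show "emeasure lborel (A n) \<le> ennreal (5 / t) * (\<integral>\<^sup>+z. g z \<partial>lborel)"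
        unfolding A_def
        by (rule weak_type_finite) (use sub KK t in auto)
    qed
    finally show ?thesis .
  qed (use eq in auto)
qed

text \<open>
The part of g below t / 2 contributes at most t / 2 to every average, so the level set at t is
contained in the level set at t / 2 of the part above t / 2. It is this form that can be iterated:
the untruncated bound would lose integrability at infinity in the layer-cake formula.
\<close>

lemma max_1d_weak_type_truncated:
  assumes [measurable]: "g \<in> borel_measurable borel" and t: "0 < t"
  shows "emeasure lborel {y. ennreal t < max_1d g y} \<le>
    ennreal (10 / t) * (\<integral>\<^sup>+z. g z * indicator {z. ennreal (t / 2) < g z} z \<partial>lborel)"
proof -
  define h where "h z = g z * indicator {z. ennreal (t / 2) < g z} z" for z
  have [measurable]: "h \<in> borel_measurable borel" by (simp add: h_def[abs_def])
  have gh: "g z \<le> h z + ennreal (t / 2)" for z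
    by (auto simp: h_def indicator_def)
  have "max_1d g y \<le> max_1d h y + ennreal (t / 2)" for y
    unfolding max_1d_def
  proof (rule SUP_least, clarify, goal_cases)
    case (1 a b)
    have "(\<integral>\<^sup>+z. g z * indicator {a<..<b} z \<partial>lborel) \<le>
       (\<integral>\<^sup>+z. h z * indicator {a<..<b} z + ennreal (t / 2) * indicator {a<..<b} z \<partial>lborel)"
      using gh by (intro nn_integral_mono) (auto simp: indicator_def)
    also have "\<dots> = (\<integral>\<^sup>+z. h z * indicator {a<..<b} z \<partial>lborel) + ennreal (t / 2) * ennreal (b - a)"
      using 1 by (subst nn_integral_add) (auto simp: nn_integral_cmult_indicator)
    finally have "(\<integral>\<^sup>+z. g z * indicator {a<..<b} z \<partial>lborel) / ennreal (b - a) \<le>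
       ((\<integral>\<^sup>+z. h z * indicator {a<..<b} z \<partial>lborel) + ennreal (t / 2) * ennreal (b - a)) / ennreal (b - a)"
      by (rule divide_right_mono_ennreal)
    also have "\<dots> = (\<integral>\<^sup>+z. h z * indicator {a<..<b} z \<partial>lborel) / ennreal (b - a) + ennreal (t / 2)"
      using 1 by (simp add: add_divide_distrib_ennreal ennreal_mult_divide_eq)
    finally have 2: "(\<integral>\<^sup>+z. g z * indicator {a<..<b} z \<partial>lborel) / ennreal (b - a) \<le>
       (\<integral>\<^sup>+z. h z * indicator {a<..<b} z \<partial>lborel) / ennreal (b - a) + ennreal (t / 2)" .
    have "indicator {a<..<b} y * ((\<integral>\<^sup>+z. g z * indicator {a<..<b} z \<partial>lborel) / ennreal (b - a))
       \<le> indicator {a<..<b} y * ((\<integral>\<^sup>+z. h z * indicator {a<..<b} z \<partial>lborel) / ennreal (b - a)) + ennreal (t / 2)"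
      using 2 by (auto simp: indicator_def)
    also have "\<dots> \<le> (SUP I\<in>{(a, b) \<in> \<rat> \<times> \<rat>. a < b}.
     case I of (a, b) \<Rightarrow> indicator {a<..<b} y *
       ((\<integral>\<^sup>+z. h z * indicator {a<..<b} z \<partial>lborel) / ennreal (b - a))) + ennreal (t / 2)"
      using 1 by (intro add_right_mono SUP_upper2[of "(a, b)"]) auto
    finally show ?case by simp
  qed
  moreover have "ennreal t = ennreal (t / 2) + ennreal (t / 2)"
    using t by (simp flip: ennreal_plus)
  ultimately have "{y. ennreal t < max_1d g y} \<subseteq> {y. ennreal (t / 2) < max_1d h y}"
    by (smt (verit, best) Collect_mono add_right_mono leD leI order_less_le_trans)
  then have "emeasure lborel {y. ennreal t < max_1d g y} \<le> emeasure lborel {y. ennreal (t / 2) < max_1d h y}"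
    by (intro emeasure_mono) auto
  also have "\<dots> \<le> ennreal (5 / (t / 2)) * (\<integral>\<^sup>+z. h z \<partial>lborel)"
    using t by (intro max_1d_weak_type) auto
  finally show ?thesis by (simp add: h_def)
qed

text \<open>
Enlarging the interval slightly to rational end points changes its length, but not the integral
from below.
\<close>

lemma interval_integral_le_max_1d:
  assumes "a < b" and y: "y \<in> {a<..<b}"
  shows "(\<integral>\<^sup>+z. g z * indicator {a<..<b} z \<partial>lborel) \<le> ennreal (b - a) * max_1d g y"
proof (cases "max_1d g y")
  case top
  then show ?thesis using assms by (simp add: ennreal_mult_top)
next
  case (real m)
  have "(\<integral>\<^sup>+z. g z * indicator {a<..<b} z \<partial>lborel) \<le> ennreal ((b - a) * m) + ennreal e" if e: "0 < e" for e
  proof -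
    define d where "d = e / (2 * (m + 1))"
    have d: "0 < d" "2 * d * m \<le> e" using e real by (auto simp: d_def field_simps)
    obtain a' where a': "a' \<in> \<rat>" "a - d < a'" "a' < a" using Rats_dense_in_real[of "a - d" a] d by auto
    obtain b' where b': "b' \<in> \<rat>" "b < b'" "b' < b + d" using Rats_dense_in_real[of b "b + d"] d by auto
    have "a' < b'" "y \<in> {a'<..<b'}" using a' b' assms by auto
    have "indicator {a'<..<b'} y * ((\<integral>\<^sup>+z. g z * indicator {a'<..<b'} z \<partial>lborel) / ennreal (b' - a')) \<le> max_1d g y"
      unfolding max_1d_def using a' b' \<open>a' < b'\<close>
      by (intro SUP_upper2[of "(a', b')"]) auto
    then have 1: "(\<integral>\<^sup>+z. g z * indicator {a'<..<b'} z \<partial>lborel) / ennreal (b' - a') \<le> ennreal m"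
      using \<open>y \<in> {a'<..<b'}\<close> real by simp
    have "(\<integral>\<^sup>+z. g z * indicator {a<..<b} z \<partial>lborel) \<le> (\<integral>\<^sup>+z. g z * indicator {a'<..<b'} z \<partial>lborel)"
      using a' b' by (intro nn_integral_mono) (auto simp: indicator_def)
    also have "\<dots> = ennreal (b' - a') * ((\<integral>\<^sup>+z. g z * indicator {a'<..<b'} z \<partial>lborel) / ennreal (b' - a'))"
      using \<open>a' < b'\<close> by (simp add: ennreal_times_divide ennreal_mult_divide_eq mult.commute[of "ennreal _"])
    also have "\<dots> \<le> ennreal (b' - a') * ennreal m"
      by (intro mult_left_mono 1) auto
    also have "\<dots> = ennreal ((b' - a') * m)"
      using \<open>a' < b'\<close> real by (simp add: ennreal_mult)
    also have "\<dots> \<le> ennreal ((b - a) * m + e)"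
    proof (rule ennreal_leI)
      have "(b' - a') * m \<le> (b - a + 2 * d) * m"
        using a' b' real by (intro mult_right_mono) auto
      then show "(b' - a') * m \<le> (b - a) * m + e"
        using d by (simp add: algebra_simps)
    qed
    also have "\<dots> = ennreal ((b - a) * m) + ennreal e"
      using e real assms by (simp add: ennreal_plus)
    finally show ?thesis .
  qed
  then have "(\<integral>\<^sup>+z. g z * indicator {a<..<b} z \<partial>lborel) \<le> ennreal ((b - a) * m)"
    by (rule ennreal_le_epsilon) auto
  then show ?thesis using real assms by (simp add: ennreal_mult)
qed

section \<open>The gauge of iterated maximal functions\<close>

text \<open>
Up to constants this is Phi_n cut off to 0 for s \<le> 2^{-k}. The constants are arranged so that
one more maximal function turns the k-th gauge into at most the next one. The cutoff comes from
the k truncations at half the level.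
\<close>

definition jmz_gauge :: "nat \<Rightarrow> real \<Rightarrow> real" where
  "jmz_gauge k s = (if (1 / 2) ^ k < s then 10 ^ k * s * (1 + ln (2 ^ k * s)) ^ (k - 1) else 0)"

lemma measurable_jmz_gauge [measurable]: "jmz_gauge k \<in> borel_measurable borel"
  unfolding jmz_gauge_def[abs_def] by measurable

lemma one_less_gauge_argument: "(1 / 2) ^ k < s \<Longrightarrow> 1 < 2 ^ k * (s::real)"
  by (simp add: power_one_over field_simps)

lemma jmz_gauge_nonneg: "0 \<le> jmz_gauge k s"
proof (cases "(1 / 2) ^ k < s")
  case True
  have "0 < s" using True by (smt (verit) zero_less_power half_gt_zero)
  moreover have "0 \<le> ln (2 ^ k * s)" using one_less_gauge_argument[OF True] by simp
  ultimately show ?thesis by (simp add: jmz_gauge_def)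
qed (simp add: jmz_gauge_def)

lemma layer_cake:
  assumes "sigma_finite_measure M" and [measurable]: "G \<in> borel_measurable M"
  shows "(\<integral>\<^sup>+x. G x \<partial>M) =
    (\<integral>\<^sup>+\<tau>. indicator {0<..} \<tau> * emeasure M {x \<in> space M. ennreal \<tau> < G x} \<partial>lborel)"
proof -
  interpret M: sigma_finite_measure M by fact
  interpret pair_sigma_finite M "lborel :: real measure" ..
  have G: "G x = (\<integral>\<^sup>+\<tau>. indicator {\<tau>. 0 < \<tau> \<and> ennreal \<tau> < G x} \<tau> \<partial>lborel)" for x
  proof (cases "G x")
    case (real r)
    have "{\<tau>. 0 < \<tau> \<and> ennreal \<tau> < G x} = {0<..<r}"
      using real by (auto simp: ennreal_less_iff)
    then show ?thesis using real by simp
  next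
    case top
    have "{\<tau>::real. 0 < \<tau> \<and> ennreal \<tau> < G x} = {0<..}"
      using top by auto
    moreover have "emeasure lborel {0::real<..} = \<infinity>"
    proof (rule ccontr)
      assume "emeasure lborel {0::real<..} \<noteq> \<infinity>"
      then obtain r where r: "0 \<le> r" "emeasure lborel {0::real<..} = ennreal r"
        by (cases "emeasure lborel {0::real<..}") auto
      have "emeasure lborel {0<..<r + 1} \<le> emeasure lborel {0::real<..}"
        by (rule emeasure_mono) auto
      then show False using r by simp
    qed
    ultimately show ?thesis using top by simp
  qed
  have "(\<integral>\<^sup>+x. G x \<partial>M) =
      (\<integral>\<^sup>+x. (\<integral>\<^sup>+\<tau>. indicator {\<tau>. 0 < \<tau> \<and> ennreal \<tau> < G x} \<tau> \<partial>lborel) \<partial>M)"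
    using G by simp
  also have "\<dots> = (\<integral>\<^sup>+\<tau>. (\<integral>\<^sup>+x. indicator {\<tau>. 0 < \<tau> \<and> ennreal \<tau> < G x} \<tau> \<partial>M) \<partial>lborel)"
    by (rule Fubini'[symmetric]) (simp add: indicator_def)
  also have "\<dots> = (\<integral>\<^sup>+\<tau>. indicator {0<..} \<tau> * emeasure M {x \<in> space M. ennreal \<tau> < G x} \<partial>lborel)"
  proof (rule nn_integral_cong)
    fix \<tau> :: real
    have "(\<integral>\<^sup>+x. indicator {\<tau>. 0 < \<tau> \<and> ennreal \<tau> < G x} \<tau> \<partial>M) =
       (\<integral>\<^sup>+x. indicator {0<..} \<tau> * indicator {x \<in> space M. ennreal \<tau> < G x} x \<partial>M)"
      by (rule nn_integral_cong) (auto simp: indicator_def)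
    then show "(\<integral>\<^sup>+x. indicator {\<tau>. 0 < \<tau> \<and> ennreal \<tau> < G x} \<tau> \<partial>M) =
       indicator {0<..} \<tau> * emeasure M {x \<in> space M. ennreal \<tau> < G x}"
      by (simp add: nn_integral_cmult)
  qed
  finally show ?thesis .
qed

lemma nn_integral_inverse:
  assumes "0 < a" "a \<le> b"
  shows "(\<integral>\<^sup>+\<tau>. ennreal (1 / \<tau>) * indicator {a..b} \<tau> \<partial>lborel) = ennreal (ln (b / a))"
proof -
  have "(\<integral>\<^sup>+\<tau>. ennreal (1 / \<tau>) * indicator {a..b} \<tau> \<partial>lborel) = ennreal (ln b - ln a)"
    using assms
    by (intro nn_integral_FTC_Icc) (auto intro!: DERIV_subset[OF DERIV_ln_divide] simp flip: has_real_derivative_iff_has_vector_derivative)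
  then show ?thesis using assms by (simp add: ln_div)
qed

text \<open>
For \<gamma> / t above the cutoff, the part \<tau> \<le> t / 2 contributes one unit and the part \<tau> \<ge> t / 2 contributes the
integral of 1 / \<tau> from t / 2 to 2^k \<gamma>; together they form the one additional factor
1 + ln (2^(k+1) \<gamma> / t).
\<close>

lemma jmz_gauge_step:
  assumes k: "1 \<le> k" and t: "0 < t"
  shows "ennreal (10 / t) * (\<integral>\<^sup>+\<tau>. indicator {0<..} \<tau> * ennreal (jmz_gauge k (\<gamma> / max \<tau> (t / 2))) \<partial>lborel)
    \<le> ennreal (jmz_gauge (Suc k) (\<gamma> / t))"
proof (cases "(1 / 2) ^ Suc k < \<gamma> / t")
  case False
  have "jmz_gauge k (\<gamma> / max \<tau> (t / 2)) = 0" for \<tau>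
  proof -
    have "\<gamma> / max \<tau> (t / 2) \<le> (1 / 2) ^ k"
    proof -
      have "\<gamma> \<le> (1 / 2) ^ k * (t / 2)" using False t by (simp add: field_simps)
      also have "\<dots> \<le> (1 / 2) ^ k * max \<tau> (t / 2)" by (intro mult_left_mono) auto
      finally show ?thesis using t by (simp add: pos_divide_le_eq less_max_iff_disj)
    qed
    then show ?thesis by (simp add: jmz_gauge_def)
  qed
  then show ?thesis by simp
next
  case True
  define L where "L = 1 + ln (2 ^ Suc k * (\<gamma> / t))"
  have pos: "0 < \<gamma>" using True t by (smt (verit) zero_less_power half_gt_zero zero_less_divide_iff)
  have big: "1 < 2 ^ Suc k * (\<gamma> / t)" using one_less_gauge_argument[OF True] .
  then have L: "1 \<le> L" by (simp add: L_def)
  define A where "A = 10 ^ k * \<gamma> * L ^ (k - 1)"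
  have A: "0 \<le> A" using pos L by (simp add: A_def)
  have tk: "t / 2 \<le> 2 ^ k * \<gamma>" using big t by (simp add: field_simps)
  \<comment> \<open>The logarithmic factor is largest for the smallest admissible value t / 2 of the maximum and is frozen there.\<close>
  have pw: "indicator {0<..} \<tau> * ennreal (jmz_gauge k (\<gamma> / max \<tau> (t / 2))) \<le>
      ennreal A * (ennreal (2 / t) * indicator {0<..t/2} \<tau> + ennreal (1 / \<tau>) * indicator {t/2..2 ^ k * \<gamma>} \<tau>)"
    for \<tau>
  proof (cases "0 < \<tau> \<and> (1 / 2) ^ k < \<gamma> / max \<tau> (t / 2)")
    case False
    then show ?thesis by (auto simp: jmz_gauge_def indicator_def)
  next
    case T: True
    define q where "q = max \<tau> (t / 2)"
    have q: "0 < q" "t / 2 \<le> q" using t by (auto simp: q_def)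
    have gq: "1 < 2 ^ k * (\<gamma> / q)" using one_less_gauge_argument T unfolding q_def by blast
    then have qk: "q < 2 ^ k * \<gamma>" using q by (simp add: field_simps)
    have le: "2 ^ k * (\<gamma> / q) \<le> 2 ^ Suc k * (\<gamma> / t)"
      using q pos t by (simp add: field_simps)
    have "(1 + ln (2 ^ k * (\<gamma> / q))) ^ (k - 1) \<le> L ^ (k - 1)"
    proof (rule power_mono)
      show "1 + ln (2 ^ k * (\<gamma> / q)) \<le> L" unfolding L_def using le gq by simp
      show "0 \<le> 1 + ln (2 ^ k * (\<gamma> / q))" using gq by (simp add: add_nonneg_nonneg)
    qed
    then have "10 ^ k * (\<gamma> / q) * (1 + ln (2 ^ k * (\<gamma> / q))) ^ (k - 1) \<le> 10 ^ k * (\<gamma> / q) * L ^ (k - 1)"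
      using pos q by (intro mult_left_mono) auto
    then have "jmz_gauge k (\<gamma> / q) \<le> 10 ^ k * (\<gamma> / q) * L ^ (k - 1)"
      using T unfolding q_def[symmetric] jmz_gauge_def by simp
    also have "\<dots> = A * (1 / q)" by (simp add: A_def)
    finally have *: "ennreal (jmz_gauge k (\<gamma> / q)) \<le> ennreal A * ennreal (1 / q)"
      using A q by (simp flip: ennreal_mult)
    have "ennreal (1 / q) \<le> ennreal (2 / t) * indicator {0<..t/2} \<tau> + ennreal (1 / \<tau>) * indicator {t/2..2 ^ k * \<gamma>} \<tau>"
      using T qk t by (cases "\<tau> \<le> t / 2") (auto simp: q_def max_def indicator_def split: if_splits)
    then have "ennreal A * ennreal (1 / q) \<le> ennreal A * (ennreal (2 / t) * indicator {0<..t/2} \<tau> + ennreal (1 / \<tau>) * indicator {t/2..2 ^ k * \<gamma>} \<tau>)"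
      by (rule mult_left_mono) simp
    with * show ?thesis using T by (auto simp: q_def intro: order_trans)
  qed
  have "(\<integral>\<^sup>+\<tau>. indicator {0<..} \<tau> * ennreal (jmz_gauge k (\<gamma> / max \<tau> (t / 2))) \<partial>lborel) \<le>
     (\<integral>\<^sup>+\<tau>. ennreal A * (ennreal (2 / t) * indicator {0<..t/2} \<tau> + ennreal (1 / \<tau>) * indicator {t/2..2 ^ k * \<gamma>} \<tau>) \<partial>lborel)"
    by (intro nn_integral_mono pw)
  also have "\<dots> = ennreal A * (ennreal (2 / t) * ennreal (t / 2) + ennreal (ln (2 ^ k * \<gamma> / (t / 2))))"
    using t tk by (simp add: nn_integral_cmult nn_integral_add nn_integral_inverse)
  also have "\<dots> = ennreal (A * L)"
  proof -
    have "2 ^ k * \<gamma> / (t / 2) = 2 ^ Suc k * (\<gamma> / t)" by simp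
    moreover have "ennreal (2 / t) * ennreal (t / 2) = 1" using t by (simp flip: ennreal_mult)
    moreover have "0 \<le> ln (2 ^ Suc k * (\<gamma> / t))" using big by (intro ln_ge_zero) simp
    ultimately show ?thesis using A
      by (simp only: L_def ennreal_mult ennreal_1[symmetric]) (simp flip: ennreal_mult ennreal_plus ennreal_1)
  qed
  finally have "ennreal (10 / t) * (\<integral>\<^sup>+\<tau>. indicator {0<..} \<tau> * ennreal (jmz_gauge k (\<gamma> / max \<tau> (t / 2))) \<partial>lborel)
     \<le> ennreal (10 / t) * ennreal (A * L)"
    by (rule mult_left_mono) simp
  also have "\<dots> = ennreal (10 / t * (A * L))" using A L t by (simp flip: ennreal_mult)
  also have "10 / t * (A * L) = jmz_gauge (Suc k) (\<gamma> / t)"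
  proof -
    have "L ^ k = L ^ (k - 1) * L" using k by (metis Suc_diff_1 less_le_trans power_Suc2 zero_less_one)
    then show ?thesis unfolding jmz_gauge_def A_def using True by (simp add: L_def)
  qed
  finally show ?thesis .
qed

section \<open>Iterated maximal functions in coordinate directions\<close>

interpretation lborel_product: product_sigma_finite "\<lambda>_::'n::finite. lborel :: real measure" ..

abbreviation lborel_PiM :: "('n::finite \<Rightarrow> real) measure" where
  "lborel_PiM \<equiv> Pi\<^sub>M UNIV (\<lambda>_. lborel)"

text \<open>
Functions of the coordinates are used here instead of vectors, since Tonelli's theorem for a single
coordinate is a statement about product measures.
\<close>

definition max_dir :: "'n::finite \<Rightarrow> (('n \<Rightarrow> real) \<Rightarrow> ennreal) \<Rightarrow> ('n \<Rightarrow> real) \<Rightarrow> ennreal" where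
  "max_dir i G x = max_1d (\<lambda>y. G (x(i := y))) (x i)"

lemma measurable_update_PiM [measurable]:
  "(\<lambda>p. (fst p)(i := snd p)) \<in> (lborel_PiM \<Otimes>\<^sub>M (lborel :: real measure)) \<rightarrow>\<^sub>M lborel_PiM"
  by (rule measurable_fun_upd[where J=UNIV]) auto

lemma measurable_update_section [measurable]:
  "G \<in> borel_measurable lborel_PiM \<Longrightarrow> (\<lambda>y. G (x(i := y))) \<in> borel_measurable borel"
proof -
  assume [measurable]: "G \<in> borel_measurable lborel_PiM"
  have "(\<lambda>y. x(i := y)) \<in> lborel \<rightarrow>\<^sub>M lborel_PiM"
    by (rule measurable_fun_upd[where J=UNIV]) (auto simp: space_PiM)
  then have "(\<lambda>y. G (x(i := y))) \<in> borel_measurable lborel"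
    by measurable
  then show ?thesis by simp
qed

lemma measurable_max_dir [measurable]:
  assumes [measurable]: "G \<in> borel_measurable lborel_PiM"
  shows "max_dir i G \<in> borel_measurable lborel_PiM"
proof -
  have 1: "(\<lambda>(x, z). G (x(i := z)) * indicator {a<..<b} z) \<in>
     borel_measurable (lborel_PiM \<Otimes>\<^sub>M lborel)" for a b :: real
  proof -
    have "(\<lambda>p. G ((fst p)(i := snd p))) \<in> borel_measurable (lborel_PiM \<Otimes>\<^sub>M lborel)"
      using measurable_comp[OF measurable_update_PiM assms] by (simp add: comp_def)
    then show ?thesis unfolding split_beta by measurable
  qed
  have [measurable]: "(\<lambda>x. \<integral>\<^sup>+z. G (x(i := z)) * indicator {a<..<b} z \<partial>lborel) \<in> borel_measurable lborel_PiM"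
    for a b :: real
    using lborel.borel_measurable_nn_integral[OF 1] by simp
  show ?thesis
    unfolding max_dir_def[abs_def] max_1d_def
    by (intro borel_measurable_SUP countable_rat_intervals) (auto split: prod.splits)
qed

text \<open>
The one-dimensional estimate on every line parallel to the i-th axis, integrated over all lines.
\<close>

lemma max_dir_weak_type:
  assumes [measurable]: "G \<in> borel_measurable lborel_PiM" and t: "0 < t"
  shows "emeasure lborel_PiM {x. ennreal t < max_dir i G x} \<le>
    ennreal (10 / t) * (\<integral>\<^sup>+x. G x * indicator {x. ennreal (t / 2) < G x} x \<partial>lborel_PiM)"
proof -
  define I where "I = UNIV - {i}"
  have I: "insert i I = UNIV" "finite I" "i \<notin> I" by (auto simp: I_def)
  have "{x \<in> space lborel_PiM. ennreal t < max_dir i G x} \<in> sets lborel_PiM" by measurable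
  then have ms: "{x. ennreal t < max_dir i G x} \<in> sets lborel_PiM" by (simp add: space_PiM)
  have m1: "(\<lambda>x. indicator {x. ennreal t < max_dir i G x} x :: ennreal) \<in> borel_measurable (Pi\<^sub>M (insert i I) (\<lambda>_. lborel))"
    unfolding I by measurable
  have m2: "(\<lambda>x. G x * indicator {x. ennreal (t / 2) < G x} x) \<in> borel_measurable (Pi\<^sub>M (insert i I) (\<lambda>_. lborel))"
    unfolding I by measurable
  have "emeasure lborel_PiM {x. ennreal t < max_dir i G x} =
      (\<integral>\<^sup>+x. indicator {x. ennreal t < max_dir i G x} x \<partial>lborel_PiM)"
    using ms by (subst nn_integral_indicator) auto
  also have "\<dots> = (\<integral>\<^sup>+x. (\<integral>\<^sup>+y. indicator {x. ennreal t < max_dir i G x} (x(i := y)) \<partial>lborel) \<partial>Pi\<^sub>M I (\<lambda>_. lborel))"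
    using lborel_product.product_nn_integral_insert[OF I(2,3) m1] unfolding I .
  also have "\<dots> \<le> (\<integral>\<^sup>+x. ennreal (10 / t) * (\<integral>\<^sup>+y. (G (x(i := y)) * indicator {x. ennreal (t / 2) < G x} (x(i := y))) \<partial>lborel) \<partial>Pi\<^sub>M I (\<lambda>_. lborel))"
  proof (rule nn_integral_mono)
    fix x :: "'a \<Rightarrow> real"
    define g where "g y = G (x(i := y))" for y
    have [measurable]: "g \<in> borel_measurable borel" unfolding g_def by measurable
    have "(\<integral>\<^sup>+y. indicator {x. ennreal t < max_dir i G x} (x(i := y)) \<partial>lborel) =
       (\<integral>\<^sup>+y. indicator {y. ennreal t < max_1d g y} y \<partial>lborel)"
      by (simp add: max_dir_def g_def[abs_def] indicator_def)
    also have "\<dots> = emeasure lborel {y. ennreal t < max_1d g y}"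
      by (subst nn_integral_indicator) auto
    also have "\<dots> \<le> ennreal (10 / t) * (\<integral>\<^sup>+z. g z * indicator {z. ennreal (t / 2) < g z} z \<partial>lborel)"
      by (rule max_1d_weak_type_truncated) (use t in auto)
    finally show "(\<integral>\<^sup>+y. indicator {x. ennreal t < max_dir i G x} (x(i := y)) \<partial>lborel) \<le>
       ennreal (10 / t) * (\<integral>\<^sup>+y. (G (x(i := y)) * indicator {x. ennreal (t / 2) < G x} (x(i := y))) \<partial>lborel)"
      by (simp add: g_def indicator_def)
  qed
  also have "\<dots> = ennreal (10 / t) * (\<integral>\<^sup>+x. (\<integral>\<^sup>+y. (G (x(i := y)) * indicator {x. ennreal (t / 2) < G x} (x(i := y))) \<partial>lborel) \<partial>Pi\<^sub>M I (\<lambda>_. lborel))"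
  proof (rule nn_integral_cmult)
    have "(\<lambda>(x, y). (\<lambda>x. G x * indicator {x. ennreal (t / 2) < G x} x) (x(i := y)))
        \<in> borel_measurable (Pi\<^sub>M I (\<lambda>_. lborel) \<Otimes>\<^sub>M lborel)"
      using measurable_comp[OF measurable_add_dim m2] by (simp add: comp_def split_beta)
    then show "(\<lambda>x. \<integral>\<^sup>+y. (G (x(i := y)) * indicator {x. ennreal (t / 2) < G x} (x(i := y))) \<partial>lborel)
       \<in> borel_measurable (Pi\<^sub>M I (\<lambda>_. lborel))"
      by (intro lborel.borel_measurable_nn_integral) (simp add: split_beta)
  qed
  also have "\<dots> = ennreal (10 / t) * (\<integral>\<^sup>+x. G x * indicator {x. ennreal (t / 2) < G x} x \<partial>lborel_PiM)"
    using lborel_product.product_nn_integral_insert[OF I(2,3) m2] unfolding I by simp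
  finally show ?thesis .
qed

lemma sigma_finite_lborel_PiM: "sigma_finite_measure (lborel_PiM :: ('n::finite \<Rightarrow> real) measure)"
  by (rule lborel_product.sigma_finite) simp

text \<open>
Induction on the number of directions. The truncated weak-type bound for the last direction brings
in the integral of G over {G > t / 2}; the layer-cake formula writes it through the distribution
function of G, where the induction hypothesis applies.
\<close>

lemma iterated_max_dir_weak_type:
  fixes g :: "('n::finite \<Rightarrow> real) \<Rightarrow> real"
  assumes [measurable]: "g \<in> borel_measurable lborel_PiM" and g: "\<And>x. 0 \<le> g x"
    and js: "js \<noteq> []" and t: "0 < t"
  shows "foldr max_dir js (\<lambda>x. ennreal (g x)) \<in> borel_measurable lborel_PiM \<and>
    emeasure lborel_PiM {x. ennreal t < foldr max_dir js (\<lambda>x. ennreal (g x)) x} \<le>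
      (\<integral>\<^sup>+x. ennreal (jmz_gauge (length js) (g x / t)) \<partial>lborel_PiM)"
  using js t
proof (induction js arbitrary: t rule: list_nonempty_induct)
  case (single i)
  have "emeasure lborel_PiM {x. ennreal t < max_dir i (\<lambda>x. ennreal (g x)) x} \<le>
      ennreal (10 / t) * (\<integral>\<^sup>+x. ennreal (g x) * indicator {x. ennreal (t / 2) < ennreal (g x)} x \<partial>lborel_PiM)"
    by (rule max_dir_weak_type) (use single in auto)
  also have "\<dots> = (\<integral>\<^sup>+x. ennreal (10 / t) * (ennreal (g x) * indicator {x. ennreal (t / 2) < ennreal (g x)} x) \<partial>lborel_PiM)"
    by (rule nn_integral_cmult[symmetric]) measurable
  also have "\<dots> = (\<integral>\<^sup>+x. ennreal (jmz_gauge 1 (g x / t)) \<partial>lborel_PiM)"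
    using single g by (intro nn_integral_cong)
      (auto simp: jmz_gauge_def indicator_def ennreal_less_iff field_simps simp flip: ennreal_mult)
  finally show ?case by simp
next
  case (cons i js)
  define G where "G = foldr max_dir js (\<lambda>x. ennreal (g x))"
  define k where "k = length js"
  have k: "1 \<le> k" using cons.hyps by (cases js) (auto simp: k_def)
  have [measurable]: "G \<in> borel_measurable lborel_PiM"
    using cons.IH[of 1] by (simp add: G_def)
  have IH: "emeasure lborel_PiM {x. ennreal t < G x} \<le> (\<integral>\<^sup>+x. ennreal (jmz_gauge k (g x / t)) \<partial>lborel_PiM)"
    if "0 < t" for t using cons.IH[OF that] by (simp add: G_def k_def)
  interpret P: sigma_finite_measure "lborel_PiM :: ('n \<Rightarrow> real) measure" by (rule sigma_finite_lborel_PiM)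
  interpret pair_sigma_finite "lborel_PiM :: ('n \<Rightarrow> real) measure" "lborel :: real measure" ..
  have "emeasure lborel_PiM {x. ennreal t < max_dir i G x} \<le>
      ennreal (10 / t) * (\<integral>\<^sup>+x. G x * indicator {x. ennreal (t / 2) < G x} x \<partial>lborel_PiM)"
    by (rule max_dir_weak_type) (use cons in auto)
  also have "(\<integral>\<^sup>+x. G x * indicator {x. ennreal (t / 2) < G x} x \<partial>lborel_PiM) =
      (\<integral>\<^sup>+\<tau>. indicator {0<..} \<tau> *
         emeasure lborel_PiM {x. ennreal (max \<tau> (t / 2)) < G x} \<partial>lborel)"
  proof (subst layer_cake, rule sigma_finite_lborel_PiM, measurable, intro nn_integral_cong)
    fix \<tau> :: real
    have "{x. ennreal \<tau> < G x * indicator {x. ennreal (t / 2) < G x} x} =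
        {x. ennreal (max \<tau> (t / 2)) < G x}" if "0 < \<tau>"
    proof (cases "\<tau> \<le> t / 2")
      case True
      then show ?thesis using le_less_trans[OF ennreal_leI[OF True]] that by (auto simp: indicator_def max_def)
    next
      case False
      then show ?thesis using le_less_trans[OF ennreal_leI, of "t / 2" \<tau>] that
        by (auto simp: indicator_def max_def)
    qed
    then show "indicator {0<..} \<tau> * emeasure lborel_PiM
         {x \<in> space lborel_PiM. ennreal \<tau> < G x * indicator {x. ennreal (t / 2) < G x} x} =
       indicator {0<..} \<tau> * emeasure lborel_PiM {x. ennreal (max \<tau> (t / 2)) < G x}"
      by (auto simp: indicator_def space_PiM)
  qed
  also have "\<dots> \<le> (\<integral>\<^sup>+\<tau>. indicator {0<..} \<tau> *
      (\<integral>\<^sup>+x. ennreal (jmz_gauge k (g x / max \<tau> (t / 2))) \<partial>lborel_PiM) \<partial>lborel)"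
    by (intro nn_integral_mono mult_left_mono IH) (use cons.prems in auto)
  also have "\<dots> = (\<integral>\<^sup>+\<tau>. (\<integral>\<^sup>+x. indicator {0<..} \<tau> * ennreal (jmz_gauge k (g x / max \<tau> (t / 2))) \<partial>lborel_PiM) \<partial>lborel)"
    by (subst nn_integral_cmult) auto
  also have "\<dots> = (\<integral>\<^sup>+x. (\<integral>\<^sup>+\<tau>. indicator {0<..} \<tau> * ennreal (jmz_gauge k (g x / max \<tau> (t / 2))) \<partial>lborel) \<partial>lborel_PiM)"
    by (rule Fubini') measurable
  finally have "emeasure lborel_PiM {x. ennreal t < max_dir i G x} \<le> ennreal (10 / t) *
     (\<integral>\<^sup>+x. (\<integral>\<^sup>+\<tau>. indicator {0<..} \<tau> * ennreal (jmz_gauge k (g x / max \<tau> (t / 2))) \<partial>lborel) \<partial>lborel_PiM)"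
    by (simp add: mult_left_mono)
  also have "\<dots> = (\<integral>\<^sup>+x. ennreal (10 / t) *
     (\<integral>\<^sup>+\<tau>. indicator {0<..} \<tau> * ennreal (jmz_gauge k (g x / max \<tau> (t / 2))) \<partial>lborel) \<partial>lborel_PiM)"
    by (rule nn_integral_cmult[symmetric]) measurable
  also have "\<dots> \<le> (\<integral>\<^sup>+x. ennreal (jmz_gauge (Suc k) (g x / t)) \<partial>lborel_PiM)"
    by (intro nn_integral_mono jmz_gauge_step k) (use cons.prems in auto)
  finally have "emeasure lborel_PiM {x. ennreal t < max_dir i G x} \<le>
     (\<integral>\<^sup>+x. ennreal (jmz_gauge (Suc k) (g x / t)) \<partial>lborel_PiM)" .
  moreover have "max_dir i G \<in> borel_measurable lborel_PiM" by measurable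
  ultimately show ?case by (simp add: G_def k_def)
qed

text \<open>
An average over a rectangle is an iterated average over intervals, and each of them is at most
the maximal function in its direction. The coordinates outside the list stay frozen at x, which
is the form that induction on the list needs.
\<close>

lemma box_integral_le_iterated_max_dir:
  fixes G :: "('n::finite \<Rightarrow> real) \<Rightarrow> ennreal"
  assumes [measurable]: "G \<in> borel_measurable lborel_PiM"
    and "distinct js" and ab: "\<And>i. i \<in> set js \<Longrightarrow> a i < x i \<and> x i < b i"
  shows "(\<integral>\<^sup>+y. G (\<lambda>i. if i \<in> set js then y i else x i) * (\<Prod>i\<in>set js. indicator {a i<..<b i} (y i))
      \<partial>Pi\<^sub>M (set js) (\<lambda>_. lborel)) \<le> (\<Prod>i\<in>set js. ennreal (b i - a i)) * foldr max_dir js G x"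
  using assms(2,3)
proof (induction js arbitrary: x)
  case Nil
  then show ?case by (simp add: lborel_product.nn_integral_empty PiM_empty)
next
  case (Cons i js)
  have i: "i \<notin> set js" "distinct js" using Cons.prems by auto
  let ?c = "\<Prod>i\<in>set js. ennreal (b i - a i)"
  have upd: "(\<lambda>j. if j \<in> insert i (set js) then (y(i := z)) j else x j) =
     (\<lambda>j. if j \<in> set js then y j else (x(i := z)) j)" for y z
    using i by (auto simp: fun_eq_iff)
  have pr: "(\<Prod>j\<in>set js. indicator {a j<..<b j} ((y(i := z)) j) :: ennreal) =
     (\<Prod>j\<in>set js. indicator {a j<..<b j} (y j))" for y z
    using i by (intro prod.cong) auto
  have ms: "(\<lambda>y. \<lambda>j. if j \<in> J then y j else x j) \<in> Pi\<^sub>M J (\<lambda>_. lborel) \<rightarrow>\<^sub>M lborel_PiM" for J and x :: "'n \<Rightarrow> real"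
  proof (rule measurable_PiM_single')
    fix j :: 'n
    show "(\<lambda>y. if j \<in> J then y j else x j) \<in> Pi\<^sub>M J (\<lambda>_. lborel) \<rightarrow>\<^sub>M lborel"
      by (cases "j \<in> J") auto
  qed (auto simp: space_PiM)
  have "(\<integral>\<^sup>+y. G (\<lambda>j. if j \<in> set (i # js) then y j else x j) * (\<Prod>j\<in>set (i # js). indicator {a j<..<b j} (y j))
      \<partial>Pi\<^sub>M (set (i # js)) (\<lambda>_. lborel)) =
    (\<integral>\<^sup>+z. (\<integral>\<^sup>+y. G (\<lambda>j. if j \<in> set js then y j else (x(i := z)) j) *
        (indicator {a i<..<b i} z * (\<Prod>j\<in>set js. indicator {a j<..<b j} (y j)))
      \<partial>Pi\<^sub>M (set js) (\<lambda>_. lborel)) \<partial>lborel)"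
    unfolding list.set
  proof (subst lborel_product.product_nn_integral_insert_rev[OF _ i(1)], simp)
    have "(\<lambda>y. G (\<lambda>j. if j \<in> insert i (set js) then y j else x j)) \<in> borel_measurable (Pi\<^sub>M (insert i (set js)) (\<lambda>_. lborel))"
      by (rule measurable_compose[OF ms assms(1)])
    then show "(\<lambda>y. G (\<lambda>j. if j \<in> insert i (set js) then y j else x j) *
       (\<Prod>j\<in>insert i (set js). indicator {a j<..<b j} (y j))) \<in> borel_measurable (Pi\<^sub>M (insert i (set js)) (\<lambda>_. lborel))"
      by measurable
  qed (simp only: upd prod.insert[OF finite_set i(1)] pr fun_upd_same)
  also have "\<dots> = (\<integral>\<^sup>+z. indicator {a i<..<b i} z * (\<integral>\<^sup>+y. G (\<lambda>j. if j \<in> set js then y j else (x(i := z)) j) *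
        (\<Prod>j\<in>set js. indicator {a j<..<b j} (y j)) \<partial>Pi\<^sub>M (set js) (\<lambda>_. lborel)) \<partial>lborel)"
  proof (rule nn_integral_cong)
    fix z
    have [measurable]: "(\<lambda>y. G (\<lambda>j. if j \<in> set js then y j else (x(i := z)) j)) \<in> borel_measurable (Pi\<^sub>M (set js) (\<lambda>_. lborel))"
      by (rule measurable_compose[OF ms assms(1)])
    show "(\<integral>\<^sup>+y. G (\<lambda>j. if j \<in> set js then y j else (x(i := z)) j) *
        (indicator {a i<..<b i} z * (\<Prod>j\<in>set js. indicator {a j<..<b j} (y j)))
      \<partial>Pi\<^sub>M (set js) (\<lambda>_. lborel)) = indicator {a i<..<b i} z * (\<integral>\<^sup>+y. G (\<lambda>j. if j \<in> set js then y j else (x(i := z)) j) *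
        (\<Prod>j\<in>set js. indicator {a j<..<b j} (y j)) \<partial>Pi\<^sub>M (set js) (\<lambda>_. lborel))"
      by (subst nn_integral_cmult[symmetric]) (auto intro!: nn_integral_cong simp: ac_simps)
  qed
  also have "\<dots> \<le> (\<integral>\<^sup>+z. indicator {a i<..<b i} z * (?c * foldr max_dir js G (x(i := z))) \<partial>lborel)"
    using Cons.prems i by (intro nn_integral_mono mult_left_mono Cons.IH) auto
  also have "\<dots> = ?c * (\<integral>\<^sup>+z. foldr max_dir js G (x(i := z)) * indicator {a i<..<b i} z \<partial>lborel)"
  proof -
    have [measurable]: "foldr max_dir js G \<in> borel_measurable lborel_PiM"
      by (induction js) auto
    show ?thesis by (subst nn_integral_cmult[symmetric]) (auto intro!: nn_integral_cong simp: ac_simps)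
  qed
  also have "\<dots> \<le> ?c * (ennreal (b i - a i) * max_1d (\<lambda>z. foldr max_dir js G (x(i := z))) (x i))"
    using Cons.prems by (intro mult_left_mono interval_integral_le_max_1d) (auto intro: less_trans)
  also have "\<dots> = (\<Prod>i\<in>set (i # js). ennreal (b i - a i)) * foldr max_dir (i # js) G x"
    using i by (simp add: max_dir_def ac_simps)
  finally show ?case .
qed

section \<open>The weak-type bound for rectangles\<close>

lemma prod_Basis_vec:
  fixes x :: "real^'n"
  shows "(\<Prod>b\<in>Basis. f (x \<bullet> b)) = (\<Prod>i\<in>UNIV. f (x $ i))"
proof -
  have B: "(Basis :: (real^'n) set) = range (\<lambda>i. axis i 1)" by (auto simp: Basis_vec_def)
  have "inj (\<lambda>i :: 'n. axis i (1 :: real))" by (auto intro!: injI simp: axis_eq_axis)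
  then show ?thesis unfolding B by (subst prod.reindex) (auto simp: inner_axis)
qed

lemma measurable_vec_lambda_PiM [measurable]:
  "(\<lambda>f. \<chi> i. f i) \<in> lborel_PiM \<rightarrow>\<^sub>M (borel :: (real^'n) measure)"
  by (subst borel_measurable_euclidean_space) (simp add: Basis_vec_def inner_axis)

lemma lborel_vec_eq: "(lborel :: (real^'n::finite) measure) = distr lborel_PiM borel (\<lambda>f. \<chi> i. f i)"
proof (rule lborel_eqI)
  fix l u :: "real^'n" assume *: "\<And>b. b \<in> Basis \<Longrightarrow> l \<bullet> b \<le> u \<bullet> b"
  have lu: "l $ i \<le> u $ i" for i using *[of "axis i 1"] by (simp add: inner_axis)
  have "(\<lambda>f. \<chi> i. f i) -` box l u \<inter> space lborel_PiM = (\<Pi>\<^sub>E i\<in>UNIV. {l $ i<..<u $ i})"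
    by (simp add: set_eq_iff mem_box_cart space_PiM PiE_iff)
  then have "emeasure (distr lborel_PiM borel (\<lambda>f. \<chi> i. f i)) (box l u) = (\<Prod>i\<in>UNIV. ennreal (u $ i - l $ i))"
    using lu by (simp add: emeasure_distr lborel_product.emeasure_PiM)
  also have "\<dots> = ennreal (\<Prod>i\<in>UNIV. u $ i - l $ i)"
    using lu by (intro prod_ennreal) auto
  also have "(\<Prod>i\<in>UNIV. u $ i - l $ i) = (\<Prod>b\<in>Basis. (u - l) \<bullet> b)"
    using prod_Basis_vec[of "\<lambda>x. x" "u - l"] by simp
  finally show "emeasure (distr lborel_PiM borel (\<lambda>f. \<chi> i. f i)) (box l u) = ennreal (\<Prod>b\<in>Basis. (u - l) \<bullet> b)" .
qed simp

lemma nn_integral_lborel_vec: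
  assumes [measurable]: "f \<in> borel_measurable borel"
  shows "(\<integral>\<^sup>+x. f (x :: real^'n::finite) \<partial>lborel) = (\<integral>\<^sup>+x. f (\<chi> i. x i) \<partial>lborel_PiM)"
  by (subst lborel_vec_eq, subst nn_integral_distr) auto

lemma emeasure_lborel_rectangle:
  assumes "\<And>i. (a :: real^'n) $ i < b $ i"
  shows "emeasure lborel (box a b) = ennreal (\<Prod>i\<in>UNIV. b $ i - a $ i)"
proof -
  have "\<forall>c\<in>Basis. a \<bullet> c \<le> b \<bullet> c"
    using assms by (auto simp: Basis_vec_def inner_axis less_imp_le)
  then have "emeasure lborel (box a b) = ennreal (\<Prod>c\<in>Basis. (b - a) \<bullet> c)"
    by (simp add: emeasure_lborel_box_eq)
  then show ?thesis using prod_Basis_vec[of "\<lambda>x. x" "b - a"] by simp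
qed

lemma emeasure_lebesgue_borel:
  assumes "A \<in> sets borel" shows "emeasure lebesgue A = emeasure lborel A"
proof -
  have "emeasure lebesgue A = (\<integral>\<^sup>+x. indicator A x \<partial>lebesgue)"
    using assms by (subst nn_integral_indicator) auto
  also have "\<dots> = (\<integral>\<^sup>+x. indicator A x \<partial>lborel)" by (rule nn_integral_completion)
  finally show ?thesis using assms by simp
qed

lemma average_lborel:
  assumes "R \<in> sets borel"
  shows "average R g = (\<integral>\<^sup>+x. g x * indicator R x \<partial>lborel) / emeasure lborel R"
  by (simp only: average_def nn_integral_completion emeasure_lebesgue_borel[OF assms])

lemma rectangle_borel: "R \<in> rectangles \<Longrightarrow> R \<in> sets borel"
  and rectangle_open: "R \<in> rectangles \<Longrightarrow> open R"
  by (auto simp: rectangles_def)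

lemma rectangle_measure:
  assumes "R \<in> rectangles"
  shows "emeasure lborel R \<noteq> 0" "emeasure lborel R \<noteq> \<infinity>"
proof -
  obtain a b :: "real^'a" where R: "R = box a b" "\<And>i. a $ i < b $ i"
    using assms by (auto simp: rectangles_def)
  have "0 < (\<Prod>i\<in>UNIV. b $ i - a $ i)" using R(2) by (intro prod_pos) auto
  then show "emeasure lborel R \<noteq> 0" "emeasure lborel R \<noteq> \<infinity>"
    unfolding R(1) emeasure_lborel_rectangle[OF R(2)] by (auto simp: ennreal_eq_0_iff simp del: prod_zero_iff)
qed

lemma indicator_box_vec:
  fixes a b :: "real^'n"
  shows "indicator (box a b) (\<chi> i. y i) = (\<Prod>i\<in>UNIV. indicator {a $ i<..<b $ i} (y i) :: ennreal)"
proof (cases "\<forall>i. y i \<in> {a $ i<..<b $ i}")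
  case True
  then show ?thesis by (simp add: mem_box_cart)
next
  case False
  then obtain i where i: "y i \<notin> {a $ i<..<b $ i}" by blast
  then have "(\<Prod>i\<in>UNIV. indicator {a $ i<..<b $ i} (y i) :: ennreal) = 0"
    by (intro prod_zero) (auto intro!: exI[of _ i])
  moreover have "(\<chi> i. y i) \<notin> box a b"
    using i unfolding mem_box_cart by (metis greaterThanLessThan_iff vec_lambda_beta)
  ultimately show ?thesis by simp
qed

text \<open>
The quantitative theorem of Jessen, Marcinkiewicz and Zygmund: the n-fold iterated maximal
function dominates every average over a rectangle, at every point of that rectangle.
\<close>

theorem jessen_marcinkiewicz_zygmund:
  fixes g :: "real^'n::finite \<Rightarrow> real"
  assumes [measurable]: "g \<in> borel_measurable borel" and g: "\<And>x. 0 \<le> g x"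
    and F: "F \<subseteq> rectangles" "\<And>R. R \<in> F \<Longrightarrow> 1 < average R (\<lambda>x. ennreal (g x))"
  shows "emeasure lborel (\<Union>F) \<le> (\<integral>\<^sup>+x. ennreal (jmz_gauge CARD('n) (g x)) \<partial>lborel)"
proof -
  obtain js :: "'n list" where js: "set js = UNIV" "distinct js"
    using finite_distinct_list[of "UNIV :: 'n set"] by auto
  have len: "length js = CARD('n)" using distinct_card[OF js(2)] js(1) by simp
  have ne: "js \<noteq> []" using js(1) by auto
  define h where "h f = g (\<chi> i. f i)" for f
  have [measurable]: "h \<in> borel_measurable lborel_PiM" unfolding h_def by measurable
  define G where "G = foldr max_dir js (\<lambda>f. ennreal (h f))"
  have G: "1 < G (\<lambda>i. x $ i)" if R: "R \<in> F" and x: "x \<in> R" for R x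
  proof -
    obtain a b where ab: "R = box a b" "\<And>i. a $ i < b $ i" using F R by (auto simp: rectangles_def)
    let ?V = "\<Prod>i\<in>UNIV. ennreal (b $ i - a $ i)"
    have V: "emeasure lborel R = ?V"
      unfolding ab(1) using emeasure_lborel_rectangle[OF ab(2)] ab(2)
      by (simp add: prod_ennreal less_imp_le)
    have "(\<integral>\<^sup>+y. ennreal (g y) * indicator R y \<partial>lborel) =
        (\<integral>\<^sup>+y. ennreal (h y) * (\<Prod>i\<in>UNIV. indicator {a $ i<..<b $ i} (y i)) \<partial>lborel_PiM)"
    proof (subst nn_integral_lborel_vec, simp add: ab, intro nn_integral_cong)
      fix y :: "'n \<Rightarrow> real"
      have "(indicator R (\<chi> i. y i) :: ennreal) = (\<Prod>i\<in>UNIV. indicator {a $ i<..<b $ i} (y i))"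
        unfolding ab(1) by (rule indicator_box_vec)
      then show "ennreal (g (\<chi> i. y i)) * indicator R (\<chi> i. y i) =
         ennreal (h y) * (\<Prod>i\<in>UNIV. indicator {a $ i<..<b $ i} (y i))" by (simp add: h_def)
    qed
    also have "\<dots> \<le> ?V * G (\<lambda>i. x $ i)"
      using box_integral_le_iterated_max_dir[of "\<lambda>f. ennreal (h f)" js "\<lambda>i. a $ i" "\<lambda>i. x $ i" "\<lambda>i. b $ i"]
        js x ab by (simp add: G_def mem_box_cart)
    finally have le: "(\<integral>\<^sup>+y. ennreal (g y) * indicator R y \<partial>lborel) \<le> ?V * G (\<lambda>i. x $ i)" .
    have "1 < (\<integral>\<^sup>+y. ennreal (g y) * indicator R y \<partial>lborel) / ?V"
      using F(2)[OF R] F(1) R rectangle_borel by (subst (asm) average_lborel) (auto simp: V)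
    also have "\<dots> \<le> ?V * G (\<lambda>i. x $ i) / ?V" by (intro divide_right_mono_ennreal le)
    also have "\<dots> = G (\<lambda>i. x $ i)"
      using rectangle_measure[of R] F(1) R by (subst mult.commute, subst ennreal_mult_divide_eq) (auto simp: V)
    finally show ?thesis .
  qed
  have it: "G \<in> borel_measurable lborel_PiM \<and>
      emeasure lborel_PiM {x. ennreal 1 < G x} \<le>
      (\<integral>\<^sup>+x. ennreal (jmz_gauge (length js) (h x / 1)) \<partial>lborel_PiM)"
    unfolding G_def by (rule iterated_max_dir_weak_type) (use g ne in \<open>auto simp: h_def\<close>)
  have [measurable]: "G \<in> borel_measurable lborel_PiM" using it by blast
  have op: "open (\<Union>F)" using F(1) rectangle_open by auto
  have "{x \<in> space lborel_PiM. ennreal 1 < G x} \<in> sets lborel_PiM" by measurable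
  then have mG: "{x. ennreal 1 < G x} \<in> sets lborel_PiM" by (simp add: space_PiM)
  have "emeasure lborel (\<Union>F) = emeasure (distr lborel_PiM borel (\<lambda>f. \<chi> i. f i)) (\<Union>F)"
    by (rule arg_cong[OF lborel_vec_eq, of "\<lambda>M. emeasure M (\<Union>F)"])
  also have "\<dots> = emeasure lborel_PiM ((\<lambda>f. \<chi> i. f i) -` (\<Union>F) \<inter> space lborel_PiM)"
    using op by (subst emeasure_distr) auto
  also have "\<dots> \<le> emeasure lborel_PiM {x. ennreal 1 < G x}"
  proof (intro emeasure_mono mG subsetI)
    fix y assume "y \<in> (\<lambda>f. \<chi> i. f i) -` \<Union>F \<inter> space lborel_PiM"
    then obtain R where "R \<in> F" "(\<chi> i. y i) \<in> R" by auto
    from G[OF this] show "y \<in> {x. ennreal 1 < G x}" by simp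
  qed
  also have "\<dots> \<le> (\<integral>\<^sup>+x. ennreal (jmz_gauge (length js) (h x / 1)) \<partial>lborel_PiM)" using it by simp
  also have "\<dots> = (\<integral>\<^sup>+x. ennreal (jmz_gauge CARD('n) (g x)) \<partial>lborel)"
    by (subst nn_integral_lborel_vec) (auto simp: len h_def)
  finally show ?thesis .
qed

section \<open>Powers as integrals of tails\<close>

text \<open>
The p-th power of x is the measure of {s. 1 < s x} for this density, that is, the layer-cake
formula for x^p with levels 1 / s. In the variable s the functions to be integrated depend on the
product s x only, so that the final change of variables is a linear dilation.
\<close>

definition tail_density :: "real \<Rightarrow> real \<Rightarrow> ennreal" where
  "tail_density p s = indicator {0<..} s * ennreal (p * s powr (- p - 1))"

lemma measurable_tail_density [measurable]: "tail_density p \<in> borel_measurable borel"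
  unfolding tail_density_def[abs_def] by measurable

lemma nn_integral_tail_density_atLeast:
  assumes "0 < p" "0 < a"
  shows "(\<integral>\<^sup>+s. tail_density p s * indicator {a..} s \<partial>lborel) = ennreal (a powr - p)"
proof -
  have "(\<integral>\<^sup>+s. tail_density p s * indicator {a..} s \<partial>lborel) =
     (\<integral>\<^sup>+s. ennreal (p * s powr (- p - 1)) * indicator {a..} s \<partial>lborel)"
    using assms by (intro nn_integral_cong) (auto simp: tail_density_def indicator_def)
  also have "\<dots> = ennreal (0 - (- (a powr - p)))"
  proof (rule nn_integral_FTC_atLeast)
    fix x assume x: "a \<le> x"
    show "((\<lambda>s. - (s powr - p)) has_real_derivative p * x powr (- p - 1)) (at x)"
      using x assms by (auto intro!: derivative_eq_intros)
    show "0 \<le> p * x powr (- p - 1)" using assms by simp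
  next
    have "((\<lambda>s. s powr - p) \<longlongrightarrow> 0) at_top"
      using assms by (intro tendsto_neg_powr filterlim_ident) auto
    then show "((\<lambda>s. - (s powr - p)) \<longlongrightarrow> 0) at_top" by (auto intro: tendsto_eq_intros)
  qed simp
  finally show ?thesis by simp
qed

lemma nn_integral_tail_density:
  assumes "0 < p" "0 \<le> x"
  shows "(\<integral>\<^sup>+s. tail_density p s * indicator {s. 1 < s * x} s \<partial>lborel) = ennreal (x powr p)"
proof (cases "x = 0")
  case False
  then have x: "0 < x" using assms by simp
  have "AE s in lborel. s \<noteq> 1 / x" by (rule AE_lborel_singleton)
  then have "(\<integral>\<^sup>+s. tail_density p s * indicator {s. 1 < s * x} s \<partial>lborel) =
     (\<integral>\<^sup>+s. tail_density p s * indicator {1 / x..} s \<partial>lborel)"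
    using x by (intro nn_integral_cong_AE) (auto simp: indicator_def field_simps)
  then show ?thesis
    using nn_integral_tail_density_atLeast[of p "1 / x"] x assms
    by (simp add: powr_minus powr_divide)
qed simp

lemma nn_integral_tail_density_scale:
  assumes [measurable]: "f \<in> borel_measurable borel" and y: "0 < y"
  shows "(\<integral>\<^sup>+s. tail_density p s * f (y * s) \<partial>lborel) =
    ennreal (y powr p) * (\<integral>\<^sup>+s. tail_density p s * f s \<partial>lborel)"
proof -
  have *: "tail_density p (0 + y * s) = ennreal (y powr (- p - 1)) * tail_density p s" for s
    using y by (auto simp: tail_density_def indicator_def powr_mult zero_less_mult_iff ac_simps simp flip: ennreal_mult')
  have "(\<integral>\<^sup>+s. tail_density p s * f s \<partial>lborel) =
      ennreal \<bar>y\<bar> * (\<integral>\<^sup>+s. tail_density p (0 + y * s) * f (0 + y * s) \<partial>lborel)"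
    using y by (intro nn_integral_real_affine) auto
  also have "\<dots> = ennreal \<bar>y\<bar> * (ennreal (y powr (- p - 1)) * (\<integral>\<^sup>+s. tail_density p s * f (y * s) \<partial>lborel))"
    unfolding * by (subst nn_integral_cmult[symmetric]) (auto simp: ac_simps)
  also have "\<dots> = ennreal (y powr - p) * (\<integral>\<^sup>+s. tail_density p s * f (y * s) \<partial>lborel)"
  proof -
    have "y * y powr (- p - 1) = y powr - p" using y by (simp add: powr_diff)
    then have "ennreal \<bar>y\<bar> * ennreal (y powr (- p - 1)) = ennreal (y powr - p)"
      using y by (simp flip: ennreal_mult)
    then show ?thesis by (simp flip: mult.assoc)
  qed
  finally have "ennreal (y powr p) * (\<integral>\<^sup>+s. tail_density p s * f s \<partial>lborel) =
     (ennreal (y powr p) * ennreal (y powr - p)) * (\<integral>\<^sup>+s. tail_density p s * f (y * s) \<partial>lborel)"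
    by (simp add: mult.assoc)
  also have "ennreal (y powr p) * ennreal (y powr - p) = 1"
    using y by (simp add: powr_minus flip: ennreal_mult)
  finally show ?thesis by simp
qed

section \<open>Selection of scattered rectangles\<close>

text \<open>
A set is selected if the previously selected ones cover at most the fraction l of it. For a
selected set the first conclusion holds because it covers itself and l < 1.
\<close>

lemma scattered_subfamily:
  fixes R :: "nat \<Rightarrow> 'a set"
  assumes R: "\<And>j. j < m \<Longrightarrow> R j \<in> sets M" "\<And>j. j < m \<Longrightarrow> emeasure M (R j) \<noteq> 0"
      "\<And>j. j < m \<Longrightarrow> emeasure M (R j) \<noteq> \<infinity>"
    and l: "0 < l" "l < 1"
  shows "\<exists>S\<subseteq>{..<m}.
    (\<forall>j<m. ennreal l * emeasure M (R j) < emeasure M (R j \<inter> (\<Union>i\<in>{i\<in>S. i \<le> j}. R i))) \<and>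
    (\<forall>j\<in>S. ennreal (1 - l) * emeasure M (R j) \<le> emeasure M (R j - (\<Union>i\<in>{i\<in>S. i < j}. R i)))"
  using R
proof (induction m)
  case 0
  then show ?case by auto
next
  case (Suc m)
  obtain S where S: "S \<subseteq> {..<m}"
     "\<And>j. j < m \<Longrightarrow> ennreal l * emeasure M (R j) < emeasure M (R j \<inter> (\<Union>i\<in>{i\<in>S. i \<le> j}. R i))"
     "\<And>j. j \<in> S \<Longrightarrow> ennreal (1 - l) * emeasure M (R j) \<le> emeasure M (R j - (\<Union>i\<in>{i\<in>S. i < j}. R i))"
  proof -
    have "\<And>j. j < m \<Longrightarrow> j < Suc m" by simp
    from Suc.IH[OF Suc.prems[OF this]] show thesis using that by blast
  qed
  have finS: "finite S" using S(1) finite_subset by blast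
  have Rm: "R m \<in> sets M" "emeasure M (R m) \<noteq> 0" "emeasure M (R m) \<noteq> \<infinity>" using Suc.prems by auto
  show ?case
  proof (cases "ennreal l * emeasure M (R m) < emeasure M (R m \<inter> (\<Union>i\<in>S. R i))")
    case True
    have "{i\<in>S. i \<le> m} = S" using S(1) by auto
    then show ?thesis using S True by (intro exI[of _ S]) (auto simp: less_Suc_eq)
  next
    case False
    let ?S = "insert m S"
    have e1: "{i\<in>?S. i \<le> j} = {i\<in>S. i \<le> j}" if "j < m" for j using that by auto
    have e2: "{i\<in>?S. i < j} = {i\<in>S. i < j}" if "j \<le> m" for j using that by auto
    have e3: "{i\<in>?S. i < m} = S" using S(1) by auto
    have 1: "ennreal l * emeasure M (R m) < emeasure M (R m)"
    proof -
      obtain r where r: "emeasure M (R m) = ennreal r" "0 < r"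
        using Rm by (cases "emeasure M (R m)") (auto simp: less_le)
      then show ?thesis using l by (simp add: ennreal_less_iff flip: ennreal_mult)
    qed
    have U: "(\<Union>i\<in>S. R i) \<in> sets M" using S(1) Suc.prems finS by (intro sets.finite_UN) auto
    have 2: "ennreal (1 - l) * emeasure M (R m) \<le> emeasure M (R m - (\<Union>i\<in>S. R i))"
    proof -
      have "ennreal l * emeasure M (R m) + ennreal (1 - l) * emeasure M (R m) = emeasure M (R m)"
        using l by (simp flip: distrib_right ennreal_plus)
      also have "\<dots> = emeasure M (R m \<inter> (\<Union>i\<in>S. R i)) + emeasure M (R m - (\<Union>i\<in>S. R i))"
        using U Rm by (subst plus_emeasure) (auto intro!: arg_cong[where f="emeasure M"])
      also have "\<dots> \<le> ennreal l * emeasure M (R m) + emeasure M (R m - (\<Union>i\<in>S. R i))"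
        using False by (intro add_right_mono) auto
      finally show ?thesis
        using Rm(3) by (subst (asm) ennreal_add_left_cancel_le) (auto simp: ennreal_mult_eq_top_iff)
    qed
    show ?thesis
    proof (intro exI[of _ ?S] conjI allI impI ballI)
      show "?S \<subseteq> {..<Suc m}" using S(1) by auto
      fix j assume "j < Suc m"
      then consider "j < m" | "j = m" by linarith
      then show "ennreal l * emeasure M (R j) < emeasure M (R j \<inter> (\<Union>i\<in>{i\<in>?S. i \<le> j}. R i))"
      proof cases
        case 2
        have "R m \<inter> (\<Union>i\<in>{i\<in>?S. i \<le> m}. R i) = R m" by auto
        then show ?thesis using 1 2 by simp
      qed (use e1 S(2) in simp)
    next
      fix j assume "j \<in> ?S"
      then consider "j \<in> S" "j \<le> m" | "j = m" using S(1) by force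
      then show "ennreal (1 - l) * emeasure M (R j) \<le> emeasure M (R j - (\<Union>i\<in>{i\<in>?S. i < j}. R i))"
        using 2 e2 e3 S(3) by cases auto
    qed
  qed
qed

section \<open>The complementary function and its integrability class\<close>

lemma jmz_gauge_le_Phi_n:
  assumes "0 \<le> x"
  shows "jmz_gauge n x \<le> 10 ^ n * (real n + 2) ^ (n - 1) * Phi_n n x"
proof (cases "(1 / 2) ^ n < x")
  case True
  have x: "0 < x" using True by (smt (verit) zero_less_power half_gt_zero)
  have "1 \<le> ln (exp 1 + x)" using x by (subst ln_ge_iff) (auto intro: add_pos_pos)
  have "ln (2 ^ n * x) = real n * ln 2 + ln x" using x by (simp add: ln_mult ln_realpow)
  also have "\<dots> \<le> real n * 1 + ln (exp 1 + x)"
  proof (intro add_mono mult_left_mono)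
    show "ln x \<le> ln (exp 1 + x)" using x by (subst ln_le_cancel_iff) (auto intro: add_pos_pos)
  qed (use ln_2_less_1 in auto)
  also have "\<dots> \<le> real n * ln (exp 1 + x) + ln (exp 1 + x)"
    using \<open>1 \<le> ln (exp 1 + x)\<close> by (intro add_right_mono mult_left_mono) auto
  finally have "1 + ln (2 ^ n * x) \<le> (real n + 2) * ln (exp 1 + x)"
    using \<open>1 \<le> ln (exp 1 + x)\<close> by (simp add: algebra_simps)
  moreover have "0 \<le> ln (2 ^ n * x)" using one_less_gauge_argument[OF True] by simp
  ultimately have "(1 + ln (2 ^ n * x)) ^ (n - 1) \<le> ((real n + 2) * ln (exp 1 + x)) ^ (n - 1)"
    by (intro power_mono) auto
  then have "10 ^ n * x * (1 + ln (2 ^ n * x)) ^ (n - 1) \<le>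
     10 ^ n * x * ((real n + 2) * ln (exp 1 + x)) ^ (n - 1)"
    using x by (intro mult_left_mono) auto
  then show ?thesis using True by (simp add: jmz_gauge_def Phi_n_def power_mult_distrib ac_simps)
next
  case False
  have "0 \<le> ln (exp 1 + x)" using assms by (intro ln_ge_zero) (smt (verit) one_le_exp_iff)
  then show ?thesis using False assms by (simp add: jmz_gauge_def Phi_n_def)
qed

lemma Phi_n_mono:
  assumes "0 \<le> x" "x \<le> y" shows "Phi_n n x \<le> Phi_n n y"
proof -
  have "1 \<le> exp 1 + x" using assms by (smt (verit) one_le_exp_iff)
  then show ?thesis unfolding Phi_n_def using assms
    by (intro mult_mono power_mono) auto
qed

lemma Phi_n_nonneg: "0 \<le> x \<Longrightarrow> 0 \<le> Phi_n n x"
  using Phi_n_mono[of 0 x n] by (simp add: Phi_n_def)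

lemma complementary_mono: "s \<le> t \<Longrightarrow> complementary \<Phi> s \<le> complementary \<Phi> t"
  unfolding complementary_def
  by (rule SUP_subset_mono) (auto intro!: ennreal_leI mult_right_mono)

lemma complementary_young: "0 < t \<Longrightarrow> ennreal (s * t - \<Phi> t) \<le> complementary \<Phi> s"
  unfolding complementary_def by (rule SUP_upper) auto

text \<open>
Subhomogeneity, the trace of convexity that is available without knowing that the supremum is
finite. If \<Psi>(1) is finite, it yields \<Psi>(s) \<rightarrow> 0 as
s \<rightarrow> 0.
\<close>

lemma complementary_scale:
  assumes "\<And>t. 0 \<le> t \<Longrightarrow> 0 \<le> \<Phi> t" "0 \<le> \<theta>" "\<theta> \<le> 1"
  shows "complementary \<Phi> (\<theta> * s) \<le> ennreal \<theta> * complementary \<Phi> s"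
  unfolding complementary_def SUP_mult_left_ennreal
proof (rule SUP_subset_mono)
  fix t :: real
  assume t: "t \<in> {0<..}"
  show "ennreal (\<theta> * s * t - \<Phi> t) \<le> ennreal \<theta> * ennreal (s * t - \<Phi> t)"
  proof -
    have "\<theta> * \<Phi> t \<le> 1 * \<Phi> t" using assms t by (intro mult_right_mono) auto
    then have "\<theta> * s * t - \<Phi> t \<le> \<theta> * (s * t - \<Phi> t)" by (simp add: algebra_simps)
    then show ?thesis using assms by (simp add: ennreal_leI flip: ennreal_mult')
  qed
qed simp

lemma complementary_nonpos:
  assumes "\<And>t. 0 \<le> t \<Longrightarrow> 0 \<le> \<Phi> t" "s \<le> 0"
  shows "complementary \<Phi> s = 0"
proof -
  have "ennreal (s * t - \<Phi> t) = 0" if "0 < t" for t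
    using assms(1)[of t] assms(2) that by (intro ennreal_neg) (smt (verit) mult_nonpos_nonneg)
  then show ?thesis unfolding complementary_def by (auto intro!: antisym SUP_least)
qed

lemma B_star_integral:
  assumes "B_star n p \<Psi>"
  obtains c where "0 < c" "(\<integral>\<^sup>+t. ext_infty (Phi_n n) (\<Psi> t) / ennreal (t powr p) / ennreal t * indicator {c..} t \<partial>lborel) < \<infinity>"
  using assms unfolding B_star_def by (auto simp: nn_integral_completion)

text \<open>
By monotonicity an infinite value would persist on a half-line, where it makes the integrand of
the class infinite.
\<close>

lemma B_star_finite:
  assumes "B_star n p (complementary \<Phi>)"
  shows "complementary \<Phi> s < \<infinity>"
proof (rule ccontr)
  assume "\<not> complementary \<Phi> s < \<infinity>"
  then have inf: "complementary \<Phi> s = \<infinity>" by (simp add: not_less top_unique)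
  obtain c where c: "0 < c" "(\<integral>\<^sup>+t. ext_infty (Phi_n n) (complementary \<Phi> t) / ennreal (t powr p) / ennreal t * indicator {c..} t \<partial>lborel) < \<infinity>"
    using B_star_integral[OF assms] .
  define a where "a = max c s"
  have "\<infinity> = (\<integral>\<^sup>+t. \<infinity> * indicator {a..a+1} t \<partial>lborel)"
    by (subst nn_integral_cmult_indicator) (auto simp: ennreal_top_mult)
  also have "\<dots> \<le> (\<integral>\<^sup>+t. ext_infty (Phi_n n) (complementary \<Phi> t) / ennreal (t powr p) / ennreal t * indicator {c..} t \<partial>lborel)"
  proof (rule nn_integral_mono)
    fix t
    show "\<infinity> * indicator {a..a+1} t \<le> ext_infty (Phi_n n) (complementary \<Phi> t) / ennreal (t powr p) / ennreal t * indicator {c..} t"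
    proof (cases "t \<in> {a..a+1}")
      case True
      then have t: "c \<le> t" "s \<le> t" by (auto simp: a_def)
      have "complementary \<Phi> t = \<infinity>" using complementary_mono[OF t(2), of \<Phi>] inf by (simp add: top_unique)
      then have "ext_infty (Phi_n n) (complementary \<Phi> t) / ennreal (t powr p) / ennreal t = \<infinity>"
        using t c by (simp add: ext_infty_def ennreal_top_divide)
      then show ?thesis using t by simp
    qed simp
  qed
  finally show False using c by simp
qed

lemma mono_real_complementary:
  assumes fin: "\<And>s. complementary \<Phi> s < \<infinity>"
  shows "mono (\<lambda>s. enn2real (complementary \<Phi> s))"
  using fin by (intro monoI enn2real_mono complementary_mono) simp_all

text \<open>
The class controls the integral near infinity. Near 0 the cutoff of the gauge makes the integrand
vanish, and on the compact interval in between everything is bounded.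
\<close>

lemma gauge_complementary_integral_finite:
  fixes \<Phi> :: "real \<Rightarrow> real"
  assumes B: "B_star n p (complementary \<Phi>)" and p: "0 < p"
    and nn: "\<And>t. 0 \<le> t \<Longrightarrow> 0 \<le> \<Phi> t"
  defines "\<psi> \<equiv> \<lambda>s. enn2real (complementary \<Phi> s)"
  shows "(\<integral>\<^sup>+s. tail_density p s * ennreal (jmz_gauge n (\<psi> s)) \<partial>lborel) < \<infinity>"
proof -
  have \<psi>: "complementary \<Phi> s = ennreal (\<psi> s)" for s
    using B_star_finite[OF B, of s] by (simp add: \<psi>_def)
  have mono: "mono \<psi>" unfolding \<psi>_def by (rule mono_real_complementary) (rule B_star_finite[OF B])
  have \<psi>0: "0 \<le> \<psi> s" for s by (simp add: \<psi>_def)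
  have \<psi>_mono: "\<psi> s \<le> \<psi> t" if "s \<le> t" for s t using mono that by (rule monoD)
  note borel_measurable_mono[OF mono, measurable]
  obtain c where c: "0 < c" "(\<integral>\<^sup>+t. ext_infty (Phi_n n) (complementary \<Phi> t) / ennreal (t powr p) / ennreal t * indicator {c..} t \<partial>lborel) < \<infinity>"
    using B_star_integral[OF B] .
  define D where "D = 10 ^ n * (real n + 2) ^ (n - 1)"
  have D: "0 \<le> D" by (simp add: D_def)
  \<comment> \<open>By subhomogeneity, \<psi> is at most s times its value at 1, hence below the cutoff (1/2)^n up to s0.\<close>
  define s0 where "s0 = min 1 ((1 / 2) ^ n / (\<psi> 1 + 1))"
  have s0: "0 < s0" "s0 \<le> 1" using \<psi>0[of 1] by (auto simp: s0_def)
  have small: "jmz_gauge n (\<psi> s) = 0" if s: "0 < s" "s \<le> s0" for s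
  proof -
    have "ennreal (\<psi> s) \<le> ennreal s * ennreal (\<psi> 1)"
      using complementary_scale[of \<Phi> s 1] nn s s0 by (simp add: \<psi>)
    then have "\<psi> s \<le> s * \<psi> 1" using s \<psi>0 by (simp flip: ennreal_mult)
    also have "\<dots> \<le> s * (\<psi> 1 + 1)" using s by simp
    also have "\<dots> \<le> (1 / 2) ^ n / (\<psi> 1 + 1) * (\<psi> 1 + 1)"
      using s \<psi>0[of 1] by (intro mult_right_mono) (auto simp: s0_def)
    also have "\<dots> = (1 / 2) ^ n" using \<psi>0[of 1] by (simp add: add_nonneg_pos)
    finally show ?thesis by (simp add: jmz_gauge_def)
  qed
  define A where "A = D * Phi_n n (\<psi> c) * (p * s0 powr (- p - 1))"
  have "(\<integral>\<^sup>+s. tail_density p s * ennreal (jmz_gauge n (\<psi> s)) \<partial>lborel) \<le>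
    (\<integral>\<^sup>+s. ennreal A * indicator {s0..c} s + ennreal (D * p) *
       (ennreal (Phi_n n (\<psi> s) / s powr p / s) * indicator {c..} s) \<partial>lborel)"
  proof (rule nn_integral_mono)
    fix s
    consider "s \<le> 0" | "0 < s" "s \<le> s0" | "0 < s" "s0 < s" "s < c" | "0 < s" "s0 < s" "c \<le> s" by linarith
    then show "tail_density p s * ennreal (jmz_gauge n (\<psi> s)) \<le> ennreal A * indicator {s0..c} s + ennreal (D * p) *
       (ennreal (Phi_n n (\<psi> s) / s powr p / s) * indicator {c..} s)"
    proof cases
      case 3
      have "jmz_gauge n (\<psi> s) \<le> D * Phi_n n (\<psi> s)" using jmz_gauge_le_Phi_n[OF \<psi>0] by (simp add: D_def)
      also have "\<dots> \<le> D * Phi_n n (\<psi> c)" using 3 by (intro mult_left_mono Phi_n_mono \<psi>0 \<psi>_mono D) auto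
      finally have 1: "jmz_gauge n (\<psi> s) \<le> D * Phi_n n (\<psi> c)" .
      have 2: "s powr (- p - 1) \<le> s0 powr (- p - 1)" using 3 s0 p by (intro powr_mono2') auto
      have "p * s powr (- p - 1) * jmz_gauge n (\<psi> s) \<le> p * s0 powr (- p - 1) * (D * Phi_n n (\<psi> c))"
        using 1 2 p by (intro mult_mono mult_left_mono) (auto intro: jmz_gauge_nonneg)
      then have "p * s powr (- p - 1) * jmz_gauge n (\<psi> s) \<le> A" by (simp add: A_def ac_simps)
      then show ?thesis using 3 p
        by (simp add: tail_density_def jmz_gauge_nonneg ennreal_leI flip: ennreal_mult)
    next
      case 4
      have "jmz_gauge n (\<psi> s) \<le> D * Phi_n n (\<psi> s)" using jmz_gauge_le_Phi_n[OF \<psi>0] by (simp add: D_def)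
      then have "p * s powr (- p - 1) * jmz_gauge n (\<psi> s) \<le> p * s powr (- p - 1) * (D * Phi_n n (\<psi> s))"
        using p by (intro mult_left_mono) auto
      also have "\<dots> = D * p * (Phi_n n (\<psi> s) / s powr p / s)"
        using 4 by (simp add: powr_diff powr_minus field_simps)
      finally have "tail_density p s * ennreal (jmz_gauge n (\<psi> s)) \<le> ennreal (D * p) * ennreal (Phi_n n (\<psi> s) / s powr p / s)"
        using 4 p D Phi_n_nonneg[OF \<psi>0, of n s]
        by (simp add: tail_density_def jmz_gauge_nonneg ennreal_leI flip: ennreal_mult)
      then show ?thesis using 4 by (simp add: add_increasing)
    qed (use small in \<open>auto simp: tail_density_def\<close>)
  qed
  also have "\<dots> = ennreal A * emeasure lborel {s0..c} + ennreal (D * p) *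
      (\<integral>\<^sup>+s. ennreal (Phi_n n (\<psi> s) / s powr p / s) * indicator {c..} s \<partial>lborel)"
    unfolding Phi_n_def by (subst nn_integral_add) (auto simp: nn_integral_cmult)
  also have "(\<integral>\<^sup>+s. ennreal (Phi_n n (\<psi> s) / s powr p / s) * indicator {c..} s \<partial>lborel) =
     (\<integral>\<^sup>+t. ext_infty (Phi_n n) (complementary \<Phi> t) / ennreal (t powr p) / ennreal t * indicator {c..} t \<partial>lborel)"
  proof (rule nn_integral_cong)
    fix s
    show "ennreal (Phi_n n (\<psi> s) / s powr p / s) * indicator {c..} s =
       ext_infty (Phi_n n) (complementary \<Phi> s) / ennreal (s powr p) / ennreal s * indicator {c..} s"
      using c \<psi>0[of s] Phi_n_nonneg[OF \<psi>0, of n s]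
      by (cases "c \<le> s") (auto simp: ext_infty_def \<psi> divide_ennreal)
  qed
  finally have "(\<integral>\<^sup>+s. tail_density p s * ennreal (jmz_gauge n (\<psi> s)) \<partial>lborel) \<le>
    ennreal A * emeasure lborel {s0..c} + ennreal (D * p) *
      (\<integral>\<^sup>+t. ext_infty (Phi_n n) (complementary \<Phi> t) / ennreal (t powr p) / ennreal t * indicator {c..} t \<partial>lborel)" .
  also have "\<dots> < \<infinity>"
    using c(2) by (simp add: ennreal_mult_less_top emeasure_lborel_Icc_eq)
  finally show ?thesis .
qed

section \<open>The bump condition on a single rectangle\<close>

lemma measurable_ext_infty:
  assumes "continuous_on {0..} \<Phi>"
  shows "ext_infty \<Phi> \<in> borel_measurable borel"
proof -
  have "continuous_on UNIV (\<lambda>t. \<Phi> (max 0 t))"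
    by (rule continuous_on_compose2[OF assms]) (auto intro: continuous_intros)
  then have [measurable]: "(\<lambda>t. \<Phi> (max 0 t)) \<in> borel_measurable borel"
    by (rule borel_measurable_continuous_onI)
  have "ext_infty \<Phi> = (\<lambda>x. if x = \<infinity> then \<infinity> else ennreal (\<Phi> (max 0 (enn2real x))))"
    by (simp add: ext_infty_def fun_eq_iff max_absorb2)
  then show ?thesis by simp
qed

lemma average_mono_AE:
  assumes "AE x in lebesgue. f x \<le> g x"
  shows "average R f \<le> average R g"
  unfolding average_def using assms
  by (intro divide_right_mono_ennreal nn_integral_mono_AE) (auto elim!: eventually_mono simp: mult_right_mono)

lemma average_add:
  assumes [measurable]: "f \<in> borel_measurable lebesgue" "g \<in> borel_measurable lebesgue" "R \<in> sets lebesgue"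
  shows "average R (\<lambda>x. f x + g x) = average R f + average R g"
  unfolding average_def
  by (simp add: distrib_right nn_integral_add add_divide_distrib_ennreal)

lemma average_cmult:
  assumes [measurable]: "f \<in> borel_measurable lebesgue" "R \<in> sets lebesgue"
  shows "average R (\<lambda>x. c * f x) = c * average R f"
  unfolding average_def
  by (simp add: mult.assoc nn_integral_cmult ennreal_times_divide)

text \<open>
This is where the bump condition is used. Choose l slightly above the Luxemburg norm of 1 / v, so
that the average of \<Phi>(1 / (v l)) is at most 1, and put N = b / (2 l). If the average of
\<Psi>(s h) were at most 1 as well, then Young's inequality would give avg_R f \<le> 2 l / s, which is
less than b when s N > 1. The bump condition says that l times the p-th root of the average of u^p
is bounded, and this is the first conclusion. If u^p has integral 0 over R there may be no such l,
and N = 0 serves.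
\<close>

lemma bump_condition_testing:
  fixes u v :: "real^'n \<Rightarrow> real"
  assumes p: "1 < p" and Y: "young_function \<Phi>" and fin: "\<And>s. complementary \<Phi> s < \<infinity>"
    and W: "weight (\<lambda>x. u x powr p)" and v: "weight v" and bump: "bump_condition p \<Phi> u v K" and K: "0 < K"
    and [measurable]: "f \<in> borel_measurable lebesgue" and f: "\<And>x. 0 \<le> f x"
    and [measurable]: "h \<in> borel_measurable borel" and h: "AE x in lebesgue. v x * f x = h x"
    and R: "R \<in> rectangles" and b: "0 < b" "ennreal b < average R (\<lambda>x. ennreal (f x))"
  shows "\<exists>N\<ge>0. ennreal (b powr p) * weighted_measure (\<lambda>x. u x powr p) R \<le>
      ennreal ((4 * K) powr p) * (ennreal (N powr p) * emeasure lborel R) \<and>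
      (\<forall>s>0. 1 < s * N \<longrightarrow> 1 < average R (\<lambda>x. ennreal (enn2real (complementary \<Phi> (s * h x)))))"
proof -
  define \<psi> where "\<psi> = (\<lambda>s. enn2real (complementary \<Phi> s))"
  have \<psi>: "complementary \<Phi> s = ennreal (\<psi> s)" for s using fin[of s] by (simp add: \<psi>_def)
  have \<psi>0: "0 \<le> \<psi> s" for s by (simp add: \<psi>_def)
  have \<psi>m [measurable]: "\<psi> \<in> borel_measurable borel"
    unfolding \<psi>_def by (rule borel_measurable_mono[OF mono_real_complementary[OF fin]])
  have \<Phi>0: "0 \<le> \<Phi> t" if "0 \<le> t" for t using Y that by (auto simp: young_function_def)
  have \<Phi>m [measurable]: "ext_infty \<Phi> \<in> borel_measurable borel"
    using Y by (intro measurable_ext_infty) (auto simp: young_function_def)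
  have vm [measurable]: "v \<in> borel_measurable lebesgue" and v0: "\<And>x. 0 \<le> v x" using v by (auto simp: weight_def)
  have Rm [measurable]: "R \<in> sets lebesgue" using rectangle_borel[OF R] by simp
  have hm [measurable]: "h \<in> borel_measurable lebesgue"
    using assms(10) by (simp add: measurable_completion)
  let ?w = "\<lambda>x. u x powr p"
  let ?A = "average R (\<lambda>x. ennreal (u x powr p))"
  obtain V where V: "emeasure lborel R = ennreal V" "0 < V"
    using rectangle_measure[OF R] by (cases "emeasure lborel R") (auto simp: less_le)
  have A: "?A = weighted_measure ?w R / ennreal V"
    by (simp only: average_def weighted_measure_def emeasure_lebesgue_borel[OF rectangle_borel[OF R]] V)
  have Wfin: "weighted_measure ?w R < \<infinity>" using W R unfolding weight_def by blast
  show ?thesis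
  proof (cases "weighted_measure ?w R = 0")
    case True
    show ?thesis by (rule exI[of _ 0]) (simp add: True)
  next
    case False
    obtain a' where a': "weighted_measure ?w R = ennreal a'" "0 < a'"
      using False Wfin by (cases "weighted_measure ?w R") (auto simp: less_le)
    define a where "a = a' / V"
    have a: "?A = ennreal a" "0 < a" "a' = a * V"
      using a' V unfolding A by (auto simp: a_def divide_ennreal)
    define \<kappa> where "\<kappa> = a powr (1 / p)"
    have \<kappa>: "0 < \<kappa>" "\<kappa> powr p = a" using a p by (auto simp: \<kappa>_def powr_powr)
    let ?L = "luxemburg_norm \<Phi> R (\<lambda>x. inverse (ennreal (v x)))"
    have "epowr ?A (1 / p) * ?L \<le> ennreal K"
      using bump R by (auto simp: bump_condition_def)
    then have "ennreal \<kappa> * ?L \<le> ennreal K"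
      using a by (simp add: epowr_def ext_infty_def \<kappa>_def)
    \<comment> \<open>The factor 2 leaves room for an l in the defining set of the infimum, also when the infimum is not attained.\<close>
    then have "?L < ennreal (2 * K / \<kappa>)"
      using \<kappa> K by (cases ?L) (auto simp: ennreal_mult_top ennreal_less_iff top_unique field_simps simp flip: ennreal_mult)
    then obtain l where l: "0 < l" "average R (\<lambda>x. ext_infty \<Phi> (inverse (ennreal (v x)) / ennreal l)) \<le> 1"
       "l < 2 * K / \<kappa>"
      unfolding luxemburg_norm_def INF_less_iff using K \<kappa> by (auto simp: ennreal_less_iff)
    define N where "N = b / (2 * l)"
    have N: "0 < N" using b l by (simp add: N_def)
    have "\<kappa> \<le> 2 * K / l" using l \<kappa> by (simp add: field_simps)
    then have "b * \<kappa> \<le> b * (2 * K / l)" using b by (intro mult_left_mono) auto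
    also have "\<dots> = 4 * K * N" by (simp add: N_def)
    finally have "(b * \<kappa>) powr p \<le> (4 * K * N) powr p"
      using b \<kappa> p by (intro powr_mono2) auto
    then have "b powr p * a \<le> (4 * K) powr p * N powr p"
      using b \<kappa> K N by (simp add: powr_mult)
    then have "b powr p * a * V \<le> (4 * K) powr p * N powr p * V"
      using V by (intro mult_right_mono) auto
    then have 1: "ennreal (b powr p) * weighted_measure ?w R \<le>
      ennreal ((4 * K) powr p) * (ennreal (N powr p) * emeasure lborel R)"
      using a a' V by (simp add: ac_simps ennreal_leI flip: ennreal_mult)
    have 2: "1 < average R (\<lambda>x. ennreal (\<psi> (s * h x)))" if s: "0 < s" "1 < s * N" for s
    proof (rule ccontr)
      assume neg: "\<not> 1 < average R (\<lambda>x. ennreal (\<psi> (s * h x)))"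
      let ?G = "\<lambda>x. ext_infty \<Phi> (inverse (ennreal (v x)) / ennreal l)"
      have Gm: "?G \<in> borel_measurable lebesgue" by measurable
      have "average R (\<lambda>x. ennreal (f x)) \<le> average R (\<lambda>x. ennreal (l / s) * (ennreal (\<psi> (s * h x)) + ?G x))"
      proof (rule average_mono_AE, use h in eventually_elim)
        fix x assume x: "v x * f x = h x"
        show "ennreal (f x) \<le> ennreal (l / s) * (ennreal (\<psi> (s * h x)) + ?G x)"
        \<comment> \<open>Where v vanishes, 1 / v is infinite and so is the right-hand side.\<close>
        proof (cases "v x = 0")
          case True
          then show ?thesis using l s by (simp add: ext_infty_def ennreal_top_divide ennreal_mult_top)
        next
          case False
          then have vx: "0 < v x" using v0[of x] by simp
          define t where "t = 1 / (v x * l)"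
          have t: "0 < t" using vx l by (simp add: t_def)
          have G: "?G x = ennreal (\<Phi> t)"
            using vx l by (simp add: inverse_ennreal divide_ennreal ext_infty_def t_def field_simps)
          have "ennreal (s * h x * t - \<Phi> t) \<le> ennreal (\<psi> (s * h x))"
            using complementary_young[OF t, of "s * h x" \<Phi>] by (simp add: \<psi>)
          then have "s * h x * t - \<Phi> t \<le> \<psi> (s * h x)" using \<psi>0[of "s * h x"] by (auto simp: ennreal_le_iff2)
          moreover have "s * h x * t = s / l * f x" using vx by (simp add: t_def flip: x)
          ultimately have "s / l * f x \<le> \<psi> (s * h x) + \<Phi> t" by simp
          then have "f x \<le> l / s * (\<psi> (s * h x) + \<Phi> t)" using s l by (simp add: field_simps)
          then show ?thesis using s l \<psi>0 \<Phi>0[of t] t unfolding G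
            by (simp add: ennreal_leI flip: ennreal_mult ennreal_plus)
        qed
      qed
      also have "\<dots> = ennreal (l / s) * (average R (\<lambda>x. ennreal (\<psi> (s * h x))) + average R ?G)"
        using Gm by (subst average_cmult) (auto simp: average_add)
      also have "\<dots> \<le> ennreal (l / s) * (1 + 1)"
        using neg l by (intro mult_left_mono add_mono) auto
      also have "\<dots> = ennreal (2 * l / s)"
        using l s by (simp add: one_add_one ennreal_mult'[symmetric] flip: ennreal_numeral)
      also have "\<dots> < ennreal b" using s l b by (intro ennreal_lessI) (auto simp: N_def field_simps)
      finally show False using b by simp
    qed
    show ?thesis using 1 2 N by (intro exI[of _ N]) (auto simp: \<psi>_def)
  qed
qed

section \<open>Finite families of rectangles\<close>

text \<open>
The part above height 1 / s of the supremum of b 1_R over the pairs (R, b) in F, as a set of pairs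
(x, s). Only s > 0 matters, since the tail density vanishes elsewhere.
\<close>

definition level_region :: "((real^'n) set \<times> real) set \<Rightarrow> ((real^'n) \<times> real) set" where
  "level_region F = (\<Union>(R, b)\<in>F. R \<times> {s. 1 < s * b})"

text \<open>
The p-th power of the supremum of b 1_R(x) over the pairs (R, b) in F. In this form it increases with F
by monotone convergence and is integrated against a weight by Tonelli's theorem.
\<close>

definition level_integral :: "real \<Rightarrow> ((real^'n) set \<times> real) set \<Rightarrow> real^'n \<Rightarrow> ennreal" where
  "level_integral p F x = (\<integral>\<^sup>+s. tail_density p s * indicator (level_region F) (x, s) \<partial>lborel)"

lemma open_level_region:
  assumes "\<And>R b. (R, b) \<in> F \<Longrightarrow> open R"
  shows "open (level_region F)"
proof -
  have "open {s. 1 < s * b}" for b :: real by (intro open_Collect_less continuous_intros)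
  then show ?thesis using assms unfolding level_region_def by (auto intro!: open_UN open_Times)
qed

lemma measurable_level_region:
  assumes "\<And>R b. (R, b) \<in> F \<Longrightarrow> open R"
  shows "(\<lambda>(x, s). indicator (level_region F) (x, s) :: ennreal) \<in> borel_measurable (lborel \<Otimes>\<^sub>M lborel)"
proof -
  have "level_region F \<in> sets (borel \<Otimes>\<^sub>M borel)"
    unfolding borel_prod using open_level_region[OF assms] by auto
  then have "indicator (level_region F) \<in> borel_measurable (borel \<Otimes>\<^sub>M (borel :: real measure))"
    by (rule borel_measurable_indicator)
  then show ?thesis by (simp add: lborel_prod borel_prod cong: measurable_cong_sets)
qed

lemma weighted_measure_UN_le:
  assumes [measurable]: "w \<in> borel_measurable lebesgue" and T: "finite T"
    and R: "\<And>i. i \<in> T \<Longrightarrow> R i \<in> sets lebesgue"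
  shows "weighted_measure w (\<Union>i\<in>T. R i) \<le> (\<Sum>i\<in>T. weighted_measure w (R i))"
proof -
  have "weighted_measure w (\<Union>i\<in>T. R i) \<le> (\<integral>\<^sup>+x. (\<Sum>i\<in>T. ennreal (w x) * indicator (R i) x) \<partial>lebesgue)"
    unfolding weighted_measure_def
  proof (rule nn_integral_mono)
    fix x
    show "ennreal (w x) * indicator (\<Union>i\<in>T. R i) x \<le> (\<Sum>i\<in>T. ennreal (w x) * indicator (R i) x)"
    proof (cases "x \<in> (\<Union>i\<in>T. R i)")
      case True
      then obtain i where i: "i \<in> T" "x \<in> R i" by auto
      then have "ennreal (w x) * indicator (R i) x \<le> (\<Sum>i\<in>T. ennreal (w x) * indicator (R i) x)"
        by (intro member_le_sum T) auto
      then show ?thesis using i True by simp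
    qed simp
  qed
  also have "\<dots> = (\<Sum>i\<in>T. weighted_measure w (R i))"
    unfolding weighted_measure_def using R by (subst nn_integral_sum) auto
  finally show ?thesis .
qed

lemma weighted_measure_mono: "A \<subseteq> B \<Longrightarrow> weighted_measure w A \<le> weighted_measure w B"
  unfolding weighted_measure_def by (intro nn_integral_mono) (auto simp: indicator_def)

text \<open>
If b_j > 1 / s, then every selected rectangle that precedes the j-th one also has b_i > 1 / s, because the
b_j decrease. So the union of the selected rectangles of height above 1 / s covers more than the
fraction l of R_j, and R_j lies in the set to which condition (A) applies.
\<close>

lemma condition_A_selection:
  fixes w :: "real^'n::finite \<Rightarrow> real" and R :: "nat \<Rightarrow> (real^'n) set"
  assumes [measurable]: "w \<in> borel_measurable lebesgue"
    and l: "0 < l" "l < 1"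
    and A: "\<And>E. E \<in> sets lebesgue \<Longrightarrow>
      weighted_measure w {x. strong_maximal (indicator E) x > ennreal l} \<le> ennreal c * weighted_measure w E"
    and R: "\<And>j. j < m \<Longrightarrow> R j \<in> rectangles"
    and b: "\<And>i j. i \<le> j \<Longrightarrow> j < m \<Longrightarrow> b j \<le> (b i :: real)"
  shows "\<exists>S\<subseteq>{..<m}.
    (\<forall>s>0. weighted_measure w (\<Union>j\<in>{j. j < m \<and> 1 < s * b j}. R j) \<le>
        ennreal c * (\<Sum>i\<in>{i\<in>S. 1 < s * b i}. weighted_measure w (R i))) \<and>
    (\<forall>j\<in>S. ennreal (1 - l) * emeasure lborel (R j) \<le> emeasure lborel (R j - (\<Union>i\<in>{i\<in>S. i < j}. R i)))"
proof -
  have Rs: "\<And>j. j < m \<Longrightarrow> R j \<in> sets lborel" using R rectangle_borel by auto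
  have "\<exists>S\<subseteq>{..<m}.
    (\<forall>j<m. ennreal l * emeasure lborel (R j) < emeasure lborel (R j \<inter> (\<Union>i\<in>{i\<in>S. i \<le> j}. R i))) \<and>
    (\<forall>j\<in>S. ennreal (1 - l) * emeasure lborel (R j) \<le> emeasure lborel (R j - (\<Union>i\<in>{i\<in>S. i < j}. R i)))"
    by (rule scattered_subfamily) (fact Rs rectangle_measure(1)[OF R] rectangle_measure(2)[OF R] l)+
  then obtain S where S1: "S \<subseteq> {..<m}"
    and S2: "\<forall>j<m. ennreal l * emeasure lborel (R j) < emeasure lborel (R j \<inter> (\<Union>i\<in>{i\<in>S. i \<le> j}. R i))"
    and S3: "\<forall>j\<in>S. ennreal (1 - l) * emeasure lborel (R j) \<le> emeasure lborel (R j - (\<Union>i\<in>{i\<in>S. i < j}. R i))"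
    by (elim exE conjE)
  have "weighted_measure w (\<Union>j\<in>{j. j < m \<and> 1 < s * b j}. R j) \<le>
        ennreal c * (\<Sum>i\<in>{i\<in>S. 1 < s * b i}. weighted_measure w (R i))" if s: "0 < s" for s
  proof -
    let ?T = "{i\<in>S. 1 < s * b i}"
    have T: "finite ?T" using S1 finite_subset[of S "{..<m}"] by auto
    have RT: "R i \<in> sets borel" if "i \<in> ?T" for i using S1 R rectangle_borel that by auto
    define E where "E = (\<Union>i\<in>?T. R i)"
    have Eb: "E \<in> sets borel" unfolding E_def using T RT by (intro sets.finite_UN) auto
    have "(\<Union>j\<in>{j. j < m \<and> 1 < s * b j}. R j) \<subseteq> {x. strong_maximal (indicator E) x > ennreal l}"
    proof clarify
      fix x j assume j: "j < m" "1 < s * b j" "x \<in> R j"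
      have bor: "R j \<in> sets borel" using rectangle_borel R j by auto
      have sub: "{i\<in>S. i \<le> j} \<subseteq> ?T"
      proof clarify
        fix i assume "i \<in> S" "i \<le> j"
        then have "s * b j \<le> s * b i" using b j s by (intro mult_left_mono) auto
        then show "1 < s * b i" using j by simp
      qed
      have "ennreal l * emeasure lborel (R j) < emeasure lborel (R j \<inter> (\<Union>i\<in>{i\<in>S. i \<le> j}. R i))"
        using S2 j(1) by blast
      also have "\<dots> \<le> emeasure lborel (R j \<inter> E)"
        using sub bor Eb unfolding E_def by (intro emeasure_mono) auto
      finally have lt: "ennreal l * emeasure lborel (R j) < emeasure lborel (R j \<inter> E)" .
      obtain V where V: "emeasure lborel (R j) = ennreal V" "0 < V"
        using rectangle_measure[OF R[OF j(1)]] by (cases "emeasure lborel (R j)") (auto simp: less_le)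
      have "emeasure lborel (R j \<inter> E) \<le> ennreal V" unfolding V(1)[symmetric] using bor by (intro emeasure_mono) auto
      then obtain V' where V': "emeasure lborel (R j \<inter> E) = ennreal V'" "0 \<le> V'"
        by (cases "emeasure lborel (R j \<inter> E)") (auto simp: top_unique)
      have "l * V < V'" using lt l V V' by (simp add: ennreal_less_iff flip: ennreal_mult)
      then have "ennreal l < ennreal V' / ennreal V"
        using l V V' by (simp add: divide_ennreal ennreal_less_iff field_simps)
      also have "\<dots> = average (R j) (\<lambda>y. ennreal \<bar>indicator E y\<bar>)"
      proof -
        have "(\<integral>\<^sup>+y. ennreal \<bar>indicator E y\<bar> * indicator (R j) y \<partial>lborel) = (\<integral>\<^sup>+y. indicator (R j \<inter> E) y \<partial>lborel)"
          by (intro nn_integral_cong) (auto simp: indicator_def)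
        then show ?thesis using bor Eb V V' by (simp add: average_lborel)
      qed
      also have "\<dots> \<le> strong_maximal (indicator E) x"
        unfolding strong_maximal_def using R j by (intro SUP_upper) auto
      finally show "ennreal l < strong_maximal (indicator E) x" .
    qed
    then have "weighted_measure w (\<Union>j\<in>{j. j < m \<and> 1 < s * b j}. R j) \<le>
        weighted_measure w {x. strong_maximal (indicator E) x > ennreal l}"
      by (rule weighted_measure_mono)
    also have "\<dots> \<le> ennreal c * weighted_measure w E" using A Eb by simp
    also have "\<dots> \<le> ennreal c * (\<Sum>i\<in>?T. weighted_measure w (R i))"
      unfolding E_def using RT by (intro mult_left_mono weighted_measure_UN_le T) auto
    finally show ?thesis .
  qed
  then show ?thesis using S1 S3 by (intro exI[of _ S] conjI allI impI)
qed

text \<open>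
Replace R_i by its part E_i that is not covered by earlier rectangles; these parts are disjoint. Where
s N_i > 1, the average of \<psi>(s h) over R_i exceeds 1, so at level s the sum of the |E_i| is at
most the measure in the theorem of Jessen, Marcinkiewicz and Zygmund. Dilating s by h(x) leaves
h(x)^p times a constant.
\<close>

lemma scattered_sum_le:
  fixes h :: "real^'n::finite \<Rightarrow> real" and \<psi> :: "real \<Rightarrow> real"
  assumes p: "0 < p" and S: "finite S" and R: "\<And>i. i \<in> S \<Longrightarrow> R i \<in> rectangles" and N: "\<And>i. i \<in> S \<Longrightarrow> 0 \<le> N i"
    and l: "\<And>j. j \<in> S \<Longrightarrow> ennreal l' * emeasure lborel (R j) \<le> emeasure lborel (R j - (\<Union>i\<in>{i\<in>S. i < (j::nat)}. R i))"
    and [measurable]: "h \<in> borel_measurable borel" and h: "\<And>x. 0 \<le> h x"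
    and [measurable]: "\<psi> \<in> borel_measurable borel" and \<psi>: "\<And>s. 0 \<le> \<psi> s" "\<psi> 0 = 0"
    and test: "\<And>i s. i \<in> S \<Longrightarrow> 0 < s \<Longrightarrow> 1 < s * N i \<Longrightarrow> 1 < average (R i) (\<lambda>x. ennreal (\<psi> (s * h x)))"
  shows "ennreal l' * (\<Sum>i\<in>S. ennreal (N i powr p) * emeasure lborel (R i)) \<le>
    (\<integral>\<^sup>+s. tail_density p s * ennreal (jmz_gauge CARD('n) (\<psi> s)) \<partial>lborel) *
      (\<integral>\<^sup>+x. ennreal (h x powr p) \<partial>lborel)"
proof -
  define E where "E j = R j - (\<Union>i\<in>{i\<in>S. i < j}. R i)" for j
  have Rb: "R i \<in> sets borel" if "i \<in> S" for i using R that rectangle_borel by auto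
  have Eb: "E i \<in> sets borel" if "i \<in> S" for i
    unfolding E_def using Rb S that by (intro sets.Diff sets.finite_UN) auto
  have disj: "disjoint_family_on E S"
    unfolding disjoint_family_on_def
  proof (intro ballI impI)
    fix i j assume "i \<in> S" "j \<in> S" "i \<noteq> j"
    then show "E i \<inter> E j = {}" unfolding E_def by (cases i j rule: linorder_cases) auto
  qed
  let ?k = "\<integral>\<^sup>+s. tail_density p s * ennreal (jmz_gauge CARD('n) (\<psi> s)) \<partial>lborel"
  have "ennreal l' * (\<Sum>i\<in>S. ennreal (N i powr p) * emeasure lborel (R i)) =
     (\<Sum>i\<in>S. ennreal (N i powr p) * (ennreal l' * emeasure lborel (R i)))"
    by (simp add: sum_distrib_left ac_simps)
  also have "\<dots> \<le> (\<Sum>i\<in>S. ennreal (N i powr p) * emeasure lborel (E i))"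
    unfolding E_def by (intro sum_mono mult_left_mono l) auto
  also have "\<dots> = (\<Sum>i\<in>S. (\<integral>\<^sup>+s. tail_density p s * indicator {s. 1 < s * N i} s * emeasure lborel (E i) \<partial>lborel))"
    using N p by (intro sum.cong) (auto simp: nn_integral_multc nn_integral_tail_density)
  also have "\<dots> = (\<integral>\<^sup>+s. (\<Sum>i\<in>S. tail_density p s * indicator {s. 1 < s * N i} s * emeasure lborel (E i)) \<partial>lborel)"
    by (rule nn_integral_sum[symmetric]) measurable
  also have "\<dots> \<le> (\<integral>\<^sup>+s. tail_density p s * (\<integral>\<^sup>+x. ennreal (jmz_gauge CARD('n) (\<psi> (s * h x))) \<partial>lborel) \<partial>lborel)"
  proof (rule nn_integral_mono)
    fix s :: real
    show "(\<Sum>i\<in>S. tail_density p s * indicator {s. 1 < s * N i} s * emeasure lborel (E i)) \<le>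
      tail_density p s * (\<integral>\<^sup>+x. ennreal (jmz_gauge CARD('n) (\<psi> (s * h x))) \<partial>lborel)"
    proof (cases "0 < s")
      case s: True
      let ?T = "{i\<in>S. 1 < s * N i}"
      have "(\<Sum>i\<in>S. indicator {s. 1 < s * N i} s * emeasure lborel (E i)) = (\<Sum>i\<in>?T. emeasure lborel (E i))"
        using S by (intro sum.mono_neutral_cong_right) (auto simp: indicator_def)
      also have "\<dots> = emeasure lborel (\<Union>i\<in>?T. E i)"
        using S disj Eb by (intro sum_emeasure) (auto intro: disjoint_family_on_mono)
      also have "\<dots> \<le> emeasure lborel (\<Union>(R ` ?T))"
        using Rb S by (intro emeasure_mono sets.finite_UN) (auto simp: E_def)
      also have "\<dots> \<le> (\<integral>\<^sup>+x. ennreal (jmz_gauge CARD('n) (\<psi> (s * h x))) \<partial>lborel)"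
        using R test s \<psi> by (intro jessen_marcinkiewicz_zygmund) auto
      finally have "tail_density p s * (\<Sum>i\<in>S. indicator {s. 1 < s * N i} s * emeasure lborel (E i)) \<le>
        tail_density p s * (\<integral>\<^sup>+x. ennreal (jmz_gauge CARD('n) (\<psi> (s * h x))) \<partial>lborel)"
        by (rule mult_left_mono) simp
      then show ?thesis by (simp add: sum_distrib_left mult.assoc)
    qed (simp add: tail_density_def)
  qed
  also have "\<dots> = (\<integral>\<^sup>+s. (\<integral>\<^sup>+x. tail_density p s * ennreal (jmz_gauge CARD('n) (\<psi> (s * h x))) \<partial>lborel) \<partial>lborel)"
    by (intro nn_integral_cong nn_integral_cmult[symmetric]) measurable
  also have "\<dots> = (\<integral>\<^sup>+x. (\<integral>\<^sup>+s. tail_density p s * ennreal (jmz_gauge CARD('n) (\<psi> (s * h x))) \<partial>lborel) \<partial>lborel)"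
    by (rule lborel_pair.Fubini'[symmetric]) measurable
  also have "\<dots> \<le> (\<integral>\<^sup>+x. ?k * ennreal (h x powr p) \<partial>lborel)"
  proof (rule nn_integral_mono)
    fix x
    show "(\<integral>\<^sup>+s. tail_density p s * ennreal (jmz_gauge CARD('n) (\<psi> (s * h x))) \<partial>lborel) \<le> ?k * ennreal (h x powr p)"
    proof (cases "h x = 0")
      case True
      then show ?thesis by (simp add: \<psi> jmz_gauge_def)
    next
      case False
      then have "0 < h x" using h[of x] by simp
      from nn_integral_tail_density_scale[of "\<lambda>s. ennreal (jmz_gauge CARD('n) (\<psi> s))", OF _ this, of p]
      show ?thesis by (simp add: mult.commute)
    qed
  qed
  also have "\<dots> = ?k * (\<integral>\<^sup>+x. ennreal (h x powr p) \<partial>lborel)" by (rule nn_integral_cmult) measurable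
  finally show ?thesis .
qed

text \<open>
The constant does not depend on the family. The numbers c and l come from condition (A), and
\<kappa> from the bump condition.
\<close>

lemma finite_family_estimate:
  fixes w h :: "real^'n::finite \<Rightarrow> real" and \<psi> :: "real \<Rightarrow> real"
  assumes wm [measurable]: "w \<in> borel_measurable lebesgue"
    and l: "0 < l" "l < 1"
    and A: "\<And>E. E \<in> sets lebesgue \<Longrightarrow>
      weighted_measure w {x. strong_maximal (indicator E) x > ennreal l} \<le> ennreal c * weighted_measure w E"
    and p: "0 < p" and F: "finite F" "\<And>R b. (R, b) \<in> F \<Longrightarrow> R \<in> rectangles \<and> 0 < b"
    and [measurable]: "h \<in> borel_measurable borel" and h: "\<And>x. 0 \<le> h x"
    and [measurable]: "\<psi> \<in> borel_measurable borel" and \<psi>: "\<And>s. 0 \<le> \<psi> s" "\<psi> 0 = 0"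
    and test: "\<And>R b. (R, b) \<in> F \<Longrightarrow> \<exists>N\<ge>0.
      ennreal (b powr p) * weighted_measure w R \<le> ennreal \<kappa> * (ennreal (N powr p) * emeasure lborel R) \<and>
      (\<forall>s>0. 1 < s * N \<longrightarrow> 1 < average R (\<lambda>x. ennreal (\<psi> (s * h x))))"
  shows "ennreal (1 - l) * (\<integral>\<^sup>+x. ennreal (w x) * level_integral p F x \<partial>lebesgue) \<le>
    ennreal c * (ennreal \<kappa> * ((\<integral>\<^sup>+s. tail_density p s * ennreal (jmz_gauge CARD('n) (\<psi> s)) \<partial>lborel) *
      (\<integral>\<^sup>+x. ennreal (h x powr p) \<partial>lborel)))"
proof -
  obtain ys where ys: "set ys = F" using finite_list[OF F(1)] by auto
  \<comment> \<open>Sorting by the negated height lists the pairs with decreasing b.\<close>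
  define xs where "xs = sort_key (\<lambda>d. - snd d) ys"
  have xs: "set xs = F" "sorted (map (\<lambda>d. - snd d) xs)" using ys by (auto simp: xs_def)
  define m where "m = length xs"
  define R where "R j = fst (xs ! j)" for j
  define b where "b j = snd (xs ! j)" for j
  have Fj: "(R j, b j) \<in> F" if "j < m" for j
    using that xs(1) nth_mem[of j xs] by (simp add: R_def b_def m_def)
  have Rr: "R j \<in> rectangles" and b0: "0 < b j" if "j < m" for j using F(2)[OF Fj[OF that]] by auto
  have bmono: "b j \<le> b i" if "i \<le> j" "j < m" for i j
    using sorted_nth_mono[OF xs(2), of i j] that by (simp add: m_def b_def)
  have reg: "level_region F = (\<Union>j\<in>{..<m}. R j \<times> {s. 1 < s * b j})"
  proof -
    have "F = (\<lambda>j. (R j, b j)) ` {..<m}"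
      unfolding R_def b_def m_def using xs(1) by (auto simp: set_conv_nth)
    then show ?thesis by (simp add: level_region_def)
  qed
  obtain S where S: "S \<subseteq> {..<m}"
    "\<forall>s>0. weighted_measure w (\<Union>j\<in>{j. j < m \<and> 1 < s * b j}. R j) \<le>
        ennreal c * (\<Sum>i\<in>{i\<in>S. 1 < s * b i}. weighted_measure w (R i))"
    "\<forall>j\<in>S. ennreal (1 - l) * emeasure lborel (R j) \<le> emeasure lborel (R j - (\<Union>i\<in>{i\<in>S. i < j}. R i))"
    using condition_A_selection[of w l c m R b, OF wm l A Rr bmono] by auto
  have finS: "finite S" using S(1) finite_subset by blast
  have "\<forall>i\<in>S. \<exists>N\<ge>0.
      ennreal (b i powr p) * weighted_measure w (R i) \<le> ennreal \<kappa> * (ennreal (N powr p) * emeasure lborel (R i)) \<and>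
      (\<forall>s>0. 1 < s * N \<longrightarrow> 1 < average (R i) (\<lambda>x. ennreal (\<psi> (s * h x))))"
    using test Fj S(1) by blast
  then obtain N where N: "\<And>i. i \<in> S \<Longrightarrow> 0 \<le> N i"
      "\<And>i. i \<in> S \<Longrightarrow> ennreal (b i powr p) * weighted_measure w (R i) \<le> ennreal \<kappa> * (ennreal (N i powr p) * emeasure lborel (R i))"
      "\<And>i s. i \<in> S \<Longrightarrow> 0 < s \<Longrightarrow> 1 < s * N i \<Longrightarrow> 1 < average (R i) (\<lambda>x. ennreal (\<psi> (s * h x)))"
    by metis
  obtain w' where [measurable]: "w' \<in> borel_measurable lborel" and w': "AE x in lborel. w x = w' x"
    using completion_ex_borel_measurable_real[OF wm] by auto
  have "\<And>R b. (R, b) \<in> F \<Longrightarrow> open R" using F(2) rectangle_open by auto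
  note reg_m [measurable] = measurable_level_region[OF this]
  have "(\<integral>\<^sup>+x. ennreal (w x) * level_integral p F x \<partial>lebesgue) =
      (\<integral>\<^sup>+x. (\<integral>\<^sup>+s. ennreal (w' x) * (tail_density p s * indicator (level_region F) (x, s)) \<partial>lborel) \<partial>lborel)"
    unfolding nn_integral_completion level_integral_def
    using w' by (intro nn_integral_cong_AE) (auto elim!: eventually_mono simp: nn_integral_cmult)
  also have "\<dots> = (\<integral>\<^sup>+s. (\<integral>\<^sup>+x. ennreal (w' x) * (tail_density p s * indicator (level_region F) (x, s)) \<partial>lborel) \<partial>lborel)"
    by (rule lborel_pair.Fubini'[symmetric]) measurable
  also have "\<dots> = (\<integral>\<^sup>+s. tail_density p s * weighted_measure w (\<Union>j\<in>{j. j < m \<and> 1 < s * b j}. R j) \<partial>lborel)"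
  proof (rule nn_integral_cong)
    fix s :: real
    define U where "U = (\<Union>j\<in>{j. j < m \<and> 1 < s * b j}. R j)"
    have [measurable]: "U \<in> sets borel"
      unfolding U_def using Rr rectangle_borel by (intro sets.finite_UN) auto
    have "indicator (level_region F) (x, s) = (indicator U x :: ennreal)" for x
      by (auto simp: indicator_def reg U_def)
    then have "(\<integral>\<^sup>+x. ennreal (w' x) * (tail_density p s * indicator (level_region F) (x, s)) \<partial>lborel) =
        (\<integral>\<^sup>+x. tail_density p s * (ennreal (w' x) * indicator U x) \<partial>lborel)"
      by (simp add: ac_simps)
    also have "\<dots> = tail_density p s * (\<integral>\<^sup>+x. ennreal (w' x) * indicator U x \<partial>lborel)"
      by (rule nn_integral_cmult) measurable
    also have "(\<integral>\<^sup>+x. ennreal (w' x) * indicator U x \<partial>lborel) = weighted_measure w U"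
      unfolding weighted_measure_def nn_integral_completion
      using w' by (intro nn_integral_cong_AE) (auto elim!: eventually_mono)
    finally show "(\<integral>\<^sup>+x. ennreal (w' x) * (tail_density p s * indicator (level_region F) (x, s)) \<partial>lborel) =
       tail_density p s * weighted_measure w (\<Union>j\<in>{j. j < m \<and> 1 < s * b j}. R j)" by (simp add: U_def)
  qed
  also have "\<dots> \<le> (\<integral>\<^sup>+s. ennreal c * (\<Sum>i\<in>S. tail_density p s * indicator {s. 1 < s * b i} s * weighted_measure w (R i)) \<partial>lborel)"
  proof (rule nn_integral_mono)
    fix s :: real
    show "tail_density p s * weighted_measure w (\<Union>j\<in>{j. j < m \<and> 1 < s * b j}. R j) \<le>
      ennreal c * (\<Sum>i\<in>S. tail_density p s * indicator {s. 1 < s * b i} s * weighted_measure w (R i))"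
    proof (cases "0 < s")
      case s: True
      have "(\<Sum>i\<in>{i\<in>S. 1 < s * b i}. weighted_measure w (R i)) =
          (\<Sum>i\<in>S. indicator {s. 1 < s * b i} s * weighted_measure w (R i))"
        using finS by (intro sum.mono_neutral_cong_left) (auto simp: indicator_def)
      then have "weighted_measure w (\<Union>j\<in>{j. j < m \<and> 1 < s * b j}. R j) \<le>
          ennreal c * (\<Sum>i\<in>S. indicator {s. 1 < s * b i} s * weighted_measure w (R i))"
        using S(2) s by auto
      then have "tail_density p s * weighted_measure w (\<Union>j\<in>{j. j < m \<and> 1 < s * b j}. R j) \<le>
          tail_density p s * (ennreal c * (\<Sum>i\<in>S. indicator {s. 1 < s * b i} s * weighted_measure w (R i)))"
        by (rule mult_left_mono) simp
      then show ?thesis by (simp add: sum_distrib_left ac_simps)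
    qed (simp add: tail_density_def)
  qed
  also have "\<dots> = ennreal c * (\<Sum>i\<in>S. (\<integral>\<^sup>+s. tail_density p s * indicator {s. 1 < s * b i} s * weighted_measure w (R i) \<partial>lborel))"
    by (subst nn_integral_cmult, measurable, subst nn_integral_sum) auto
  also have "\<dots> = ennreal c * (\<Sum>i\<in>S. ennreal (b i powr p) * weighted_measure w (R i))"
  proof -
    have "0 \<le> b i" if "i \<in> S" for i using b0[of i] S(1) that by auto
    then show ?thesis using p
      by (intro arg_cong[where f="\<lambda>x. ennreal c * x"] sum.cong) (auto simp: nn_integral_multc nn_integral_tail_density)
  qed
  also have "\<dots> \<le> ennreal c * (\<Sum>i\<in>S. ennreal \<kappa> * (ennreal (N i powr p) * emeasure lborel (R i)))"
    by (intro mult_left_mono sum_mono N) auto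
  finally have "ennreal (1 - l) * (\<integral>\<^sup>+x. ennreal (w x) * level_integral p F x \<partial>lebesgue) \<le>
     ennreal (1 - l) * (ennreal c * (\<Sum>i\<in>S. ennreal \<kappa> * (ennreal (N i powr p) * emeasure lborel (R i))))"
    by (rule mult_left_mono) simp
  also have "\<dots> = ennreal c * (ennreal \<kappa> * (ennreal (1 - l) * (\<Sum>i\<in>S. ennreal (N i powr p) * emeasure lborel (R i))))"
    by (simp add: ac_simps flip: sum_distrib_left)
  also have "\<dots> \<le> ennreal c * (ennreal \<kappa> * ((\<integral>\<^sup>+s. tail_density p s * ennreal (jmz_gauge CARD('n) (\<psi> s)) \<partial>lborel) *
      (\<integral>\<^sup>+x. ennreal (h x powr p) \<partial>lborel)))"
    using S(1,3) Rr N h \<psi> p finS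
    by (intro mult_left_mono scattered_sum_le) auto
  finally show ?thesis .
qed

section \<open>Passage to the maximal function\<close>

lemma tail_density_integral_infinite:
  assumes "0 < p"
  shows "(\<integral>\<^sup>+s. tail_density p s \<partial>lborel) = \<infinity>"
proof (rule ccontr)
  assume "(\<integral>\<^sup>+s. tail_density p s \<partial>lborel) \<noteq> \<infinity>"
  then obtain r where r: "(\<integral>\<^sup>+s. tail_density p s \<partial>lborel) = ennreal r" "0 \<le> r"
    by (cases "\<integral>\<^sup>+s. tail_density p s \<partial>lborel") auto
  define x where "x = (r + 1) powr (1 / p)"
  have "ennreal (x powr p) = (\<integral>\<^sup>+s. tail_density p s * indicator {s. 1 < s * x} s \<partial>lborel)"
    using assms by (simp add: nn_integral_tail_density x_def)
  also have "\<dots> \<le> ennreal r" unfolding r(1)[symmetric]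
    by (intro nn_integral_mono) (auto simp: indicator_def)
  finally show False using r assms by (simp add: x_def powr_powr)
qed

text \<open>
For every rational height q, the rectangles on which f has average above q have the same union as countably
many of them, by Lindelof's theorem. Countability is what allows monotone convergence along finite
families.
\<close>

lemma countable_level_description:
  fixes f :: "real^'n \<Rightarrow> real"
  assumes f: "\<And>x. 0 \<le> f x"
  obtains D where "countable D"
    "\<And>R b. (R, b) \<in> D \<Longrightarrow> R \<in> rectangles \<and> 0 < b \<and> ennreal b < average R (\<lambda>x. ennreal (f x))"
    "\<And>x \<tau>. 0 \<le> \<tau> \<Longrightarrow> ennreal \<tau> < strong_maximal f x \<longleftrightarrow> (\<exists>(R, b)\<in>D. x \<in> R \<and> \<tau> < b)"
proof -
  let ?av = "\<lambda>R. average R (\<lambda>x. ennreal (f x))"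
  define \<F> where "\<F> q = {R \<in> rectangles. ennreal q < ?av R}" for q
  have "\<exists>G\<subseteq>\<F> q. countable G \<and> \<Union>G = \<Union>(\<F> q)" for q
    by (rule Lindelof[of "\<F> q"]) (auto simp: \<F>_def rectangle_open)
  then obtain G where G: "\<And>q. G q \<subseteq> \<F> q" "\<And>q. countable (G q)" "\<And>q. \<Union>(G q) = \<Union>(\<F> q)"
    by metis
  define D where "D = (\<Union>q\<in>{q\<in>\<rat>. 0 < q}. (\<lambda>R. (R, q)) ` G q)"
  have cD: "countable D"
    unfolding D_def by (intro countable_UN countable_image G(2)) (auto intro: countable_subset[OF _ countable_rat])
  have D: "R \<in> rectangles \<and> 0 < b \<and> ennreal b < ?av R" if "(R, b) \<in> D" for R b
    using that G(1) by (auto simp: D_def \<F>_def)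
  have lev: "ennreal \<tau> < strong_maximal f x \<longleftrightarrow> (\<exists>(R, b)\<in>D. x \<in> R \<and> \<tau> < b)" if \<tau>: "0 \<le> \<tau>" for x \<tau>
  proof
    assume "ennreal \<tau> < strong_maximal f x"
    then obtain R where R: "R \<in> rectangles" "x \<in> R" "ennreal \<tau> < ?av R"
      using f by (auto simp: strong_maximal_def less_SUP_iff)
    obtain \<sigma> where \<sigma>: "\<tau> < \<sigma>" "ennreal \<sigma> \<le> ?av R"
    proof (cases "?av R")
      case (real r)
      then show ?thesis using R(3) \<tau> by (intro that[of r]) (auto simp: ennreal_less_iff)
    qed (use that[of "\<tau> + 1"] in auto)
    obtain q where q: "q \<in> \<rat>" "\<tau> < q" "q < \<sigma>" using Rats_dense_in_real[OF \<sigma>(1)] by auto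
    have "ennreal q < ?av R" using q \<tau> by (intro less_le_trans[OF _ \<sigma>(2)]) (auto simp: ennreal_less_iff)
    then have "x \<in> \<Union>(\<F> q)" using R by (auto simp: \<F>_def)
    then obtain R' where "R' \<in> G q" "x \<in> R'" using G(3)[of q] by auto
    then show "\<exists>(R, b)\<in>D. x \<in> R \<and> \<tau> < b" using q \<tau> unfolding D_def by (intro bexI[of _ "(R', q)"]) auto
  next
    assume "\<exists>(R, b)\<in>D. x \<in> R \<and> \<tau> < b"
    then obtain R b where Rb: "(R, b) \<in> D" "x \<in> R" "\<tau> < b" by auto
    then have "ennreal \<tau> < ennreal b" using \<tau> by (simp add: ennreal_less_iff)
    also have "\<dots> < ?av R" using D[OF Rb(1)] by simp
    also have "\<dots> \<le> strong_maximal f x"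
      unfolding strong_maximal_def using f D[OF Rb(1)] Rb(2) by (intro SUP_upper2[of R]) auto
    finally show "ennreal \<tau> < strong_maximal f x" .
  qed
  show thesis by (rule that[OF cD D lev])
qed

text \<open>
The identity includes the points where M is infinite: there both sides are infinite if u > 0 and
0 if u = 0.
\<close>

lemma maximal_powr_level_integral:
  assumes p: "0 < p" and u: "0 \<le> u"
    and D: "\<And>\<tau>. 0 \<le> \<tau> \<Longrightarrow> ennreal \<tau> < M \<longleftrightarrow> (\<exists>(R, b)\<in>D. x \<in> R \<and> \<tau> < b)"
  shows "epowr (ennreal u * M) p = ennreal (u powr p) * level_integral p D x"
proof -
  have iff: "(x, s) \<in> level_region D \<longleftrightarrow> ennreal (1 / s) < M" if "0 < s" for s
    using D[of "1 / s"] that by (auto simp: level_region_def field_simps split: prod.splits)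
  show ?thesis
  proof (cases M)
    case (real r)
    have "level_integral p D x = (\<integral>\<^sup>+s. tail_density p s * indicator {s. 1 < s * r} s \<partial>lborel)"
      unfolding level_integral_def
    proof (rule nn_integral_cong)
      fix s :: real
      show "tail_density p s * indicator (level_region D) (x, s) = tail_density p s * indicator {s. 1 < s * r} s"
        using iff[of s] real by (cases "0 < s") (auto simp: tail_density_def indicator_def ennreal_less_iff field_simps)
    qed
    also have "\<dots> = ennreal (r powr p)" using p real by (intro nn_integral_tail_density) auto
    finally show ?thesis using real u
      by (simp add: epowr_def ext_infty_def powr_mult flip: ennreal_mult)
  next
    case top
    have "level_integral p D x = (\<integral>\<^sup>+s. tail_density p s \<partial>lborel)"
      unfolding level_integral_def
    proof (rule nn_integral_cong)
      fix s :: real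
      show "tail_density p s * indicator (level_region D) (x, s) = tail_density p s"
        using iff[of s] top by (cases "0 < s") (auto simp: tail_density_def indicator_def)
    qed
    then have "level_integral p D x = \<infinity>" using tail_density_integral_infinite[OF p] by simp
    then show ?thesis using top u p
      by (cases "u = 0") (auto simp: epowr_def ext_infty_def ennreal_mult_top)
  qed
qed

lemma level_region_mono: "F \<subseteq> G \<Longrightarrow> level_region F \<subseteq> level_region G"
  by (auto simp: level_region_def)

lemma measurable_level_integral:
  assumes "\<And>R b. (R, b) \<in> F \<Longrightarrow> open R"
  shows "level_integral p F \<in> borel_measurable lebesgue"
proof -
  note [measurable] = measurable_level_region[OF assms]
  have "(\<lambda>x. level_integral p F x) \<in> borel_measurable lborel"
    unfolding level_integral_def by measurable
  then show ?thesis by (simp add: measurable_completion)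
qed

lemma weighted_level_integral_SUP:
  assumes wm [measurable]: "w \<in> borel_measurable lebesgue"
    and D: "\<And>R b. (R, b) \<in> D \<Longrightarrow> open R"
    and F: "incseq F" "(\<Union>m. F m) = D"
  shows "(\<integral>\<^sup>+x. ennreal (w x) * level_integral p D x \<partial>lebesgue) =
    (SUP m. \<integral>\<^sup>+x. ennreal (w x) * level_integral p (F m) x \<partial>lebesgue)"
proof -
  have Fo: "open R" if "(R, b) \<in> F m" for R b m using that F(2) D by blast
  have lev: "level_integral p G x = emeasure (density lborel (tail_density p)) {s. (x, s) \<in> level_region G}"
    and bor: "{s. (x, s) \<in> level_region G} \<in> sets borel"
    if "\<And>R b. (R, b) \<in> G \<Longrightarrow> open R" for G x
  proof -
    have "open ((\<lambda>s. (x, s)) -` level_region G)"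
      using that by (intro open_vimage open_level_region continuous_intros)
    then show *: "{s. (x, s) \<in> level_region G} \<in> sets borel" by (simp add: vimage_def)
    show "level_integral p G x = emeasure (density lborel (tail_density p)) {s. (x, s) \<in> level_region G}"
      unfolding level_integral_def using * by (subst emeasure_density) (auto simp: indicator_def)
  qed
  have mono: "level_integral p (F m) x \<le> level_integral p (F m') x" if "m \<le> m'" for m m' x
    using level_region_mono[OF incseqD[OF F(1) that]] unfolding level_integral_def
    by (intro nn_integral_mono mult_left_mono) (auto simp: indicator_def)
  have sup: "level_integral p D x = (SUP m. level_integral p (F m) x)" for x
  proof -
    have reg: "{s. (x, s) \<in> level_region D} = (\<Union>m. {s. (x, s) \<in> level_region (F m)})"
      unfolding level_region_def F(2)[symmetric] by auto
    have inc: "incseq (\<lambda>m. {s. (x, s) \<in> level_region (F m)})"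
      using level_region_mono[OF incseqD[OF F(1)]] by (auto simp: incseq_def)
    have "(SUP m. emeasure (density lborel (tail_density p)) {s. (x, s) \<in> level_region (F m)}) =
      emeasure (density lborel (tail_density p)) (\<Union>m. {s. (x, s) \<in> level_region (F m)})"
      using bor[OF Fo] by (intro SUP_emeasure_incseq inc) auto
    moreover have "level_integral p (F m) x =
        emeasure (density lborel (tail_density p)) {s. (x, s) \<in> level_region (F m)}" for m
      by (rule lev) (rule Fo)
    moreover have "level_integral p D x =
        emeasure (density lborel (tail_density p)) {s. (x, s) \<in> level_region D}"
      by (rule lev) (rule D)
    ultimately show ?thesis by (simp add: reg)
  qed
  have "(\<integral>\<^sup>+x. ennreal (w x) * level_integral p D x \<partial>lebesgue) =
      (\<integral>\<^sup>+x. (SUP m. ennreal (w x) * level_integral p (F m) x) \<partial>lebesgue)"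
    by (simp add: sup SUP_mult_left_ennreal)
  also have "\<dots> = (SUP m. \<integral>\<^sup>+x. ennreal (w x) * level_integral p (F m) x \<partial>lebesgue)"
  proof (rule nn_integral_monotone_convergence_SUP)
    show "incseq (\<lambda>m x. ennreal (w x) * level_integral p (F m) x)"
      by (auto simp: incseq_def le_fun_def intro!: mult_left_mono mono)
    fix m
    have [measurable]: "level_integral p (F m) \<in> borel_measurable lebesgue"
      by (rule measurable_level_integral[OF Fo])
    show "(\<lambda>x. ennreal (w x) * level_integral p (F m) x) \<in> borel_measurable lebesgue" by measurable
  qed
  finally show ?thesis .
qed

theorem bump_sufficient:
  fixes u v :: "real^'n::finite \<Rightarrow> real"
  assumes p: "1 < p" and Y: "young_function \<Phi>" and B: "B_star CARD('n) p (complementary \<Phi>)"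
    and u: "weight u" and v: "weight v" and A: "condition_A (\<lambda>x. u x powr p)"
    and K: "0 < K" and bump: "bump_condition p \<Phi> u v K"
  shows "\<exists>C::real. 0 < C \<and>
    (\<forall>f\<in>borel_measurable lebesgue. (\<forall>x. 0 \<le> f x) \<longrightarrow>
      (\<integral>\<^sup>+x. epowr (ennreal (u x) * strong_maximal f x) p \<partial>lebesgue)
        \<le> ennreal C * (\<integral>\<^sup>+x. ennreal ((v x * f x) powr p) \<partial>lebesgue))"
proof -
  define w where "w x = u x powr p" for x
  obtain l c where l: "0 < l" "l < 1" and c: "0 < c" and Ac: "\<And>E. E \<in> sets lebesgue \<Longrightarrow>
      weighted_measure w {x. strong_maximal (indicator E) x > ennreal l} \<le> ennreal c * weighted_measure w E"
    using A unfolding condition_A_def w_def by blast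
  have W: "weight w" using A unfolding condition_A_def w_def by blast
  have wm: "w \<in> borel_measurable lebesgue" using W by (simp add: weight_def)
  have vm [measurable]: "v \<in> borel_measurable lebesgue" and v0: "\<And>x. 0 \<le> v x" using v by (auto simp: weight_def)
  have u0: "\<And>x. 0 \<le> u x" using u by (auto simp: weight_def)
  define \<psi> where "\<psi> = (\<lambda>s. enn2real (complementary \<Phi> s))"
  have fin: "complementary \<Phi> s < \<infinity>" for s by (rule B_star_finite[OF B])
  have \<psi>m: "\<psi> \<in> borel_measurable borel"
    unfolding \<psi>_def by (rule borel_measurable_mono[OF mono_real_complementary[OF fin]])
  have \<Phi>0: "0 \<le> \<Phi> t" if "0 \<le> t" for t using Y that by (auto simp: young_function_def)
  have \<psi>0: "0 \<le> \<psi> s" "\<psi> 0 = 0" for s using complementary_nonpos[of \<Phi> 0] \<Phi>0 by (auto simp: \<psi>_def)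
  have "(\<integral>\<^sup>+s. tail_density p s * ennreal (jmz_gauge CARD('n) (\<psi> s)) \<partial>lborel) < \<infinity>"
    unfolding \<psi>_def using p \<Phi>0 by (intro gauge_complementary_integral_finite B) auto
  then obtain k where k: "(\<integral>\<^sup>+s. tail_density p s * ennreal (jmz_gauge CARD('n) (\<psi> s)) \<partial>lborel) = ennreal k" "0 \<le> k"
    by (cases "\<integral>\<^sup>+s. tail_density p s * ennreal (jmz_gauge CARD('n) (\<psi> s)) \<partial>lborel") auto
  define \<kappa> where "\<kappa> = (4 * K) powr p"
  define C where "C = c * (\<kappa> * k) / (1 - l) + 1"
  have C0: "0 \<le> c * (\<kappa> * k) / (1 - l)" using c k l by (simp add: \<kappa>_def)
  have main: "(\<integral>\<^sup>+x. epowr (ennreal (u x) * strong_maximal f x) p \<partial>lebesgue)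
        \<le> ennreal C * (\<integral>\<^sup>+x. ennreal ((v x * f x) powr p) \<partial>lebesgue)"
    if fm [measurable]: "f \<in> borel_measurable lebesgue" and f: "\<forall>x. 0 \<le> f x" for f
  proof -
    have vf: "(\<lambda>x. v x * f x) \<in> borel_measurable lebesgue" by measurable
    obtain h' where h': "h' \<in> borel_measurable lborel" "AE x in lborel. v x * f x = h' x"
      using completion_ex_borel_measurable_real[OF vf] by auto
    define h where "h x = max 0 (h' x)" for x
    have hm: "h \<in> borel_measurable borel" using h'(1) unfolding h_def by simp
    have h0: "0 \<le> h x" for x by (simp add: h_def)
    have hAE: "AE x in lborel. v x * f x = h x"
      using h'(2)
    proof eventually_elim
      fix x assume "v x * f x = h' x"
      moreover have "0 \<le> v x * f x" using v0 f by simp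
      ultimately show "v x * f x = h x" by (simp add: h_def)
    qed
    have hp: "(\<integral>\<^sup>+x. ennreal ((v x * f x) powr p) \<partial>lebesgue) = (\<integral>\<^sup>+x. ennreal (h x powr p) \<partial>lborel)"
      unfolding nn_integral_completion using hAE by (intro nn_integral_cong_AE) (auto elim!: eventually_mono)
    let ?H = "\<integral>\<^sup>+x. ennreal (h x powr p) \<partial>lborel"
    obtain D where D: "countable D"
      "\<And>R b. (R, b) \<in> D \<Longrightarrow> R \<in> rectangles \<and> 0 < b \<and> ennreal b < average R (\<lambda>x. ennreal (f x))"
      "\<And>x \<tau>. 0 \<le> \<tau> \<Longrightarrow> ennreal \<tau> < strong_maximal f x \<longleftrightarrow> (\<exists>(R, b)\<in>D. x \<in> R \<and> \<tau> < b)"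
      by (rule countable_level_description[of f]) (use f in auto)
    have test: "\<exists>N\<ge>0. ennreal (b powr p) * weighted_measure w R \<le> ennreal \<kappa> * (ennreal (N powr p) * emeasure lborel R) \<and>
      (\<forall>s>0. 1 < s * N \<longrightarrow> 1 < average R (\<lambda>x. ennreal (\<psi> (s * h x))))" if "(R, b) \<in> D" for R b
      unfolding w_def \<psi>_def \<kappa>_def
    proof (rule bump_condition_testing[OF p Y fin _ v bump K fm _ hm])
      show "weight (\<lambda>x. u x powr p)" using W by (simp add: w_def[abs_def])
      show "AE x in lebesgue. v x * f x = h x" by (rule AE_completion[OF hAE])
    qed (use D(2)[OF that] f in auto)
    have finite_est: "(\<integral>\<^sup>+x. ennreal (w x) * level_integral p F x \<partial>lebesgue) \<le> ennreal C * ?H"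
      if F: "finite F" "F \<subseteq> D" for F
    proof -
      let ?I = "\<integral>\<^sup>+x. ennreal (w x) * level_integral p F x \<partial>lebesgue"
      have "ennreal (1 - l) * ?I \<le> ennreal c * (ennreal \<kappa> * ((\<integral>\<^sup>+s. tail_density p s * ennreal (jmz_gauge CARD('n) (\<psi> s)) \<partial>lborel) * ?H))"
      proof (rule finite_family_estimate[OF wm l Ac _ F(1) _ hm h0 \<psi>m \<psi>0])
        fix R b assume "(R, b) \<in> F"
        then have Rb: "(R, b) \<in> D" using F by blast
        show "R \<in> rectangles \<and> 0 < b" using D(2)[OF Rb] by blast
        show "\<exists>N\<ge>0. ennreal (b powr p) * weighted_measure w R \<le> ennreal \<kappa> * (ennreal (N powr p) * emeasure lborel R) \<and>
          (\<forall>s>0. 1 < s * N \<longrightarrow> 1 < average R (\<lambda>x. ennreal (\<psi> (s * h x))))" by (rule test[OF Rb])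
      qed (use p in simp_all)
      also have "\<dots> = ennreal (c * (\<kappa> * k)) * ?H"
        using c k by (simp add: \<kappa>_def ennreal_mult ac_simps)
      finally have le: "ennreal (1 - l) * ?I \<le> ennreal (c * (\<kappa> * k)) * ?H" .
      have "?I = ennreal (1 / (1 - l)) * (ennreal (1 - l) * ?I)"
        using l by (simp flip: ennreal_mult mult.assoc)
      also have "\<dots> \<le> ennreal (1 / (1 - l)) * (ennreal (c * (\<kappa> * k)) * ?H)"
        by (intro mult_left_mono le) simp
      also have "\<dots> = ennreal (c * (\<kappa> * k) / (1 - l)) * ?H"
      proof -
        have "ennreal (1 / (1 - l)) * ennreal (c * (\<kappa> * k)) = ennreal (1 / (1 - l) * (c * (\<kappa> * k)))"
          using l c k by (intro ennreal_mult[symmetric]) (auto simp: \<kappa>_def)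
        then show ?thesis by (simp flip: mult.assoc)
      qed
      also have "\<dots> \<le> ennreal C * ?H" by (intro mult_right_mono ennreal_leI) (auto simp: C_def)
      finally show ?thesis .
    qed
    have "(\<integral>\<^sup>+x. epowr (ennreal (u x) * strong_maximal f x) p \<partial>lebesgue) =
        (\<integral>\<^sup>+x. ennreal (w x) * level_integral p D x \<partial>lebesgue)"
      unfolding w_def
      by (intro nn_integral_cong maximal_powr_level_integral) (use p u0 D(3) in auto)
    also have "\<dots> \<le> ennreal C * ?H"
    proof (cases "D = {}")
      case True
      then show ?thesis by (simp add: level_integral_def level_region_def)
    next
      case False
      define F where "F m = from_nat_into D ` {..<m}" for m :: nat
      have incF: "incseq F" unfolding F_def incseq_def by (intro allI impI image_mono) auto
      have UF: "(\<Union>m. F m) = D"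
      proof -
        have "(\<Union>m. F m) = range (from_nat_into D)" unfolding F_def by (auto simp: image_iff)
        then show ?thesis using False D(1) by (simp add: range_from_nat_into)
      qed
      have FD: "finite (F m)" "F m \<subseteq> D" for m using UF by (auto simp: F_def)
      have Do: "\<And>R b. (R, b) \<in> D \<Longrightarrow> open R" using D(2) rectangle_open by blast
      show ?thesis
        by (subst weighted_level_integral_SUP[OF wm Do incF UF]) (assumption, rule SUP_least, rule finite_est, rule FD, rule FD)
    qed
    finally show ?thesis unfolding hp .
  qed
  show ?thesis using main C0 by (intro exI[of _ C]) (auto simp: C_def)
qed

section \<open>Hyperbolic regions\<close>

text \<open>
A rectangle centred at the origin that contains both the unit cube and x has measure at least
comparable to this number, so 1 / hyp_mod is, up to constants, the strong maximal function of
the cube at x.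
\<close>

definition hyp_mod :: "real^'n \<Rightarrow> real" where
  "hyp_mod x = (\<Prod>i\<in>UNIV. max 1 \<bar>x $ i\<bar>)"

lemma hyp_mod_ge_1: "1 \<le> hyp_mod x"
  unfolding hyp_mod_def by (rule prod_ge_1) auto

lemma measurable_hyp_mod [measurable]: "hyp_mod \<in> borel_measurable (borel :: (real^'n) measure)"
  unfolding hyp_mod_def[abs_def]
  by (intro borel_measurable_continuous_onI continuous_intros)

text \<open>
Integrating out one coordinate y, restricted to 1 \<le> y \<le> s, leaves the region of level s / y in one
dimension less. The integral of (s / y) ln (s / y)^(k-1) dy over this range is s (ln s)^k / k.
\<close>

lemma hyperbolic_region_PiM_lower:
  fixes J :: "'n::finite set"
  assumes "J \<noteq> {}" "1 \<le> s"
  shows "ennreal (s * ln s ^ (card J - 1) / fact (card J - 1)) \<le>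
    (\<integral>\<^sup>+x. indicator {x. (\<Prod>j\<in>J. max 1 \<bar>x j\<bar>) \<le> s} x \<partial>Pi\<^sub>M J (\<lambda>_. lborel))"
  using finite[of J] assms
proof (induction J arbitrary: s rule: finite_ne_induct)
  case (singleton i)
  have "(\<integral>\<^sup>+x. indicator {x. (\<Prod>j\<in>{i}. max 1 \<bar>x j\<bar>) \<le> s} x \<partial>Pi\<^sub>M {i} (\<lambda>_. lborel)) =
      (\<integral>\<^sup>+x. indicator {-s..s} (x i) \<partial>Pi\<^sub>M {i} (\<lambda>_. lborel))"
    using singleton by (intro nn_integral_cong) (auto simp: indicator_def)
  also have "\<dots> = ennreal (2 * s)"
    using singleton by (subst lborel_product.product_nn_integral_singleton) auto
  finally show ?case using singleton by (simp add: ennreal_leI)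
next
  case (insert i J)
  define k where "k = card J"
  have k: "1 \<le> k" "card (insert i J) - 1 = k" using insert.hyps by (auto simp: k_def Suc_le_eq card_gt_0_iff)
  have fk: "fact k = real k * fact (k - 1)" using k by (simp add: fact_reduce)
  let ?D = "\<lambda>s. \<integral>\<^sup>+x. indicator {x. (\<Prod>j\<in>J. max 1 \<bar>x j\<bar>) \<le> s} x \<partial>Pi\<^sub>M J (\<lambda>_. lborel)"
  have s: "1 \<le> s" by fact
  let ?F = "\<lambda>y. - (s * ln (s / y) ^ k / fact k)"
  let ?f = "\<lambda>y. (s / y) * ln (s / y) ^ (k - 1) / fact (k - 1)"
  have "ennreal (s * ln s ^ k / fact k) = ennreal (?F s - ?F 1)"
    using s k by (simp add: power_0_left)
  also have "\<dots> = (\<integral>\<^sup>+y. ennreal (?f y) * indicator {1..s} y \<partial>lborel)"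
  proof (rule nn_integral_FTC_Icc[symmetric])
    fix y assume y: "y \<in> {1..s}"
    have dl: "((\<lambda>y. ln (s / y)) has_real_derivative - (1 / y)) (at y)"
      using y s by (auto intro!: derivative_eq_intros simp: field_simps power2_eq_square)
    have "(?F has_real_derivative - (s * (real k * (- (1 / y) * ln (s / y) ^ (k - 1))) / fact k)) (at y)"
      using DERIV_power[OF dl, of k] by (intro DERIV_minus DERIV_cdivide DERIV_cmult) (simp add: ac_simps)
    also have "- (s * (real k * (- (1 / y) * ln (s / y) ^ (k - 1))) / fact k) = ?f y"
      unfolding fk using k by (simp add: field_simps)
    finally show "(?F has_real_derivative ?f y) (at y)" .
    show "0 \<le> ?f y" using y s by (intro divide_nonneg_nonneg mult_nonneg_nonneg zero_le_power ln_ge_zero) auto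
  qed (use s in auto)
  also have "\<dots> \<le> (\<integral>\<^sup>+y. (\<integral>\<^sup>+x. indicator {x. (\<Prod>j\<in>insert i J. max 1 \<bar>x j\<bar>) \<le> s} (x(i := y)) \<partial>Pi\<^sub>M J (\<lambda>_. lborel)) \<partial>lborel)"
  proof (rule nn_integral_mono)
    fix y :: real
    show "ennreal (?f y) * indicator {1..s} y \<le>
      (\<integral>\<^sup>+x. indicator {x. (\<Prod>j\<in>insert i J. max 1 \<bar>x j\<bar>) \<le> s} (x(i := y)) \<partial>Pi\<^sub>M J (\<lambda>_. lborel))"
    proof (cases "y \<in> {1..s}")
      case True
      then have y: "0 < y" "1 \<le> s / y" by auto
      have "ennreal (?f y) \<le> ?D (s / y)" using insert.IH[OF y(2)] by (simp add: k_def)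
      also have "\<dots> = (\<integral>\<^sup>+x. indicator {x. (\<Prod>j\<in>insert i J. max 1 \<bar>x j\<bar>) \<le> s} (x(i := y)) \<partial>Pi\<^sub>M J (\<lambda>_. lborel))"
      proof (rule nn_integral_cong)
        fix x :: "'n \<Rightarrow> real"
        have "(\<Prod>j\<in>J. max 1 \<bar>(x(i := y)) j\<bar>) = (\<Prod>j\<in>J. max 1 \<bar>x j\<bar>)"
          using insert.hyps by (intro prod.cong) auto
        then have "(\<Prod>j\<in>insert i J. max 1 \<bar>(x(i := y)) j\<bar>) = y * (\<Prod>j\<in>J. max 1 \<bar>x j\<bar>)"
          using insert.hyps True by simp
        then show "indicator {x. (\<Prod>j\<in>J. max 1 \<bar>x j\<bar>) \<le> s / y} x =
           indicator {x. (\<Prod>j\<in>insert i J. max 1 \<bar>x j\<bar>) \<le> s} (x(i := y))"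
          using y by (simp add: indicator_def field_simps)
      qed
      finally show ?thesis using True by simp
    qed simp
  qed
  also have "\<dots> = (\<integral>\<^sup>+x. indicator {x. (\<Prod>j\<in>insert i J. max 1 \<bar>x j\<bar>) \<le> s} x \<partial>Pi\<^sub>M (insert i J) (\<lambda>_. lborel))"
  proof (rule lborel_product.product_nn_integral_insert_rev[symmetric])
    have "(\<lambda>x. \<Prod>j\<in>insert i J. max 1 \<bar>x j\<bar>) \<in> borel_measurable (Pi\<^sub>M (insert i J) (\<lambda>_. lborel :: real measure))"
      by (intro borel_measurable_prod) measurable
    then have "(\<lambda>x. indicator {..s} (\<Prod>j\<in>insert i J. max 1 \<bar>x j\<bar>) :: ennreal) \<in> borel_measurable (Pi\<^sub>M (insert i J) (\<lambda>_. lborel))"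
      by measurable
    then show "(indicator {x. (\<Prod>j\<in>insert i J. max 1 \<bar>x j\<bar>) \<le> s} :: _ \<Rightarrow> ennreal) \<in> borel_measurable (Pi\<^sub>M (insert i J) (\<lambda>_. lborel))"
      by (simp add: indicator_def)
  qed (use insert.hyps in auto)
  finally show ?case unfolding k(2) .
qed

lemma hyperbolic_region_lower:
  assumes "1 \<le> s"
  shows "ennreal (s * ln s ^ (CARD('n::finite) - 1) / fact (CARD('n) - 1)) \<le>
    emeasure lborel {x :: real^'n. hyp_mod x \<le> s}"
proof -
  have "emeasure lborel {x :: real^'n. hyp_mod x \<le> s} =
      (\<integral>\<^sup>+x. indicator {x :: real^'n. hyp_mod x \<le> s} x \<partial>lborel)" by simp
  also have "\<dots> = (\<integral>\<^sup>+x. indicator {x :: real^'n. hyp_mod x \<le> s} (\<chi> i. x i) \<partial>lborel_PiM)"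
    by (rule nn_integral_lborel_vec) measurable
  also have "\<dots> = (\<integral>\<^sup>+x. indicator {x. (\<Prod>j\<in>(UNIV :: 'n set). max 1 \<bar>x j\<bar>) \<le> s} x \<partial>lborel_PiM)"
    by (simp add: hyp_mod_def indicator_def)
  finally show ?thesis using hyperbolic_region_PiM_lower[of "UNIV :: 'n set" s] assms by simp
qed

text \<open>
For s \<ge> e the numbers ln (e + s) and ln s agree up to a factor 2. The value \<infinity> is included because the
complementary function may take it.
\<close>

lemma Phi_n_le_hyperbolic_region:
  fixes y :: ennreal
  assumes y: "ennreal (exp 1) \<le> y"
  shows "ext_infty (Phi_n CARD('n)) y \<le> ennreal (2 ^ (CARD('n) - 1) * fact (CARD('n) - 1)) *
    emeasure lborel {x :: real^'n::finite. ennreal (hyp_mod x) \<le> y}"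
proof (cases y)
  case top
  then show ?thesis by (simp add: ext_infty_def ennreal_mult_top emeasure_lborel_UNIV)
next
  case (real s)
  define k where "k = CARD('n) - 1"
  have s: "exp 1 \<le> s" using y real by (simp add: ennreal_le_iff)
  have e2: "2 \<le> exp (1 :: real)" using exp_ge_add_one_self[of 1] by simp
  have "exp 1 + s \<le> 2 * s" using s by simp
  also have "\<dots> \<le> s * s" using s e2 by (intro mult_right_mono) auto
  finally have "ln (exp 1 + s) \<le> ln (s * s)" using s e2 by (subst ln_le_cancel_iff) auto
  also have "\<dots> = 2 * ln s" using s e2 by (simp add: ln_mult)
  finally have "ln (exp 1 + s) ^ k \<le> (2 * ln s) ^ k"
    using s e2 by (intro power_mono ln_ge_zero) auto
  then have "s * ln (exp 1 + s) ^ k \<le> s * (2 * ln s) ^ k"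
    using s e2 by (intro mult_left_mono) auto
  also have "\<dots> = (2 ^ k * fact k) * (s * ln s ^ k / fact k)" by (simp add: power_mult_distrib)
  finally have "ennreal (s * ln (exp 1 + s) ^ k) \<le> ennreal (2 ^ k * fact k) * ennreal (s * ln s ^ k / fact k)"
    using s e2 by (simp add: ennreal_leI flip: ennreal_mult')
  also have "\<dots> \<le> ennreal (2 ^ k * fact k) * emeasure lborel {x :: real^'n. hyp_mod x \<le> s}"
    unfolding k_def using s e2 by (intro mult_left_mono hyperbolic_region_lower) auto
  also have "{x :: real^'n. hyp_mod x \<le> s} = {x. ennreal (hyp_mod x) \<le> y}"
    using real s e2 by (auto simp: ennreal_le_iff)
  finally show ?thesis using real by (simp add: ext_infty_def Phi_n_def k_def)
qed

section \<open>The inverse of a Young function and the class of its complement\<close>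

text \<open>
The argument is cut off at 0, so that the inverse is a monotone function on the whole line.
\<close>

definition young_inverse :: "(real \<Rightarrow> real) \<Rightarrow> real \<Rightarrow> real" where
  "young_inverse \<Phi> s = inv_into {0..} \<Phi> (max 0 s)"

lemma young_inverse:
  assumes Y: "young_function \<Phi>"
  shows "0 \<le> young_inverse \<Phi> s" "\<Phi> (young_inverse \<Phi> s) = max 0 s"
proof -
  have "max 0 s \<in> \<Phi> ` {0..}"
  proof -
    have "eventually (\<lambda>t. max 0 s \<le> \<Phi> t) at_top"
      using Y unfolding young_function_def filterlim_at_top by blast
    then obtain t0 where "\<And>t. t0 \<le> t \<Longrightarrow> max 0 s \<le> \<Phi> t" unfolding eventually_at_top_linorder by blast
    then obtain t where t: "max 0 s \<le> \<Phi> t" "0 \<le> t" using that[of "max 0 t0"] by simp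
    have "\<exists>x\<ge>0. x \<le> t \<and> \<Phi> x = max 0 s"
      using Y t by (intro IVT') (auto simp: young_function_def intro: continuous_on_subset)
    then show ?thesis by (metis atLeast_iff image_eqI)
  qed
  then show "0 \<le> young_inverse \<Phi> s" "\<Phi> (young_inverse \<Phi> s) = max 0 s"
    unfolding young_inverse_def using inv_into_into[of "max 0 s" \<Phi> "{0..}"] f_inv_into_f[of "max 0 s" \<Phi> "{0..}"]
    by auto
qed

lemma young_strict_mono: "young_function \<Phi> \<Longrightarrow> 0 \<le> s \<Longrightarrow> s < t \<Longrightarrow> \<Phi> s < \<Phi> t"
  by (auto simp: young_function_def strict_mono_on_def)

lemma young_inverse_mono:
  assumes "young_function \<Phi>" "s \<le> t"
  shows "young_inverse \<Phi> s \<le> young_inverse \<Phi> t"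
proof (rule ccontr)
  assume "\<not> ?thesis"
  then have "\<Phi> (young_inverse \<Phi> t) < \<Phi> (young_inverse \<Phi> s)"
    using young_inverse[OF assms(1)] by (intro young_strict_mono[OF assms(1)]) auto
  then show False using young_inverse[OF assms(1)] assms(2) by (auto simp: max_def split: if_splits)
qed

lemma young_inverse_pos:
  assumes "young_function \<Phi>" "0 < s"
  shows "0 < young_inverse \<Phi> s"
proof (rule ccontr)
  assume "\<not> ?thesis"
  then have "young_inverse \<Phi> s = 0" using young_inverse(1)[OF assms(1), of s] by simp
  then show False using young_inverse(2)[OF assms(1), of s] assms by (auto simp: young_function_def)
qed

lemma measurable_young_inverse:
  "young_function \<Phi> \<Longrightarrow> young_inverse \<Phi> \<in> borel_measurable borel"
  by (rule borel_measurable_mono) (auto simp: mono_def young_inverse_mono)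

lemma young_scale:
  assumes Y: "young_function \<Phi>" and "0 \<le> \<theta>" "\<theta> \<le> 1" "0 \<le> t"
  shows "\<Phi> (\<theta> * t) \<le> \<theta> * \<Phi> t"
proof -
  have "\<Phi> ((1 - \<theta>) *\<^sub>R 0 + \<theta> *\<^sub>R t) \<le> (1 - \<theta>) * \<Phi> 0 + \<theta> * \<Phi> t"
    using assms by (intro convex_onD[of "{0..}"]) (auto simp: young_function_def)
  then show ?thesis using Y by (simp add: young_function_def)
qed

text \<open>
With \<sigma> = \<Phi>^{-1}(s), the competitors r \<le> \<sigma> in the supremum contribute at most t \<sigma>; for r > \<sigma> convexity
gives \<Phi>(r) / r \<ge> s / \<sigma> \<ge> t, so they contribute nothing.
\<close>

lemma complementary_le_mult_young_inverse:
  assumes Y: "young_function \<Phi>" and s: "0 < s" and t: "0 < t" "t * young_inverse \<Phi> s \<le> s"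
  shows "complementary \<Phi> t \<le> ennreal (t * young_inverse \<Phi> s)"
  unfolding complementary_def
proof (intro SUP_least ennreal_leI)
  fix r :: real assume "r \<in> {0<..}"
  then have r: "0 < r" by simp
  define \<sigma> where "\<sigma> = young_inverse \<Phi> s"
  have \<sigma>: "0 < \<sigma>" "\<Phi> \<sigma> = s" using young_inverse_pos[OF Y s] young_inverse(2)[OF Y, of s] s by (auto simp: \<sigma>_def)
  show "t * r - \<Phi> r \<le> t * young_inverse \<Phi> s"
  proof (cases "r \<le> \<sigma>")
    case True
    then have "t * r \<le> t * \<sigma>" using t by simp
    moreover have "0 \<le> \<Phi> r" using Y r by (auto simp: young_function_def)
    ultimately show ?thesis by (simp add: \<sigma>_def)
  next
    case False
    have "s \<le> \<sigma> / r * \<Phi> r" using young_scale[OF Y, of "\<sigma> / r" r] \<sigma> r False by simp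
    then have "t * \<sigma> \<le> \<sigma> / r * \<Phi> r" using t by (simp add: \<sigma>_def)
    then have "t * r \<le> \<Phi> r" using \<sigma> r by (simp add: field_simps)
    then show ?thesis using t \<sigma> by (simp add: \<sigma>_def[symmetric])
      (smt (verit) mult_pos_pos)
  qed
qed

lemma complementary_ge_imp:
  assumes Y: "young_function \<Phi>" and s: "0 < s" and t: "0 < t" "ennreal s \<le> complementary \<Phi> t"
  shows "s / young_inverse \<Phi> s \<le> t"
proof (rule ccontr)
  assume "\<not> ?thesis"
  then have lt: "t * young_inverse \<Phi> s < s" using young_inverse_pos[OF Y s] by (simp add: field_simps)
  then have "complementary \<Phi> t \<le> ennreal (t * young_inverse \<Phi> s)"
    using s t by (intro complementary_le_mult_young_inverse[OF Y]) auto
  also have "\<dots> < ennreal s" using lt s by (intro ennreal_lessI) auto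
  finally show False using t by simp
qed

lemma measurable_complementary [measurable]: "complementary \<Phi> \<in> borel_measurable borel"
proof (rule borel_measurableI_greater)
  fix y
  have "{x \<in> space borel. y < complementary \<Phi> x} = (\<Union>t\<in>{0<..}. {x. y < ennreal (x * t - \<Phi> t)})"
    by (auto simp: complementary_def less_SUP_iff)
  also have "open \<dots>"
    by (intro open_UN ballI open_Collect_less continuous_on_ennreal continuous_intros)
  finally show "{x \<in> space borel. y < complementary \<Phi> x} \<in> sets borel" by (rule borel_open)
qed

text \<open>
The gauge of \<Psi>(t) is at most a multiple of |{P \<le> \<Psi>(t)}|. By Tonelli's theorem one integrates
t^(-p-1) over {t. P(x) \<le> \<Psi>(t)} first, and this set lies above P(x) / \<Phi>^{-1}(P(x)).
\<close>

lemma hyperbolic_integral_imp_B_star: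
  fixes \<Phi> :: "real \<Rightarrow> real"
  assumes p: "0 < p" and Y: "young_function \<Phi>"
    and fin: "(\<integral>\<^sup>+x. ennreal ((young_inverse \<Phi> (hyp_mod x) / hyp_mod (x :: real^'n::finite)) powr p) \<partial>lborel) < \<infinity>"
  shows "B_star CARD('n) p (complementary \<Phi>)"
proof -
  \<comment> \<open>The competitor 1 in the supremum shows that the complementary function is at least e from c on.\<close>
  define c where "c = exp 1 + \<Phi> 1"
  have \<Phi>1: "0 \<le> \<Phi> 1" using Y by (auto simp: young_function_def)
  have c: "0 < c" using \<Phi>1 by (simp add: c_def add_pos_nonneg)
  have big: "ennreal (exp 1) \<le> complementary \<Phi> t" if "c \<le> t" for t
  proof -
    have "ennreal (exp 1) \<le> ennreal (t * 1 - \<Phi> 1)" using that by (intro ennreal_leI) (simp add: c_def)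
    also have "\<dots> \<le> complementary \<Phi> t" by (rule complementary_young) simp
    finally show ?thesis .
  qed
  define A where "A = (2 ^ (CARD('n) - 1) * fact (CARD('n) - 1) :: real)"
  have A: "0 \<le> A" by (simp add: A_def)
  let ?U = "\<lambda>t. {x :: real^'n. ennreal (hyp_mod x) \<le> complementary \<Phi> t}"
  let ?T = "\<lambda>x :: real^'n. hyp_mod x / young_inverse \<Phi> (hyp_mod x)"
  have h1: "1 \<le> hyp_mod x" for x :: "real^'n" by (rule hyp_mod_ge_1)
  have ip: "0 < young_inverse \<Phi> (hyp_mod x)" for x :: "real^'n"
    using h1[of x] by (intro young_inverse_pos[OF Y]) auto
  note measurable_young_inverse[OF Y, measurable]
  have "(\<integral>\<^sup>+t. ext_infty (Phi_n CARD('n)) (complementary \<Phi> t) / ennreal (t powr p) / ennreal t * indicator {c..} t \<partial>lborel) \<le>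
    (\<integral>\<^sup>+t. ennreal (A / p) * (tail_density p t * indicator {c..} t * (\<integral>\<^sup>+x. indicator (?U t) x \<partial>lborel)) \<partial>lborel)"
  proof (rule nn_integral_mono)
    fix t :: real
    show "ext_infty (Phi_n CARD('n)) (complementary \<Phi> t) / ennreal (t powr p) / ennreal t * indicator {c..} t \<le>
      ennreal (A / p) * (tail_density p t * indicator {c..} t * (\<integral>\<^sup>+x. indicator (?U t) x \<partial>lborel))"
    proof (cases "c \<le> t")
      case True
      then have t: "0 < t" using c by simp
      have "ext_infty (Phi_n CARD('n)) (complementary \<Phi> t) / ennreal (t powr p) / ennreal t =
          ext_infty (Phi_n CARD('n)) (complementary \<Phi> t) * ennreal (t powr (- p - 1))"
        using t by (simp add: divide_ennreal_def inverse_ennreal mult.assoc powr_diff powr_minus inverse_eq_divide flip: ennreal_mult)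
      also have "\<dots> \<le> ennreal A * emeasure lborel (?U t) * ennreal (t powr (- p - 1))"
        unfolding A_def by (intro mult_right_mono Phi_n_le_hyperbolic_region big True) auto
      also have "\<dots> = ennreal (A / p) * (tail_density p t * (\<integral>\<^sup>+x. indicator (?U t) x \<partial>lborel))"
      proof -
        have "ennreal (A / p) * ennreal (p * t powr (- p - 1)) = ennreal A * ennreal (t powr (- p - 1))"
          using A p by (simp flip: ennreal_mult)
        moreover have "(\<integral>\<^sup>+x. indicator (?U t) x \<partial>lborel) = emeasure lborel (?U t)" by simp
        ultimately have "ennreal (A / p) * (tail_density p t * (\<integral>\<^sup>+x. indicator (?U t) x \<partial>lborel)) =
            ennreal A * ennreal (t powr (- p - 1)) * emeasure lborel (?U t)"
          using t by (simp add: tail_density_def flip: mult.assoc)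
        then show ?thesis by (simp only: ac_simps)
      qed
      finally show ?thesis using True by simp
    qed simp
  qed
  also have "\<dots> = ennreal (A / p) * (\<integral>\<^sup>+t. (tail_density p t * indicator {c..} t * (\<integral>\<^sup>+x. indicator (?U t) x \<partial>lborel)) \<partial>lborel)"
    by (rule nn_integral_cmult) measurable
  also have "(\<integral>\<^sup>+t. (tail_density p t * indicator {c..} t * (\<integral>\<^sup>+x. indicator (?U t) x \<partial>lborel)) \<partial>lborel) =
     (\<integral>\<^sup>+t. (\<integral>\<^sup>+x. tail_density p t * indicator {c..} t * indicator (?U t) x \<partial>lborel) \<partial>lborel)"
    by (intro nn_integral_cong nn_integral_cmult[symmetric]) measurable
  also have "\<dots> = (\<integral>\<^sup>+x. (\<integral>\<^sup>+t. tail_density p t * indicator {c..} t * indicator (?U t) x \<partial>lborel) \<partial>lborel)"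
    by (rule lborel_pair.Fubini'[symmetric]) (simp add: indicator_def)
  also have "\<dots> \<le> (\<integral>\<^sup>+x. (\<integral>\<^sup>+t. tail_density p t * indicator {?T x..} t \<partial>lborel) \<partial>lborel)"
  proof (intro nn_integral_mono)
    fix x :: "real^'n" and t :: real
    show "tail_density p t * indicator {c..} t * indicator (?U t) x \<le> tail_density p t * indicator {?T x..} t"
    proof (cases "0 < t \<and> x \<in> ?U t")
      case True
      then have "?T x \<le> t" using h1[of x] by (intro complementary_ge_imp[OF Y]) auto
      then show ?thesis using True by (auto simp: indicator_def)
    qed (auto simp: tail_density_def indicator_def)
  qed
  also have "\<dots> = (\<integral>\<^sup>+x. ennreal ((young_inverse \<Phi> (hyp_mod x) / hyp_mod (x :: real^'n)) powr p) \<partial>lborel)"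
  proof (rule nn_integral_cong)
    fix x :: "real^'n"
    have "0 < ?T x" using ip[of x] h1[of x] by simp
    then have "(\<integral>\<^sup>+t. tail_density p t * indicator {?T x..} t \<partial>lborel) = ennreal (?T x powr - p)"
      by (rule nn_integral_tail_density_atLeast[OF p])
    also have "?T x powr - p = (young_inverse \<Phi> (hyp_mod x) / hyp_mod x) powr p"
      using ip[of x] h1[of x] by (simp add: powr_minus powr_divide)
    finally show "(\<integral>\<^sup>+t. tail_density p t * indicator {?T x..} t \<partial>lborel) =
      ennreal ((young_inverse \<Phi> (hyp_mod x) / hyp_mod x) powr p)" .
  qed
  finally have "(\<integral>\<^sup>+t. ext_infty (Phi_n CARD('n)) (complementary \<Phi> t) / ennreal (t powr p) / ennreal t * indicator {c..} t \<partial>lborel) \<le>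
    ennreal (A / p) * (\<integral>\<^sup>+x. ennreal ((young_inverse \<Phi> (hyp_mod x) / hyp_mod (x :: real^'n)) powr p) \<partial>lborel)"
    by (simp add: mult_left_mono)
  also have "\<dots> < \<infinity>" using fin by (simp add: ennreal_mult_less_top)
  finally show ?thesis unfolding B_star_def nn_integral_completion using c by blast
qed

section \<open>The test pair\<close>

text \<open>
Let m be the bound for |y| in the denominator. If the interval is longer than m / 2, the total
integral \<pi> suffices. Otherwise either m = 1 and the trivial bound 1 / (1 + y^2) \<le> 1 suffices, or the interval stays at distance at least m / 2 from
0, where 1 + y^2 \<ge> 1 + m^2 / 4 \<ge> m.
\<close>

lemma interval_integral_inverse_quadratic:
  fixes a b :: real
  assumes ab: "a < b"
  shows "(\<integral>\<^sup>+y. ennreal (1 / (1 + y\<^sup>2)) * indicator {a<..<b} y \<partial>lborel) \<le>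
    ennreal (8 * (b - a) / max 1 (max \<bar>a\<bar> \<bar>b\<bar>))"
proof -
  define m where "m = max 1 (max \<bar>a\<bar> \<bar>b\<bar>)"
  have m: "1 \<le> m" "\<bar>a\<bar> \<le> m" "\<bar>b\<bar> \<le> m" by (auto simp: m_def)
  show ?thesis
  proof (cases "m / 2 \<le> b - a")
    case True
    have "(\<integral>\<^sup>+y. ennreal (1 / (1 + y\<^sup>2)) * indicator {a<..<b} y \<partial>lborel) \<le>
        (\<integral>\<^sup>+y. ennreal (1 / (1 + y\<^sup>2)) * indicator {a..b} y \<partial>lborel)"
      by (intro nn_integral_mono) (auto simp: indicator_def)
    also have "\<dots> = ennreal (arctan b - arctan a)"
      using ab by (intro nn_integral_FTC_Icc) (auto intro!: derivative_eq_intros simp: inverse_eq_divide)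
    also have "\<dots> \<le> ennreal (8 * (b - a) / m)"
    proof (rule ennreal_leI)
      have "arctan b - arctan a \<le> 4" using arctan_bounded[of a] arctan_bounded[of b] pi_less_4 by simp
      also have "4 \<le> 8 * (b - a) / m" using True m by (simp add: field_simps)
      finally show "arctan b - arctan a \<le> 8 * (b - a) / m" .
    qed
    finally show ?thesis by (simp add: m_def)
  next
    case False
    have "1 / (1 + y\<^sup>2) \<le> 1 / m" if y: "y \<in> {a<..<b}" for y
    proof (cases "m = 1")
      case False
      then have "m = \<bar>a\<bar> \<or> m = \<bar>b\<bar>" by (auto simp: m_def max_def split: if_splits)
      then have "m / 2 \<le> \<bar>y\<bar>" using y \<open>\<not> m / 2 \<le> b - a\<close> by auto
      then have "(m / 2)\<^sup>2 \<le> y\<^sup>2" using m by (metis abs_le_square_iff abs_of_nonneg divide_nonneg_nonneg dual_order.trans zero_le_numeral zero_le_one)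
      moreover have "m \<le> 1 + (m / 2)\<^sup>2"
        using zero_le_power2[of "m / 2 - 1"] by (simp add: power2_eq_square algebra_simps)
      ultimately have "m \<le> 1 + y\<^sup>2" by simp
      then show ?thesis using m by (intro divide_left_mono) (auto intro: add_pos_nonneg)
    qed (simp add: divide_le_eq add_pos_nonneg)
    then have "(\<integral>\<^sup>+y. ennreal (1 / (1 + y\<^sup>2)) * indicator {a<..<b} y \<partial>lborel) \<le>
       (\<integral>\<^sup>+y. ennreal (1 / m) * indicator {a<..<b} y \<partial>lborel)"
      by (intro nn_integral_mono) (auto simp: indicator_def intro!: ennreal_leI)
    also have "\<dots> = ennreal (1 / m * (b - a))"
      using ab m by (simp add: nn_integral_cmult_indicator flip: ennreal_mult)
    also have "\<dots> \<le> ennreal (8 * (b - a) / m)"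
      using ab m by (intro ennreal_leI) (simp add: field_simps)
    finally show ?thesis by (simp add: m_def)
  qed
qed

text \<open>
The reciprocal is positive, integrable and of product form, and it decays fast enough to be
negligible next to the indicator of the unit cube in every average over a rectangle.
\<close>

definition quad_weight :: "real^'n \<Rightarrow> real" where
  "quad_weight x = (\<Prod>i\<in>UNIV. 1 + (x $ i)\<^sup>2)"

lemma quad_weight_ge_1: "1 \<le> quad_weight x"
  unfolding quad_weight_def by (rule prod_ge_1) auto

lemma measurable_quad_weight [measurable]: "quad_weight \<in> borel_measurable (borel :: (real^'n) measure)"
  unfolding quad_weight_def[abs_def]
  by (intro borel_measurable_continuous_onI continuous_intros)

lemma average_inverse_quad_weight:
  fixes a b :: "real^'n::finite"
  assumes ab: "\<And>i. a $ i < b $ i"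
  shows "average (box a b) (\<lambda>x. ennreal (1 / quad_weight x)) \<le>
    ennreal (8 ^ CARD('n) / (\<Prod>i\<in>UNIV. max 1 (max \<bar>a $ i\<bar> \<bar>b $ i\<bar>)))"
proof -
  define V where "V = (\<Prod>i\<in>UNIV. b $ i - a $ i)"
  define S where "S = (\<Prod>i\<in>UNIV. max 1 (max \<bar>a $ i\<bar> \<bar>b $ i\<bar>))"
  have V: "0 < V" unfolding V_def using ab by (intro prod_pos) auto
  have S: "0 < S" unfolding S_def by (intro prod_pos) auto
  have eV: "emeasure lborel (box a b) = ennreal V" unfolding V_def by (rule emeasure_lborel_rectangle[OF ab])
  have "(\<integral>\<^sup>+x. ennreal (1 / quad_weight x) * indicator (box a b) x \<partial>lborel) =
      (\<integral>\<^sup>+x. ennreal (1 / quad_weight (\<chi> i. x i)) * indicator (box a b) (\<chi> i. x i) \<partial>lborel_PiM)"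
    by (rule nn_integral_lborel_vec) measurable
  also have "\<dots> = (\<integral>\<^sup>+x. (\<Prod>i\<in>UNIV. ennreal (1 / (1 + (x i)\<^sup>2)) * indicator {a $ i<..<b $ i} (x i)) \<partial>lborel_PiM)"
  proof (rule nn_integral_cong)
    fix x :: "'n \<Rightarrow> real"
    have 1: "ennreal (1 / quad_weight (\<chi> i. x i)) = (\<Prod>i\<in>UNIV. ennreal (1 / (1 + (x i)\<^sup>2)))"
      by (simp add: quad_weight_def prod_ennreal prod_dividef)
    have 2: "indicator (box a b) (\<chi> i. x i) = (\<Prod>i\<in>UNIV. indicator {a $ i<..<b $ i} (x i) :: ennreal)"
      by (rule indicator_box_vec)
    show "ennreal (1 / quad_weight (\<chi> i. x i)) * indicator (box a b) (\<chi> i. x i) =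
      (\<Prod>i\<in>UNIV. ennreal (1 / (1 + (x i)\<^sup>2)) * indicator {a $ i<..<b $ i} (x i))"
      unfolding 1 2 by (rule prod.distrib[symmetric])
  qed
  also have "\<dots> = (\<Prod>i\<in>UNIV. \<integral>\<^sup>+y. ennreal (1 / (1 + y\<^sup>2)) * indicator {a $ i<..<b $ i} y \<partial>lborel)"
    by (rule lborel_product.product_nn_integral_prod) auto
  also have "\<dots> \<le> (\<Prod>i\<in>UNIV. ennreal (8 * (b $ i - a $ i) / max 1 (max \<bar>a $ i\<bar> \<bar>b $ i\<bar>)))"
    by (intro prod_mono_ennreal interval_integral_inverse_quadratic ab)
  also have "\<dots> = ennreal (\<Prod>i\<in>UNIV. 8 * (b $ i - a $ i) / max 1 (max \<bar>a $ i\<bar> \<bar>b $ i\<bar>))"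
    using ab by (intro prod_ennreal) (auto simp: less_imp_le)
  also have "(\<Prod>i\<in>UNIV. 8 * (b $ i - a $ i) / max 1 (max \<bar>a $ i\<bar> \<bar>b $ i\<bar>)) = 8 ^ CARD('n) * V / S"
    by (simp only: prod_dividef prod.distrib prod_constant V_def S_def)
  finally have "(\<integral>\<^sup>+x. ennreal (1 / quad_weight x) * indicator (box a b) x \<partial>lborel) \<le> ennreal (8 ^ CARD('n) * V / S)" .
  then have "average (box a b) (\<lambda>x. ennreal (1 / quad_weight x)) \<le> ennreal (8 ^ CARD('n) * V / S) / ennreal V"
    by (subst average_lborel) (auto simp: eV intro: divide_right_mono_ennreal)
  also have "\<dots> = ennreal (8 ^ CARD('n) / S)" using V S by (simp add: divide_ennreal)
  finally show ?thesis by (simp add: S_def)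
qed

lemma weight_bounded:
  fixes w :: "real^'n::finite \<Rightarrow> real"
  assumes [measurable]: "w \<in> borel_measurable borel" and w: "\<And>x. 0 \<le> w x"
    and bd: "\<And>a b. \<exists>B. \<forall>x\<in>box a b. w x \<le> B"
  shows "weight w"
  unfolding weight_def
proof (intro conjI ballI allI w)
  show "w \<in> borel_measurable lebesgue" using assms(1) by (simp add: measurable_completion)
  fix R :: "(real^'n) set" assume R: "R \<in> rectangles"
  then obtain a b where "R = box a b" by (auto simp: rectangles_def)
  then obtain B where B: "\<forall>x\<in>R. w x \<le> B" using bd[of a b] by auto
  have "weighted_measure w R \<le> (\<integral>\<^sup>+x. ennreal B * indicator R x \<partial>lborel)"
    unfolding weighted_measure_def nn_integral_completion
    using B by (intro nn_integral_mono) (auto simp: indicator_def intro!: ennreal_leI)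
  also have "\<dots> = ennreal B * emeasure lborel R"
    using rectangle_borel[OF R] by (subst nn_integral_cmult_indicator) auto
  also have "\<dots> < \<infinity>" using rectangle_measure(2)[OF R] by (simp add: ennreal_mult_less_top less_top)
  finally show "weighted_measure w R < \<infinity>" .
qed

lemma hyp_mod_le_box:
  assumes "x \<in> box a b"
  shows "hyp_mod x \<le> (\<Prod>i\<in>UNIV. max 1 (max \<bar>a $ i\<bar> \<bar>b $ i\<bar>))"
  unfolding hyp_mod_def
proof (intro prod_mono conjI)
  fix i
  have "a $ i < x $ i" "x $ i < b $ i" using assms by (auto simp: mem_box_cart)
  then show "max 1 \<bar>x $ i\<bar> \<le> max 1 (max \<bar>a $ i\<bar> \<bar>b $ i\<bar>)" by auto
qed auto

lemma weight_young_inverse_hyp_mod: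
  assumes Y: "young_function \<Phi>"
  shows "weight (\<lambda>x :: real^'n::finite. young_inverse \<Phi> (hyp_mod x))"
proof (rule weight_bounded)
  note measurable_young_inverse[OF Y, measurable]
  show "(\<lambda>x :: real^'n. young_inverse \<Phi> (hyp_mod x)) \<in> borel_measurable borel" by measurable
  show "\<exists>B. \<forall>x\<in>box a b. young_inverse \<Phi> (hyp_mod x) \<le> B" for a b :: "real^'n"
    using hyp_mod_le_box young_inverse_mono[OF Y] by blast
qed (rule young_inverse(1)[OF Y])

lemma weight_quad_weight: "weight (quad_weight :: real^'n::finite \<Rightarrow> real)"
proof (rule weight_bounded)
  show "0 \<le> quad_weight x" for x :: "real^'n" using quad_weight_ge_1[of x] by simp
  show "\<exists>B. \<forall>x\<in>box a b. quad_weight x \<le> B" for a b :: "real^'n"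
  proof (intro exI ballI)
    fix x assume x: "x \<in> box a b"
    show "quad_weight x \<le> (\<Prod>i\<in>UNIV. 1 + (max \<bar>a $ i\<bar> \<bar>b $ i\<bar>)\<^sup>2)"
      unfolding quad_weight_def
    proof (intro prod_mono conjI add_left_mono)
      fix i
      have "a $ i < x $ i" "x $ i < b $ i" using x by (auto simp: mem_box_cart)
      then have "\<bar>x $ i\<bar> \<le> max \<bar>a $ i\<bar> \<bar>b $ i\<bar>" by auto
      then show "(x $ i)\<^sup>2 \<le> (max \<bar>a $ i\<bar> \<bar>b $ i\<bar>)\<^sup>2" by (metis abs_ge_zero power2_abs power_mono)
    qed auto
  qed
qed measurable

text \<open>
On R the function u is at most U = \<Phi>^{-1}(S), where S is the supremum of hyp_mod over R. With K = 8^n and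
Luxemburg parameter K / U, convexity gives \<Phi>(U / (K v)) \<le> S / (K v), and the average of 1 / v over R
is at most K / S.
\<close>

lemma bump_condition_test_pair:
  fixes \<Phi> :: "real \<Rightarrow> real"
  assumes p: "0 < p" and Y: "young_function \<Phi>"
  shows "bump_condition p \<Phi> (\<lambda>x :: real^'n::finite. young_inverse \<Phi> (hyp_mod x)) quad_weight (8 ^ CARD('n))"
  unfolding bump_condition_def
proof
  fix R :: "(real^'n) set" assume R: "R \<in> rectangles"
  then obtain a b where ab: "R = box a b" "\<And>i. a $ i < b $ i" by (auto simp: rectangles_def)
  define S where "S = (\<Prod>i\<in>UNIV. max 1 (max \<bar>a $ i\<bar> \<bar>b $ i\<bar>))"
  define K where "K = (8 :: real) ^ CARD('n)"
  define U where "U = young_inverse \<Phi> S"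
  have S: "1 \<le> S" unfolding S_def by (rule prod_ge_1) auto
  have K: "1 \<le> K" by (simp add: K_def)
  have U: "0 < U" "\<Phi> U = S"
    using young_inverse_pos[OF Y, of S] young_inverse(2)[OF Y, of S] S by (auto simp: U_def)
  let ?u = "\<lambda>x :: real^'n. young_inverse \<Phi> (hyp_mod x)"
  have uU: "?u x \<le> U" if "x \<in> R" for x
    unfolding U_def S_def using that ab by (intro young_inverse_mono[OF Y] hyp_mod_le_box) auto
  have [measurable]: "R \<in> sets borel" by (rule rectangle_borel[OF R])
  have "(\<integral>\<^sup>+x. ennreal (?u x powr p) * indicator R x \<partial>lborel) \<le> (\<integral>\<^sup>+x. ennreal (U powr p) * indicator R x \<partial>lborel)"
    using uU p young_inverse(1)[OF Y]
    by (intro nn_integral_mono) (auto simp: indicator_def intro!: ennreal_leI powr_mono2)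
  also have "\<dots> = ennreal (U powr p) * emeasure lborel R" by (subst nn_integral_cmult_indicator) auto
  finally have "average R (\<lambda>x. ennreal (?u x powr p)) \<le> ennreal (U powr p) * emeasure lborel R / emeasure lborel R"
    by (subst average_lborel) (auto intro: divide_right_mono_ennreal)
  also have "\<dots> = ennreal (U powr p)"
    using rectangle_measure[OF R] by (simp add: ennreal_mult_divide_eq)
  finally have avu: "average R (\<lambda>x. ennreal (?u x powr p)) \<le> ennreal (U powr p)" .
  have 1: "epowr (average R (\<lambda>x. ennreal (?u x powr p))) (1 / p) \<le> ennreal U"
  proof (cases "average R (\<lambda>x. ennreal (?u x powr p))")
    case (real r)
    then have "r \<le> U powr p" using avu by simp
    then have "r powr (1 / p) \<le> (U powr p) powr (1 / p)" using real p by (intro powr_mono2) auto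
    then show ?thesis using real p U by (simp add: epowr_def ext_infty_def powr_powr ennreal_leI)
  qed (use avu in \<open>simp add: top_unique\<close>)
  have "luxemburg_norm \<Phi> R (\<lambda>x. inverse (ennreal (quad_weight x))) \<le> ennreal (K / U)"
    unfolding luxemburg_norm_def
  proof (rule INF_lower, safe)
    show "0 < K / U" using U K by simp
    have "average R (\<lambda>x. ext_infty \<Phi> (inverse (ennreal (quad_weight x)) / ennreal (K / U))) \<le>
        average R (\<lambda>x. ennreal (S / K) * ennreal (1 / quad_weight x))"
    proof (intro average_mono_AE AE_I2)
      fix x :: "real^'n"
      have q: "1 \<le> quad_weight x" by (rule quad_weight_ge_1)
      define \<theta> where "\<theta> = 1 / (quad_weight x * K)"
      have "1 * 1 \<le> quad_weight x * K" using q K by (intro mult_mono) auto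
      then have \<theta>: "0 \<le> \<theta>" "\<theta> \<le> 1" by (auto simp: \<theta>_def divide_le_eq)
      have "inverse (ennreal (quad_weight x)) / ennreal (K / U) = ennreal (\<theta> * U)"
        using q K U by (simp add: inverse_ennreal divide_ennreal \<theta>_def field_simps)
      then have "ext_infty \<Phi> (inverse (ennreal (quad_weight x)) / ennreal (K / U)) = ennreal (\<Phi> (\<theta> * U))"
        using \<theta> U by (simp add: ext_infty_def)
      also have "\<dots> \<le> ennreal (\<theta> * S)" using young_scale[OF Y \<theta>, of U] U by (intro ennreal_leI) auto
      also have "\<theta> * S = S / K * (1 / quad_weight x)" by (simp add: \<theta>_def)
      finally show "ext_infty \<Phi> (inverse (ennreal (quad_weight x)) / ennreal (K / U)) \<le> ennreal (S / K) * ennreal (1 / quad_weight x)"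
        using q S K by (simp flip: ennreal_mult)
    qed
    also have "\<dots> = ennreal (S / K) * average R (\<lambda>x. ennreal (1 / quad_weight x))"
    proof (rule average_cmult)
      have "(\<lambda>x :: real^'n. ennreal (1 / quad_weight x)) \<in> borel_measurable lborel" by measurable
      then show "(\<lambda>x :: real^'n. ennreal (1 / quad_weight x)) \<in> borel_measurable lebesgue"
        by (rule measurable_completion)
    qed simp
    also have "\<dots> \<le> ennreal (S / K) * ennreal (K / S)"
      unfolding K_def S_def ab(1) by (intro mult_left_mono average_inverse_quad_weight ab(2)) auto
    also have "\<dots> = 1" using S K by (simp flip: ennreal_mult)
    finally show "average R (\<lambda>x. ext_infty \<Phi> (inverse (ennreal (quad_weight x)) / ennreal (K / U))) \<le> 1" .
  qed
  then have "epowr (average R (\<lambda>x. ennreal (?u x powr p))) (1 / p) *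
      luxemburg_norm \<Phi> R (\<lambda>x. inverse (ennreal (quad_weight x))) \<le> ennreal U * ennreal (K / U)"
    using 1 by (intro mult_mono) auto
  also have "\<dots> = ennreal K" using U K by (simp flip: ennreal_mult)
  finally show "epowr (average R (\<lambda>x. ennreal (?u x powr p))) (1 / p) *
      luxemburg_norm \<Phi> R (\<lambda>x. inverse (ennreal (quad_weight x))) \<le> ennreal (8 ^ CARD('n))" by (simp add: K_def)
qed

section \<open>Necessity\<close>

text \<open>
The rectangle with half-sides 2 max 1 |x_i| contains x and the cube; the ratio of the measures is
2^n / (4^n hyp_mod x).
\<close>

lemma strong_maximal_cube_lower:
  fixes x :: "real^'n::finite"
  shows "ennreal ((1 / 2) ^ CARD('n) / hyp_mod x) \<le>
    strong_maximal (indicator {x. \<forall>i. \<bar>x $ i\<bar> < 1}) x"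
proof -
  let ?Q = "{x :: real^'n. \<forall>i. \<bar>x $ i\<bar> < 1}"
  define r where "r i = 2 * max 1 \<bar>x $ i\<bar>" for i
  have r: "2 \<le> r i" "\<bar>x $ i\<bar> < r i" for i by (auto simp: r_def max_def)
  define R where "R = box (\<chi> i. - r i) (\<chi> i. r i)"
  have lt: "(\<chi> i. - r i) $ i < (\<chi> i. r i) $ i" for i using r(1)[of i] by simp
  have R: "R \<in> rectangles" unfolding rectangles_def R_def using lt by blast
  have xR: "x \<in> R" unfolding R_def using r(2) by (auto simp: mem_box_cart abs_less_iff) (metis minus_less_iff)
  have Q: "?Q = box (\<chi> i. - 1) (\<chi> i. 1)" by (auto simp: mem_box_cart abs_less_iff)
  have QR: "?Q \<subseteq> R"
  proof
    fix y assume "y \<in> ?Q"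
    then have "\<bar>y $ i\<bar> < r i" for i using r(1)[of i] by (auto intro: less_le_trans)
    then show "y \<in> R" unfolding R_def by (auto simp: mem_box_cart abs_less_iff) (metis minus_less_iff)
  qed
  have eQ: "emeasure lborel ?Q = ennreal (2 ^ CARD('n))"
    unfolding Q by (subst emeasure_lborel_rectangle) auto
  have eR: "emeasure lborel R = ennreal (4 ^ CARD('n) * hyp_mod x)"
  proof -
    have "emeasure lborel R = ennreal (\<Prod>i\<in>UNIV. 4 * max 1 \<bar>x $ i\<bar>)"
      unfolding R_def by (subst emeasure_lborel_rectangle[OF lt]) (simp add: r_def)
    also have "(\<Prod>i\<in>UNIV. 4 * max 1 \<bar>x $ i\<bar>) = 4 ^ CARD('n) * hyp_mod x"
      by (simp only: prod.distrib prod_constant hyp_mod_def)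
    finally show ?thesis .
  qed
  have h: "1 \<le> hyp_mod x" by (rule hyp_mod_ge_1)
  have "(\<integral>\<^sup>+y. ennreal \<bar>indicator ?Q y\<bar> * indicator R y \<partial>lborel) = (\<integral>\<^sup>+y. indicator ?Q y \<partial>lborel)"
    using QR by (intro nn_integral_cong) (auto simp: indicator_def)
  also have "\<dots> = ennreal (2 ^ CARD('n))"
    using eQ Q by (subst nn_integral_indicator) auto
  finally have "average R (\<lambda>y. ennreal \<bar>indicator ?Q y\<bar>) = ennreal (2 ^ CARD('n)) / ennreal (4 ^ CARD('n) * hyp_mod x)"
    using rectangle_borel[OF R] by (simp only: average_lborel eR)
  also have "\<dots> = ennreal (2 ^ CARD('n) / (4 ^ CARD('n) * hyp_mod x))"
    using h by (intro divide_ennreal) auto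
  also have "2 ^ CARD('n) / (4 ^ CARD('n) * hyp_mod x) = (1 / 2) ^ CARD('n) / hyp_mod x"
  proof -
    have "(4 :: real) ^ CARD('n) = 2 ^ CARD('n) * 2 ^ CARD('n)" by (simp flip: power_mult_distrib)
    then show ?thesis by (simp add: power_one_over)
  qed
  finally have "ennreal ((1 / 2) ^ CARD('n) / hyp_mod x) = average R (\<lambda>y. ennreal \<bar>indicator ?Q y\<bar>)" by simp
  also have "\<dots> \<le> strong_maximal (indicator ?Q) x"
    unfolding strong_maximal_def using R xR by (intro SUP_upper) auto
  finally show ?thesis .
qed

lemma epowr_less_top: "epowr x p < \<infinity> \<longleftrightarrow> x < \<infinity>"
  by (auto simp: epowr_def ext_infty_def less_top)

lemma epowr_mono:
  assumes "0 < p" "x \<le> y" shows "epowr x p \<le> epowr y p"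
proof (cases "y = \<infinity>")
  case False
  then have "x \<noteq> \<infinity>" using assms by (auto simp: top_unique)
  have "enn2real x \<le> enn2real y" using False assms by (intro enn2real_mono) (auto simp: less_top)
  then show ?thesis using False \<open>x \<noteq> \<infinity>\<close> assms
    by (auto simp: epowr_def ext_infty_def intro!: ennreal_leI powr_mono2)
qed (simp add: epowr_def ext_infty_def)

text \<open>
The boundedness for the test pair is applied to the indicator of the open unit cube, on which the
weight v^p is bounded.
\<close>

theorem bump_necessary:
  fixes \<Phi> :: "real \<Rightarrow> real"
  assumes p: "1 < p" and Y: "young_function \<Phi>"
    and bounded: "strong_maximal_bounded p (\<lambda>x :: real^'n::finite. quad_weight x powr p)
      (\<lambda>x. young_inverse \<Phi> (hyp_mod x) powr p)"
  shows "B_star CARD('n) p (complementary \<Phi>)"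
proof (rule hyperbolic_integral_imp_B_star[OF _ Y])
  let ?Q = "{x :: real^'n. \<forall>i. \<bar>x $ i\<bar> < 1}"
  let ?v = "\<lambda>x :: real^'n. quad_weight x powr p"
  let ?u = "\<lambda>x :: real^'n. young_inverse \<Phi> (hyp_mod x) powr p"
  have p0: "0 < p" using p by simp
  show "0 < p" by fact
  obtain C where C: "\<And>f. f \<in> borel_measurable lebesgue \<Longrightarrow>
      weighted_Lp_norm p ?v (\<lambda>x. ennreal \<bar>f x\<bar>) < \<infinity> \<Longrightarrow>
      weighted_Lp_norm p ?u (strong_maximal f) \<le> ennreal C * weighted_Lp_norm p ?v (\<lambda>x. ennreal \<bar>f x\<bar>)"
    using bounded unfolding strong_maximal_bounded_def by blast
  have leb: "borel_measurable (borel :: (real^'n) measure) \<subseteq> borel_measurable lebesgue"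
    by (auto intro: measurable_completion)
  have Q: "?Q = box (\<chi> i. - 1) (\<chi> i. 1)" by (auto simp: mem_box_cart abs_less_iff)
  then have Qr: "?Q \<in> rectangles" unfolding rectangles_def by force
  have [measurable]: "?Q \<in> sets borel" by (rule rectangle_borel[OF Qr])
  have Qm: "(indicator ?Q :: _ \<Rightarrow> real) \<in> borel_measurable lebesgue" by (simp add: borel_measurable_indicator)
  have Qm': "(indicator ?Q :: _ \<Rightarrow> ennreal) \<in> borel_measurable lebesgue"
    by (rule borel_measurable_indicator) simp
  have vm: "(\<lambda>x :: real^'n. ennreal (?v x)) \<in> borel_measurable lebesgue" 
    by (rule measurable_completion) measurable
  note measurable_young_inverse[OF Y, measurable]
  have um: "(\<lambda>x :: real^'n. ennreal (?u x)) \<in> borel_measurable lebesgue"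
    by (rule measurable_completion) measurable
  have "(\<integral>\<^sup>+x. epowr (ennreal \<bar>indicator ?Q x\<bar>) p \<partial>density lebesgue (\<lambda>x. ennreal (?v x))) =
      (\<integral>\<^sup>+x. indicator ?Q x \<partial>density lebesgue (\<lambda>x. ennreal (?v x)))"
    using p0 by (intro nn_integral_cong) (auto simp: indicator_def epowr_def ext_infty_def)
  also have "\<dots> = (\<integral>\<^sup>+x. ennreal (?v x) * indicator ?Q x \<partial>lborel)"
    by (simp only: nn_integral_density[OF vm Qm'] nn_integral_completion)
  also have "\<dots> \<le> (\<integral>\<^sup>+x. ennreal ((2 ^ CARD('n)) powr p) * indicator ?Q x \<partial>lborel)"
  proof (intro nn_integral_mono)
    fix x :: "real^'n"
    have "quad_weight x \<le> 2 ^ CARD('n)" if "x \<in> ?Q"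
    proof -
      have "quad_weight x \<le> (\<Prod>i\<in>(UNIV :: 'n set). 2)"
        unfolding quad_weight_def
      proof (intro prod_mono conjI)
        fix i
        have "(x $ i)\<^sup>2 \<le> 1" using that by (auto simp: abs_square_le_1 less_imp_le)
        then show "1 + (x $ i)\<^sup>2 \<le> 2" by simp
      qed auto
      then show ?thesis by simp
    qed
    then show "ennreal (?v x) * indicator ?Q x \<le> ennreal ((2 ^ CARD('n)) powr p) * indicator ?Q x"
      using quad_weight_ge_1[of x] p0 by (auto simp: indicator_def intro!: ennreal_leI powr_mono2)
  qed
  also have "\<dots> = ennreal ((2 ^ CARD('n)) powr p) * emeasure lborel ?Q"
    by (subst nn_integral_cmult_indicator) auto
  also have "\<dots> < \<infinity>" using rectangle_measure(2)[OF Qr] by (simp add: ennreal_mult_less_top less_top)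
  finally have vfin: "weighted_Lp_norm p ?v (\<lambda>x. ennreal \<bar>indicator ?Q x\<bar>) < \<infinity>"
    unfolding weighted_Lp_norm_def epowr_less_top .
  have "weighted_Lp_norm p ?u (strong_maximal (indicator ?Q)) < \<infinity>"
    using C[OF Qm vfin] vfin by (auto simp: ennreal_mult_less_top intro: le_less_trans)
  then have fin: "(\<integral>\<^sup>+x. epowr (strong_maximal (indicator ?Q) x) p \<partial>density lebesgue (\<lambda>x. ennreal (?u x))) < \<infinity>"
    unfolding weighted_Lp_norm_def epowr_less_top .
  define \<kappa> where "\<kappa> = (1 / 2 :: real) ^ CARD('n)"
  have \<kappa>: "0 < \<kappa>" by (simp add: \<kappa>_def)
  let ?I = "\<integral>\<^sup>+x. ennreal ((young_inverse \<Phi> (hyp_mod x) / hyp_mod (x :: real^'n)) powr p) \<partial>lborel"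
  have km: "(\<lambda>x :: real^'n. ennreal ((\<kappa> / hyp_mod x) powr p)) \<in> borel_measurable lebesgue"
    by (rule measurable_completion) measurable
  have "ennreal (\<kappa> powr p) * ?I =
      (\<integral>\<^sup>+x. ennreal (\<kappa> powr p) * ennreal ((young_inverse \<Phi> (hyp_mod x) / hyp_mod (x :: real^'n)) powr p) \<partial>lborel)"
    by (rule nn_integral_cmult[symmetric]) measurable
  also have "\<dots> = (\<integral>\<^sup>+x. ennreal (?u x) * ennreal ((\<kappa> / hyp_mod x) powr p) \<partial>lborel)"
  proof (rule nn_integral_cong)
    fix x :: "real^'n"
    show "ennreal (\<kappa> powr p) * ennreal ((young_inverse \<Phi> (hyp_mod x) / hyp_mod x) powr p) =
      ennreal (?u x) * ennreal ((\<kappa> / hyp_mod x) powr p)"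
      using \<kappa> hyp_mod_ge_1[of x] young_inverse(1)[OF Y, of "hyp_mod x"]
      by (simp add: powr_divide flip: ennreal_mult)
  qed
  also have "\<dots> = (\<integral>\<^sup>+x. ennreal ((\<kappa> / hyp_mod x) powr p) \<partial>density lebesgue (\<lambda>x. ennreal (?u x)))"
    by (simp only: nn_integral_density[OF um km] nn_integral_completion)
  also have "\<dots> \<le> (\<integral>\<^sup>+x. epowr (strong_maximal (indicator ?Q) x) p \<partial>density lebesgue (\<lambda>x. ennreal (?u x)))"
  proof (rule nn_integral_mono)
    fix x :: "real^'n"
    have "ennreal ((\<kappa> / hyp_mod x) powr p) = epowr (ennreal (\<kappa> / hyp_mod x)) p"
      using \<kappa> hyp_mod_ge_1[of x] by (simp add: epowr_def ext_infty_def)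
    also have "\<dots> \<le> epowr (strong_maximal (indicator ?Q) x) p"
      unfolding \<kappa>_def by (intro epowr_mono p0 strong_maximal_cube_lower)
    finally show "ennreal ((\<kappa> / hyp_mod x) powr p) \<le> epowr (strong_maximal (indicator ?Q) x) p" .
  qed
  finally have "ennreal (\<kappa> powr p) * ?I < \<infinity>" using fin by (rule le_less_trans)
  then show "?I < \<infinity>" using \<kappa> by (auto simp: ennreal_mult_less_top)
qed

section \<open>The characterization\<close>

theorem theorem1p2:
  fixes p :: real and \<Phi> :: "real \<Rightarrow> real"
  assumes "1 < p" and "young_function \<Phi>"
  shows
    "(B_star CARD('n) p (complementary \<Phi>) \<longrightarrow>
       (\<forall>(u :: real ^ 'n \<Rightarrow> real) (v :: real ^ 'n \<Rightarrow> real).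
          weight u \<and> weight v \<and> condition_A (\<lambda>x. u x powr p) \<and>
          (\<exists>K>0. bump_condition p \<Phi> u v K) \<longrightarrow>
          (\<exists>C::real. 0 < C \<and>
            (\<forall>f\<in>borel_measurable lebesgue. (\<forall>x. 0 \<le> f x) \<longrightarrow>
               (\<integral>\<^sup>+x. epowr (ennreal (u x) * strong_maximal f x) p \<partial>lebesgue)
                 \<le> ennreal C * (\<integral>\<^sup>+x. ennreal ((v x * f x) powr p) \<partial>lebesgue)))))
     \<and>
     ((\<forall>(u :: real ^ 'n \<Rightarrow> real) (v :: real ^ 'n \<Rightarrow> real).
          weight u \<and> weight v \<and> (\<exists>K>0. bump_condition p \<Phi> u v K) \<longrightarrow>
          strong_maximal_bounded p (\<lambda>x. v x powr p) (\<lambda>x. u x powr p)) \<longrightarrow>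
       B_star CARD('n::finite) p (complementary \<Phi>))"
proof (intro conjI impI allI)
  fix u v :: "real^'n \<Rightarrow> real"
  assume "B_star CARD('n) p (complementary \<Phi>)"
    and "weight u \<and> weight v \<and> condition_A (\<lambda>x. u x powr p) \<and> (\<exists>K>0. bump_condition p \<Phi> u v K)"
  then show "\<exists>C::real. 0 < C \<and>
      (\<forall>f\<in>borel_measurable lebesgue. (\<forall>x. 0 \<le> f x) \<longrightarrow>
        (\<integral>\<^sup>+x. epowr (ennreal (u x) * strong_maximal f x) p \<partial>lebesgue)
          \<le> ennreal C * (\<integral>\<^sup>+x. ennreal ((v x * f x) powr p) \<partial>lebesgue))"
    using bump_sufficient[OF assms] by blast
next
  assume H: "\<forall>(u :: real ^ 'n \<Rightarrow> real) (v :: real ^ 'n \<Rightarrow> real).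
      weight u \<and> weight v \<and> (\<exists>K>0. bump_condition p \<Phi> u v K) \<longrightarrow>
      strong_maximal_bounded p (\<lambda>x. v x powr p) (\<lambda>x. u x powr p)"
  have "bump_condition p \<Phi> (\<lambda>x :: real^'n. young_inverse \<Phi> (hyp_mod x)) quad_weight (8 ^ CARD('n))"
    using assms by (intro bump_condition_test_pair) auto
  then have "\<exists>K>0. bump_condition p \<Phi> (\<lambda>x :: real^'n. young_inverse \<Phi> (hyp_mod x)) quad_weight K"
    by (intro exI[of _ "8 ^ CARD('n)"]) simp
  then have "strong_maximal_bounded p (\<lambda>x :: real^'n. quad_weight x powr p) (\<lambda>x. young_inverse \<Phi> (hyp_mod x) powr p)"
    using H weight_young_inverse_hyp_mod[OF assms(2)] weight_quad_weight by blast
  then show "B_star CARD('n) p (complementary \<Phi>)" by (rule bump_necessary[OF assms])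
qed

end
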